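(* Let $\sigma$ be a partition of the set of all primes and let $G$ be a finite group. (i) If in every maximal chain $M_3<M_2<M_1<M_0=G$ of $G$ of length $3$, one of $M_3$, $M_2$ and $M_1$ is $\sigma$-subnormal in $G$, then $G$ is $\sigma$-soluble. (ii) If $1<m_\sigma(G)\leq 3$, then $G$ is soluble.
   Context: All groups are finite. $\sigma=\{\sigma_i\mid i\in I\}$, $I\subseteq\mathbb{N}$, is a partition of the set $\mathbb{P}$ of all primes: $\mathbb{P}=\bigcup_{i\in I}\sigma_i$ and $\sigma_i\cap\sigma_j=\emptyset$ for $i\neq j$. A group is $\sigma$-primary if it is a $\sigma_i$-group for some $i$ (all primes dividing its order lie in a single $\sigma_i$); it is $\sigma$-soluble if every chief factor of it is $\sigma$-primary. A subgroup $A$ of $G$ is $\sigma$-subnormal in $G$ if there is a subgroup chain $A=A_0\leq A_1\leq\cdots\leq A_t=G$ such that for each $i=1,\ldots,t$ either $A_{i-1}\trianglelefteq A_i$ or $A_i/(A_{i-1})_{A_i}$ is $\sigma$-primary, where $(A_{i-1})_{A_i}$ is the largest normal subgroup of $A_i$ contained in $A_{i-1}$. A maximal chain of $G$ of length $n$ is a chain $M_n<M_{n-1}<\cdots<M_1<M_0=G$ with $M_i$ a maximal subgroup of $M_{i-1}$ for all $i=1,\ldots,n$; then $M_n$ ($n>0$) is called an $n$-maximal subgroup of $G$. One writes $m_\sigma(G)=n$ if each $n$-maximal subgroup of $G$ is $\sigma$-subnormal in $G$ but, in the case $n>1$, some $(n-1)$-maximal subgroup is not $\sigma$-subnormal in $G$.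 *)

theory Defs
  imports
    "HOL-Algebra.Solvable_Groups"
    "HOL-Computational_Algebra.Primes"
    "HOL-Library.Disjoint_Sets"
begin

text \<open>
  A partition of the primes is given as its set of classes,
  \<open>partition_on {p. prime p} \<sigma>\<close> with \<open>\<sigma> :: nat set set\<close>. A subgroup \<open>H\<close> of \<open>G\<close>, viewed
  as a group in its own right, is \<open>G\<lparr>carrier := H\<rparr>\<close>.
\<close>

definition pi_group :: "nat set \<Rightarrow> ('a, 'b) monoid_scheme \<Rightarrow> bool" where
  "pi_group \<pi> G \<longleftrightarrow> (\<forall>p. Factorial_Ring.prime p \<and> p dvd order G \<longrightarrow> p \<in> \<pi>)"

definition sigma_primary :: "nat set set \<Rightarrow> ('a, 'b) monoid_scheme \<Rightarrow> bool" where
  "sigma_primary \<sigma> G \<longleftrightarrow> (\<exists>\<pi>\<in>\<sigma>. pi_group \<pi> G)"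

text \<open>\<open>H/K\<close> is a chief factor of \<open>G\<close>: \<open>H/K\<close> is a minimal normal subgroup of \<open>G/K\<close>.\<close>

definition chief_factor :: "('a, 'b) monoid_scheme \<Rightarrow> 'a set \<Rightarrow> 'a set \<Rightarrow> bool" where
  "chief_factor G H K \<longleftrightarrow> H \<lhd> G \<and> K \<lhd> G \<and> K \<subset> H \<and> (\<nexists>N. N \<lhd> G \<and> K \<subset> N \<and> N \<subset> H)"

definition sigma_soluble :: "nat set set \<Rightarrow> ('a, 'b) monoid_scheme \<Rightarrow> bool" where
  "sigma_soluble \<sigma> G \<longleftrightarrow>
     (\<forall>H K. chief_factor G H K \<longrightarrow> sigma_primary \<sigma> (G\<lparr>carrier := H\<rparr> Mod K))"

definition core :: "('a, 'b) monoid_scheme \<Rightarrow> 'a set \<Rightarrow> 'a set" where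
  "core G A = (GREATEST N. N \<lhd> G \<and> N \<subseteq> A)"

text \<open>For a subgroup \<open>A\<close> the greatest element, with respect to inclusion, does exist.\<close>

lemma (in group) core_greatest:
  assumes A: "subgroup A G"
  shows "core G A \<lhd> G" and "core G A \<subseteq> A"
    and "\<And>N. N \<lhd> G \<Longrightarrow> N \<subseteq> A \<Longrightarrow> N \<subseteq> core G A"
proof -
  define C where "C = {x \<in> carrier G. \<forall>g\<in>carrier G. g \<otimes> x \<otimes> inv g \<in> A}"
  have subC: "subgroup C G"
  proof (rule subgroupI)
    show "C \<subseteq> carrier G" by (auto simp: C_def)
    have "\<one> \<in> C" using subgroup.one_closed[OF A] by (auto simp: C_def)
    then show "C \<noteq> {}" by blast
  next
    fix a assume a: "a \<in> C"
    have "g \<otimes> inv a \<otimes> inv g \<in> A" if g: "g \<in> carrier G" for g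
    proof -
      have "inv (g \<otimes> a \<otimes> inv g) \<in> A"
        using a g subgroup.m_inv_closed[OF A] by (auto simp: C_def)
      moreover have "inv (g \<otimes> a \<otimes> inv g) = g \<otimes> inv a \<otimes> inv g"
        using a g by (simp add: C_def inv_mult_group m_assoc)
      ultimately show ?thesis by simp
    qed
    then show "inv a \<in> C" using a by (auto simp: C_def)
  next
    fix a b assume a: "a \<in> C" and b: "b \<in> C"
    have "g \<otimes> (a \<otimes> b) \<otimes> inv g \<in> A" if g: "g \<in> carrier G" for g
    proof -
      have "(g \<otimes> a \<otimes> inv g) \<otimes> (g \<otimes> b \<otimes> inv g) \<in> A"
        using a b g subgroup.m_closed[OF A] by (auto simp: C_def)
      moreover have "(g \<otimes> a \<otimes> inv g) \<otimes> (g \<otimes> b \<otimes> inv g) = g \<otimes> (a \<otimes> b) \<otimes> inv g"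
        using a b g by (simp add: C_def m_assoc inv_solve_left')
      ultimately show ?thesis by simp
    qed
    then show "a \<otimes> b \<in> C" using a b by (auto simp: C_def)
  qed
  have C: "C \<lhd> G"
  proof (rule normal_invI[OF subC])
    fix x h assume x: "x \<in> carrier G" and h: "h \<in> C"
    have "g \<otimes> (x \<otimes> h \<otimes> inv x) \<otimes> inv g \<in> A" if g: "g \<in> carrier G" for g
    proof -
      have "(g \<otimes> x) \<otimes> h \<otimes> inv (g \<otimes> x) \<in> A" using h g x by (auto simp: C_def)
      moreover have "(g \<otimes> x) \<otimes> h \<otimes> inv (g \<otimes> x) = g \<otimes> (x \<otimes> h \<otimes> inv x) \<otimes> inv g"
        using h g x by (simp add: C_def inv_mult_group m_assoc)
      ultimately show ?thesis by simp
    qed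
    then show "x \<otimes> h \<otimes> inv x \<in> C" using h x by (auto simp: C_def)
  qed
  have CA: "C \<subseteq> A" by (force simp: C_def dest: bspec[where x = \<one>])
  have max: "N \<subseteq> C" if N: "N \<lhd> G" "N \<subseteq> A" for N
    using N normal.inv_op_closed2[OF N(1)] subgroup.subset[OF normal_imp_subgroup[OF N(1)]]
    by (auto simp: C_def)
  have "core G A = C"
    unfolding core_def by (rule Greatest_equality) (use C CA max in auto)
  then show "core G A \<lhd> G" "core G A \<subseteq> A" "\<And>N. N \<lhd> G \<Longrightarrow> N \<subseteq> A \<Longrightarrow> N \<subseteq> core G A"
    using C CA max by auto
qed

definition sigma_subnormal :: "nat set set \<Rightarrow> ('a, 'b) monoid_scheme \<Rightarrow> 'a set \<Rightarrow> bool" where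
  "sigma_subnormal \<sigma> G A \<longleftrightarrow>
     (\<exists>(t::nat) B. B 0 = A \<and> B t = carrier G \<and> (\<forall>i\<le>t. subgroup (B i) G) \<and>
        (\<forall>i\<in>{1..t}. B (i - 1) \<subseteq> B i \<and>
           (B (i - 1) \<lhd> G\<lparr>carrier := B i\<rparr> \<or>
            sigma_primary \<sigma> (G\<lparr>carrier := B i\<rparr> Mod core (G\<lparr>carrier := B i\<rparr>) (B (i - 1))))))"

definition maximal_subgroup :: "'a set \<Rightarrow> ('a, 'b) monoid_scheme \<Rightarrow> bool" where
  "maximal_subgroup M G \<longleftrightarrow> subgroup M G \<and> M \<noteq> carrier G \<and>
     (\<forall>K. subgroup K G \<longrightarrow> M \<subseteq> K \<longrightarrow> K = M \<or> K = carrier G)"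

definition maximal_chain :: "('a, 'b) monoid_scheme \<Rightarrow> nat \<Rightarrow> (nat \<Rightarrow> 'a set) \<Rightarrow> bool" where
  "maximal_chain G n M \<longleftrightarrow> M 0 = carrier G \<and>
     (\<forall>i\<in>{1..n}. maximal_subgroup (M i) (G\<lparr>carrier := M (i - 1)\<rparr>))"

definition n_maximal_subgroup :: "('a, 'b) monoid_scheme \<Rightarrow> nat \<Rightarrow> 'a set \<Rightarrow> bool" where
  "n_maximal_subgroup G n H \<longleftrightarrow> n > 0 \<and> (\<exists>M. maximal_chain G n M \<and> M n = H)"

text \<open>\<open>m_sigma_eq \<sigma> G n\<close> is the relation written \<open>m\<^sub>\<sigma>(G) = n\<close>.\<close>

definition m_sigma_eq :: "nat set set \<Rightarrow> ('a, 'b) monoid_scheme \<Rightarrow> nat \<Rightarrow> bool" where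
  "m_sigma_eq \<sigma> G n \<longleftrightarrow> n > 0 \<and>
     (\<forall>H. n_maximal_subgroup G n H \<longrightarrow> sigma_subnormal \<sigma> G H) \<and>
     (n > 1 \<longrightarrow> (\<exists>H. n_maximal_subgroup G (n - 1) H \<and> \<not> sigma_subnormal \<sigma> G H))"

end

theory Submission
  imports Defs "HOL-Algebra.Sylow" "HOL-Algebra.Group_Action" "HOL-Algebra.Multiplicative_Group"
begin

text \<open>
  The engine is a coprimality argument: if \<open>A\<close> is \<open>\<sigma>\<close>-subnormal in \<open>G\<close>, \<open>N\<close> is a normal
  \<open>\<sigma>\<^sub>i\<close>-subgroup and \<open>p \<notin> \<sigma>\<^sub>i\<close>, then all \<open>p\<close>-elements of \<open>AN\<close> lie in \<open>A\<close>; if instead \<open>N\<close> is minimal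
  normal, not \<open>\<sigma>\<close>-primary, and \<open>A\<close> contains a nontrivial Sylow subgroup of \<open>N\<close>, then \<open>N \<subseteq> A\<close>.

  For (i), let \<open>N\<close> be a minimal normal subgroup that is not \<open>\<sigma>\<close>-primary, with trivial centralizer, and
  \<open>Q\<close> a Sylow subgroup of \<open>N\<close>. By the Frattini argument a maximal subgroup \<open>L\<close> containing \<open>N\<^sub>G(Q)\<close>
  satisfies \<open>NL = G\<close>. Nothing between \<open>Q\<close> and \<open>L\<close> is \<open>\<sigma>\<close>-subnormal, so the hypothesis on chains forces \<open>Q\<close> to be
  \<open>L\<close> or maximal in \<open>L\<close>. One then finds a prime for which \<open>Q\<close> is abelian and central in its normalizer,
  and Burnside's transfer theorem gives \<open>N\<close> a normal complement to \<open>Q\<close>, a contradiction.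

  For (ii), let \<open>M\<close> be a maximal subgroup that is not \<open>\<sigma>\<close>-subnormal and \<open>N/M\<^sub>G\<close> a chief factor, a
  \<open>\<sigma>\<^sub>i\<close>-group by (i). For a prime \<open>p \<notin> \<sigma>\<^sub>i\<close> dividing the order of \<open>G/M\<^sub>G\<close>, no \<open>\<sigma>\<close>-subnormal subgroup lies between a Sylow
  \<open>p\<close>-subgroup \<open>P\<close> of \<open>M\<close> and \<open>M\<close>. Hence \<open>P = M\<close>, or \<open>P\<close> is cyclic and maximal in \<open>M\<close>, and a group with a cyclic
  maximal \<open>p\<close>-subgroup is soluble by Burnside's theorem. If all maximal subgroups are \<open>\<sigma>\<close>-subnormal,
  the same analysis is applied inside a maximal subgroup \<open>M\<close> that has a maximal subgroup not \<open>\<sigma>\<close>-subnormal in \<open>G\<close>.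
\<close>

section \<open>Finite groups\<close>

text \<open>Both parts rest on quotients: preimages of maximal chains are maximal chains and images
  of \<sigma>-subnormal subgroups are \<sigma>-subnormal, so the hypotheses pass to the quotient by
  the centralizer of \<open>N\<close> and to the quotient by the core of \<open>M\<close>. The
  obstacle in (i) is to get \<open>Q\<close> abelian and central in its normalizer. If
  \<open>N = G\<close>, proper \<sigma>-subnormal subgroups are trivial, so a chain of length 3
  cannot end above the centre of \<open>Q\<close>; and for the least prime \<open>q\<close>, a
  \<open>Q\<close> of order \<open>q\<close> cannot be acted on nontrivially by its normalizer. If
  \<open>N\<close> is proper, a prime \<open>p\<close> dividing the index of \<open>N\<close> and
  another prime \<open>q\<close> of \<open>N\<close> make \<open>Q\<close> and a Sylow
  \<open>p\<close>-subgroup \<open>P\<close> both maximal in \<open>L\<close>; then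
  \<open>L = Z(Q) P\<close>, so \<open>Q = Z(Q)\<close>. In (ii), a \<sigma>-subnormal subgroup
  between \<open>P\<close> and \<open>M\<close> would force all \<open>p\<close>-elements of the
  core-free quotient into the image of \<open>M\<close>, where they would generate a nontrivial
  normal subgroup. Coprimality is applied throughout to exponents of single elements, which needs
  only a subgroup to test membership in.\<close>

lemma group_actionI:
  fixes G (structure)
  assumes "group G"
    and closed: "\<And>g x. g \<in> carrier G \<Longrightarrow> x \<in> E \<Longrightarrow> f g x \<in> E"
    and one: "\<And>x. x \<in> E \<Longrightarrow> f \<one> x = x"
    and mult: "\<And>g h x. g \<in> carrier G \<Longrightarrow> h \<in> carrier G \<Longrightarrow> x \<in> E \<Longrightarrow> f (g \<otimes> h) x = f g (f h x)"
  shows "group_action G E (\<lambda>g. restrict (f g) E)"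
proof -
  interpret group G by fact
  \<comment> \<open>\<open>Bij E\<close> contains only extensional maps, hence the
    \<open>restrict\<close>.\<close>
  have bij: "restrict (f g) E \<in> Bij E" if g: "g \<in> carrier G" for g
  proof -
    have "bij_betw (f g) E E"
      by (rule bij_betw_byWitness[where f' = "f (inv g)"])
        (use g closed one mult[of g "inv g"] mult[of "inv g" g] in auto)
    then show ?thesis
      by (simp add: Bij_def)
  qed
  have "(\<lambda>g. restrict (f g) E) \<in> hom G (BijGroup E)"
    by (rule homI) (use bij closed mult in \<open>auto simp: BijGroup_def compose_def fun_eq_iff\<close>)
  then show ?thesis
    by (intro group_action.intro group_hom.intro group_hom_axioms.intro group_BijGroup) auto
qed

text \<open>The moved points form a union of orbits of size greater than 1, and such a size is a
  positive power of \<open>p\<close>. Counting moved points yields a fixed point whenever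
  \<open>p\<close> does not divide \<open>card E\<close>.\<close>

lemma prime_power_group_dvd_card_moved:
  fixes G (structure)
  assumes "group G" and p: "prime p" and ord: "order G = p ^ k" and fin: "finite E"
    and closed: "\<And>g x. g \<in> carrier G \<Longrightarrow> x \<in> E \<Longrightarrow> f g x \<in> E"
    and one: "\<And>x. x \<in> E \<Longrightarrow> f \<one> x = x"
    and mult: "\<And>g h x. g \<in> carrier G \<Longrightarrow> h \<in> carrier G \<Longrightarrow> x \<in> E \<Longrightarrow> f (g \<otimes> h) x = f g (f h x)"
  shows "p dvd card {x \<in> E. \<exists>g\<in>carrier G. f g x \<noteq> x}"
proof -
  define \<phi> where "\<phi> = (\<lambda>g. restrict (f g) E)"
  interpret group_action G E \<phi>
    unfolding \<phi>_def by (rule group_actionI) (use assms in auto)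
  interpret group G by fact
  define M where "M = {x \<in> E. \<exists>g\<in>carrier G. f g x \<noteq> x}"
  define C where "C = {orbit G \<phi> x | x. x \<in> M}"
  have orbE: "orbit G \<phi> x \<subseteq> E" if "x \<in> E" for x
    using that closed by (auto simp: orbit_def \<phi>_def)
  have sub: "orbit G \<phi> x \<subseteq> M" if "x \<in> M" for x
  proof
    fix y assume y: "y \<in> orbit G \<phi> x"
    have xE: "x \<in> E" using that by (simp add: M_def)
    then have yE: "y \<in> E" using y orbE by blast
    have "x \<in> orbit G \<phi> y" using orbit_sym[OF xE yE y] .
    then obtain g where g: "g \<in> carrier G" "f g y = x" using yE by (auto simp: orbit_def \<phi>_def)
    show "y \<in> M"
    proof (rule ccontr)
      assume "y \<notin> M"
      then have fx: "\<forall>g\<in>carrier G. f g y = y" using yE by (auto simp: M_def)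
      then have "x = y" using g by auto
      with fx that show False by (auto simp: M_def)
    qed
  qed
  have "\<Union>C = M"
    using sub orbit_refl by (fastforce simp: C_def M_def)
  moreover have "p dvd card c" if c: "c \<in> C" for c
  proof -
    obtain x where x: "x \<in> M" "c = orbit G \<phi> x" using c unfolding C_def by blast
    have xE: "x \<in> E" using x by (simp add: M_def)
    have "card c dvd p ^ k"
      using orbit_stabilizer_theorem[OF xE] ord x by (metis dvd_triv_left)
    then obtain j where j: "card c = p ^ j" using p by (meson divides_primepow_nat)
    have "j \<noteq> 0"
    proof
      assume "j = 0"
      then have "card c = 1" using j by simp
      then obtain z where "c = {z}" by (auto simp: card_1_singleton_iff)
      moreover have "x \<in> c" using orbit_refl[OF xE] x by simp
      ultimately have "c = {x}" by auto
      then have "f g x = x" if "g \<in> carrier G" for g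
        using that x(2) xE by (auto simp: orbit_def \<phi>_def)
      then show False using x by (auto simp: M_def)
    qed
    then show ?thesis using j by simp
  qed
  moreover have "c \<inter> d = {}" if "c \<in> C" "d \<in> C" "c \<noteq> d" for c d
  proof -
    have "c \<in> orbits G E \<phi>" "d \<in> orbits G E \<phi>" using that by (auto simp: C_def orbits_def M_def)
    then show ?thesis using disjoint_union that by blast
  qed
  moreover have "finite M" using fin by (simp add: M_def)
  ultimately have "p dvd card M"
    using dvd_partition[of C p] by (metis)
  then show ?thesis by (simp add: M_def)
qed

section \<open>Subgroups, powers modulo a normal subgroup, and products of subgroups\<close>

locale finite_group = group +
  assumes finite_carrier: "finite (carrier G)"
begin

lemma mult_inv_cancel_left [simp]:
  "x \<in> carrier G \<Longrightarrow> y \<in> carrier G \<Longrightarrow> x \<otimes> (inv x \<otimes> y) = y"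
  "x \<in> carrier G \<Longrightarrow> y \<in> carrier G \<Longrightarrow> inv x \<otimes> (x \<otimes> y) = y"
  by (simp_all add: m_assoc[symmetric])

lemmas group_normalize = m_assoc inv_mult_group

abbreviation normalizes :: "'a set \<Rightarrow> 'a set \<Rightarrow> bool" where
  "normalizes B A \<equiv> \<forall>b\<in>B. \<forall>a\<in>A. b \<otimes> a \<otimes> inv b \<in> A"

definition conjug :: "'a \<Rightarrow> 'a set \<Rightarrow> 'a set" where
  "conjug g A = (\<lambda>x. g \<otimes> x \<otimes> inv g) ` A"

lemma subgroup_finite: "subgroup A G \<Longrightarrow> finite A"
  using finite_carrier finite_subset subgroup.subset by blast

lemma subgroup_card_pos: "subgroup A G \<Longrightarrow> card A > 0"
  using subgroup_finite subgroup.one_closed card_gt_0_iff by blast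

lemma finite_group_subgroup:
  assumes "subgroup A G"
  shows "finite_group (G\<lparr>carrier := A\<rparr>)"
  by (intro finite_group.intro finite_group_axioms.intro)
    (use assms subgroup_finite subgroup_imp_group in auto)

lemma subgroup_restrict_iff:
  assumes "subgroup B G"
  shows "subgroup A (G\<lparr>carrier := B\<rparr>) \<longleftrightarrow> subgroup A G \<and> A \<subseteq> B"
proof
  assume A: "subgroup A (G\<lparr>carrier := B\<rparr>)"
  then show "subgroup A G \<and> A \<subseteq> B"
    using incl_subgroup[OF assms A] subgroup.subset[OF A] by simp
qed (use assms subgroup_incl in blast)

lemma normal_restrict_iff:
  assumes B: "subgroup B G"
  shows "A \<lhd> G\<lparr>carrier := B\<rparr> \<longleftrightarrow> subgroup A G \<and> A \<subseteq> B \<and> (normalizes B A)"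
proof -
  interpret B: group "G\<lparr>carrier := B\<rparr>" using B subgroup_imp_group by blast
  show ?thesis
    using B by (auto simp: B.normal_inv_iff subgroup_restrict_iff m_inv_consistent)
qed

lemma subgroup_card_dvd:
  assumes A: "subgroup A G" and B: "subgroup B G" and AB: "A \<subseteq> B"
  shows "card A dvd card B"
proof -
  interpret B: group "G\<lparr>carrier := B\<rparr>" using B subgroup_imp_group by blast
  have "subgroup A (G\<lparr>carrier := B\<rparr>)" using assms subgroup_restrict_iff by blast
  from B.lagrange[OF this] have "card (rcosets\<^bsub>G\<lparr>carrier := B\<rparr>\<^esub> A) * card A = card B"
    by (simp add: order_def)
  then show ?thesis using dvd_triv_right by metis
qed

lemma subgroup_eqI_card:
  assumes "subgroup B G" "A \<subseteq> B" "card B \<le> card A"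
  shows "A = B"
  using assms subgroup_finite card_seteq by blast

lemma pow_in_subgroup: "subgroup A G \<Longrightarrow> x \<in> A \<Longrightarrow> x [^] (n::nat) \<in> A"
  by (induction n) (auto simp: subgroup.one_closed subgroup.m_closed)

lemma pow_card_subgroup:
  assumes A: "subgroup A G" and x: "x \<in> A"
  shows "x [^] card A = \<one>"
proof -
  interpret A: group "G\<lparr>carrier := A\<rparr>" using A subgroup_imp_group by blast
  have "x [^]\<^bsub>G\<lparr>carrier := A\<rparr>\<^esub> order (G\<lparr>carrier := A\<rparr>) = \<one>"
    using A.pow_order_eq_1 x by simp
  then show ?thesis by (simp add: order_def nat_pow_consistent[symmetric])
qed

text \<open>The exponents of \<^term>\<open>x\<close> that fall into \<^term>\<open>A\<close> form an ideal, so coprime ones give \<^term>\<open>x\<close> itself.\<close>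
lemma subgroup_pow_coprime:
  assumes A: "subgroup A G" and x: "x \<in> carrier G"
    and a: "x [^] (a::nat) \<in> A" and b: "x [^] (b::nat) \<in> A" and "coprime a b"
  shows "x \<in> A"
proof (cases "a = 0")
  case True
  then have "b = 1" using \<open>coprime a b\<close> by simp
  then show ?thesis using b x by simp
next
  case False
  then obtain u v where uv: "a * u = b * v + 1"
    using bezout_nat[of a b] \<open>coprime a b\<close> by (metis coprime_iff_gcd_eq_1)
  have "x [^] (a * u) \<in> A" using pow_in_subgroup[OF A a, of u] x by (simp add: nat_pow_pow)
  moreover have "x [^] (b * v) \<in> A" using pow_in_subgroup[OF A b, of v] x by (simp add: nat_pow_pow)
  moreover have "x = inv (x [^] (b * v)) \<otimes> x [^] (a * u)"
    unfolding uv using x by (simp add: nat_pow_mult[symmetric] m_assoc[symmetric])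
  ultimately show ?thesis
    using A by (metis subgroup.m_closed subgroup.m_inv_closed)
qed

lemma rcos_eq_mult_inv:
  assumes N: "subgroup N G" and x: "x \<in> carrier G" and y: "y \<in> carrier G" and eq: "N #> x = N #> y"
  shows "x \<otimes> inv y \<in> N"
proof -
  have "x \<in> N #> y" using rcos_self[OF x N] eq by simp
  then obtain n where n: "n \<in> N" "x = n \<otimes> y" by (auto simp: r_coset_def)
  then show ?thesis using y subgroup.mem_carrier[OF N n(1)] by (simp add: m_assoc)
qed

lemma pow_index_mem_normal:
  assumes N: "N \<lhd> G" and x: "x \<in> carrier G"
  shows "x [^] (card (carrier G) div card N) \<in> N"
proof -
  interpret N: normal N G by fact
  interpret Q: group "G Mod N" by (rule N.factorgroup_is_group)
  have sub: "subgroup N G" using N by (simp add: normal_imp_subgroup)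
  have ord: "order (G Mod N) = card (carrier G) div card N"
    using lagrange[OF sub] subgroup_card_pos[OF sub]
    by (simp add: FactGroup_def order_def) (metis div_mult_self_is_m)
  have "N #> x \<in> carrier (G Mod N)" using x by (auto simp: FactGroup_def RCOSETS_def)
  then have "(N #> x) [^]\<^bsub>G Mod N\<^esub> order (G Mod N) = N" using Q.pow_order_eq_1 by simp
  then have "N #> (x [^] order (G Mod N)) = N" using N.FactGroup_pow[OF x] by simp
  then show ?thesis
    using coset_join1[OF _ _ sub] x sub ord by (metis nat_pow_closed rcos_self)
qed

lemma pow_index_mem:
  assumes B: "subgroup B G" and N: "subgroup N G" "N \<subseteq> B" "normalizes B N" and x: "x \<in> B"
  shows "x [^] (card B div card N) \<in> N"
proof -
  interpret B: finite_group "G\<lparr>carrier := B\<rparr>" using B by (rule finite_group_subgroup)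
  have "N \<lhd> G\<lparr>carrier := B\<rparr>" using N normal_restrict_iff[OF B] by blast
  from B.pow_index_mem_normal[OF this] x show ?thesis
    by (simp add: nat_pow_consistent[symmetric])
qed

text \<open>The order of \<open>x\<close> modulo \<open>N\<close> divides both \<open>a\<close> and
  the index, hence is 1. This turns coprimality of numbers into membership of single
  elements.\<close>

lemma mem_of_coprime_index:
  assumes B: "subgroup B G" and N: "subgroup N G" "N \<subseteq> B" "normalizes B N" and x: "x \<in> B"
    and "x [^] (a::nat) \<in> N" "coprime a (card B div card N)"
  shows "x \<in> N"
  using subgroup_pow_coprime[OF N(1) subgroup.mem_carrier[OF B x] assms(6) pow_index_mem[OF assms(1-5)] assms(7)] .

lemma set_mult_subgroup:
  assumes A: "subgroup A G" and B: "subgroup B G" and nrm: "normalizes B A"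
  shows "subgroup (A <#> B) G"
proof (rule subgroupI)
  note cl = subgroup.mem_carrier[OF A] subgroup.mem_carrier[OF B]
  show "A <#> B \<subseteq> carrier G" using cl by (auto simp: set_mult_def)
  show "A <#> B \<noteq> {}" using subgroup.one_closed[OF A] subgroup.one_closed[OF B] by (auto simp: set_mult_def)
  fix x assume "x \<in> A <#> B"
  then obtain a b where ab: "a \<in> A" "b \<in> B" "x = a \<otimes> b" by (auto simp: set_mult_def)
  have "inv b \<otimes> inv a \<otimes> inv (inv b) \<in> A"
    using nrm ab A B subgroup.m_inv_closed by metis
  moreover have "inv x = (inv b \<otimes> inv a \<otimes> inv (inv b)) \<otimes> inv b"
    using ab cl by (simp add: group_normalize)
  ultimately show "inv x \<in> A <#> B"
    using ab subgroup.m_inv_closed[OF B] by (auto simp: set_mult_def)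
  fix y assume "y \<in> A <#> B"
  then obtain c d where cd: "c \<in> A" "d \<in> B" "y = c \<otimes> d" by (auto simp: set_mult_def)
  have "b \<otimes> c \<otimes> inv b \<in> A" using nrm ab cd by blast
  moreover have "x \<otimes> y = (a \<otimes> (b \<otimes> c \<otimes> inv b)) \<otimes> (b \<otimes> d)"
    using ab cd cl by (simp add: group_normalize)
  moreover have "a \<otimes> (b \<otimes> c \<otimes> inv b) \<in> A" "b \<otimes> d \<in> B"
    using ab cd calculation(1) subgroup.m_closed[OF A] subgroup.m_closed[OF B] by blast+
  ultimately show "x \<otimes> y \<in> A <#> B"
    unfolding set_mult_def by blast
qed

lemma set_mult_subset:
  assumes "subgroup L G" "A \<subseteq> L" "B \<subseteq> L"
  shows "A <#> B \<subseteq> L"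
  using assms subgroup.m_closed[of L G] by (auto simp: set_mult_def)

lemma subset_set_mult_left:
  assumes "A \<subseteq> carrier G" "subgroup B G" shows "A \<subseteq> A <#> B"
proof
  fix x assume "x \<in> A"
  then have "x = x \<otimes> \<one>" using assms by auto
  then show "x \<in> A <#> B" unfolding set_mult_def using \<open>x \<in> A\<close> subgroup.one_closed[OF assms(2)] by blast
qed

lemma subset_set_mult_right:
  assumes "subgroup A G" "B \<subseteq> carrier G" shows "B \<subseteq> A <#> B"
proof
  fix x assume "x \<in> B"
  then have "x = \<one> \<otimes> x" using assms by auto
  then show "x \<in> A <#> B" unfolding set_mult_def using \<open>x \<in> B\<close> subgroup.one_closed[OF assms(1)] by blast
qed

text \<open>All fibres of the multiplication map from \<open>A \<times> B\<close> onto the product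
  set have the size of \<open>A \<inter> B\<close>.\<close>

lemma card_set_mult:
  assumes A: "subgroup A G" and B: "subgroup B G"
  shows "card (A <#> B) * card (A \<inter> B) = card A * card B"
proof -
  note cl = subgroup.mem_carrier[OF A] subgroup.mem_carrier[OF B]
  have finAB: "finite A" "finite B" using A B subgroup_finite by auto
  define F where "F z = {(a, b) \<in> A \<times> B. a \<otimes> b = z}" for z
  have card_F: "card (F z) = card (A \<inter> B)" if z: "z \<in> A <#> B" for z
  proof -
    obtain a b where ab: "a \<in> A" "b \<in> B" "z = a \<otimes> b" using z by (auto simp: set_mult_def)
    \<comment> \<open>Every factorization of \<open>a \<otimes> b\<close> arises by moving some
      \<open>c\<close> from the second factor to the first.\<close>
    have "bij_betw (\<lambda>c. (a \<otimes> c, inv c \<otimes> b)) (A \<inter> B) (F z)"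
    proof (rule bij_betw_byWitness[where f' = "\<lambda>(x, y). inv a \<otimes> x"])
      show "\<forall>c\<in>A \<inter> B. (case (a \<otimes> c, inv c \<otimes> b) of (x, y) \<Rightarrow> inv a \<otimes> x) = c"
        using ab cl by simp
      have "a \<otimes> (inv a \<otimes> x) = x \<and> inv (inv a \<otimes> x) \<otimes> b = y" if xy: "x \<in> A" "y \<in> B" "x \<otimes> y = z" for x y
      proof -
        have "inv x \<otimes> (a \<otimes> b) = y" using xy ab cl mult_inv_cancel_left(2)[of x y] by simp
        then show ?thesis using xy ab cl by (simp add: group_normalize)
      qed
      then show "\<forall>p\<in>F z. (a \<otimes> (case p of (x, y) \<Rightarrow> inv a \<otimes> x), inv (case p of (x, y) \<Rightarrow> inv a \<otimes> x) \<otimes> b) = p"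
        by (auto simp: F_def)
      show "(\<lambda>c. (a \<otimes> c, inv c \<otimes> b)) ` (A \<inter> B) \<subseteq> F z"
        using ab cl subgroup.m_closed[OF A] subgroup.m_closed[OF B] subgroup.m_inv_closed[OF B]
        by (auto simp: F_def group_normalize)
      have "inv a \<otimes> x \<in> A \<inter> B" if xy: "x \<in> A" "y \<in> B" "x \<otimes> y = z" for x y
      proof -
        have "inv a \<otimes> (x \<otimes> y) \<otimes> inv y = inv a \<otimes> (a \<otimes> b) \<otimes> inv y" using xy ab by simp
        then have "inv a \<otimes> x = b \<otimes> inv y"
          using xy(1,2) ab(1,2) cl by (simp add: group_normalize)
        then show ?thesis
          using xy ab A B by (metis IntI subgroup.m_closed subgroup.m_inv_closed)
      qed
      then show "(\<lambda>(x, y). inv a \<otimes> x) ` F z \<subseteq> A \<inter> B" by (auto simp: F_def)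
    qed
    then show ?thesis by (simp add: bij_betw_same_card)
  qed
  have AB: "A \<times> B = (\<Union>z\<in>A <#> B. F z)" by (auto simp: F_def set_mult_def)
  have fin: "finite (A <#> B)" "finite (F z)" for z
    using finAB finite_subset[of "F z" "A \<times> B"] by (auto simp: F_def set_mult_def)
  have "card (A \<times> B) = (\<Sum>z\<in>A <#> B. card (F z))"
    unfolding AB by (rule card_UN_disjoint) (use fin in \<open>auto simp: F_def\<close>)
  also have "\<dots> = card (A <#> B) * card (A \<inter> B)" using card_F by simp
  finally show ?thesis by (simp add: card_cartesian_product)
qed

lemma conj_mem:
  assumes L: "subgroup L G" and "g \<in> L" "x \<in> L"
  shows "g \<otimes> x \<otimes> inv g \<in> L"
  using subgroup.m_closed[OF L subgroup.m_closed[OF L assms(2,3)] subgroup.m_inv_closed[OF L assms(2)]] .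

lemma commute_inv:
  assumes a: "a \<in> carrier G" and x: "x \<in> carrier G" and e: "a \<otimes> x = x \<otimes> a"
  shows "inv a \<otimes> x = x \<otimes> inv a"
proof -
  have "inv a \<otimes> x = inv a \<otimes> (x \<otimes> a) \<otimes> inv a" using a x by (simp add: m_assoc)
  also have "\<dots> = x \<otimes> inv a" unfolding e[symmetric] using a x by (simp add: m_assoc)
  finally show ?thesis .
qed

lemma commute_mult:
  assumes a: "a \<in> carrier G" and b: "b \<in> carrier G" and x: "x \<in> carrier G"
    and e: "a \<otimes> x = x \<otimes> a" "b \<otimes> x = x \<otimes> b"
  shows "(a \<otimes> b) \<otimes> x = x \<otimes> (a \<otimes> b)"
proof -
  have "(a \<otimes> b) \<otimes> x = a \<otimes> (b \<otimes> x)" using a b x by (simp add: m_assoc)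
  also have "\<dots> = (a \<otimes> x) \<otimes> b" unfolding e(2) using a b x by (simp add: m_assoc)
  also have "\<dots> = x \<otimes> (a \<otimes> b)" unfolding e(1) using a b x by (simp add: m_assoc)
  finally show ?thesis .
qed

definition centralizer :: "'a set \<Rightarrow> 'a set \<Rightarrow> 'a set" where
  "centralizer B A = {g \<in> B. \<forall>x\<in>A. g \<otimes> x = x \<otimes> g}"

lemma centralizer_subgroup:
  assumes B: "subgroup B G" and A: "A \<subseteq> carrier G"
  shows "subgroup (centralizer B A) G"
proof (rule subgroupI)
  note cl = subgroup.mem_carrier[OF B] subsetD[OF A]
  show "centralizer B A \<subseteq> carrier G" using cl(1) by (auto simp: centralizer_def)
  have "\<one> \<in> centralizer B A" using subgroup.one_closed[OF B] cl(2) by (simp add: centralizer_def)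
  then show "centralizer B A \<noteq> {}" by blast
  fix a assume a: "a \<in> centralizer B A"
  then show "inv a \<in> centralizer B A"
    using subgroup.m_inv_closed[OF B] cl commute_inv by (simp add: centralizer_def)
  fix b assume b: "b \<in> centralizer B A"
  then show "a \<otimes> b \<in> centralizer B A"
    using a subgroup.m_closed[OF B] cl commute_mult by (simp add: centralizer_def)
qed

section \<open>Sylow subgroups\<close>

lemma conjug_subgroup:
  assumes A: "subgroup A G" and g: "g \<in> carrier G"
  shows "subgroup (conjug g A) G"
proof (rule subgroupI)
  note cl = subgroup.mem_carrier[OF A]
  show "conjug g A \<subseteq> carrier G" using g cl by (auto simp: conjug_def)
  show "conjug g A \<noteq> {}" using subgroup.one_closed[OF A] by (auto simp: conjug_def)
  fix x assume "x \<in> conjug g A"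
  then obtain a where a: "a \<in> A" "x = g \<otimes> a \<otimes> inv g" by (auto simp: conjug_def)
  have "inv x = g \<otimes> inv a \<otimes> inv g" using a g cl by (simp add: group_normalize)
  then show "inv x \<in> conjug g A" using a subgroup.m_inv_closed[OF A] by (auto simp: conjug_def)
  fix y assume "y \<in> conjug g A"
  then obtain b where b: "b \<in> A" "y = g \<otimes> b \<otimes> inv g" by (auto simp: conjug_def)
  have "x \<otimes> y = g \<otimes> (a \<otimes> b) \<otimes> inv g" using a b g cl by (simp add: group_normalize)
  then show "x \<otimes> y \<in> conjug g A" using a b subgroup.m_closed[OF A] by (auto simp: conjug_def)
qed

lemma card_conjug:
  assumes "A \<subseteq> carrier G" and "g \<in> carrier G"
  shows "card (conjug g A) = card A"
  unfolding conjug_def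
proof (rule card_image, rule inj_onI)
  fix x y assume "x \<in> A" "y \<in> A" "g \<otimes> x \<otimes> inv g = g \<otimes> y \<otimes> inv g"
  then show "x = y" using assms by (simp add: subset_iff)
qed

lemma conjug_mult:
  assumes "A \<subseteq> carrier G" and "g \<in> carrier G" "h \<in> carrier G"
  shows "conjug g (conjug h A) = conjug (g \<otimes> h) A"
  unfolding conjug_def image_image using assms by (intro image_cong) (auto simp: group_normalize)

lemma conjug_one: "A \<subseteq> carrier G \<Longrightarrow> conjug \<one> A = A"
  by (force simp: conjug_def image_def)

lemma conjug_mono: "A \<subseteq> B \<Longrightarrow> conjug g A \<subseteq> conjug g B"
  by (auto simp: conjug_def)

lemma conjug_subset_iff: "conjug g A \<subseteq> B \<longleftrightarrow> (\<forall>a\<in>A. g \<otimes> a \<otimes> inv g \<in> B)"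
  by (auto simp: conjug_def)

lemma conjug_in_subgroup:
  assumes "subgroup B G" "A \<subseteq> B" "g \<in> B"
  shows "conjug g A \<subseteq> B"
  using assms by (auto simp: conjug_subset_iff intro!: subgroup.m_closed subgroup.m_inv_closed)

lemma conjug_cancel:
  assumes "A \<subseteq> carrier G" and "g \<in> carrier G"
  shows "conjug (inv g) (conjug g A) = A"
  using assms by (simp add: conjug_mult conjug_one)

text \<open>The normalizer of \<open>A\<close> in \<open>G\<close>. The condition is one-sided;
  \<open>normer_iff\<close> upgrades it to an equality of sets.\<close>

definition normer :: "'a set \<Rightarrow> 'a set" where
  "normer A = {g \<in> carrier G. \<forall>a\<in>A. g \<otimes> a \<otimes> inv g \<in> A}"

text \<open>Conjugation keeps the cardinality, so for a finite \<open>A\<close> the inclusion is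
  already an equality.\<close>

lemma normer_iff:
  assumes "subgroup A G"
  shows "g \<in> normer A \<longleftrightarrow> g \<in> carrier G \<and> conjug g A = A"
proof -
  have "conjug g A \<subseteq> A \<longleftrightarrow> conjug g A = A" if "g \<in> carrier G"
    using card_conjug[OF subgroup.subset[OF assms] that] subgroup_finite[OF assms] card_subset_eq by auto
  then show ?thesis by (auto simp: normer_def conjug_subset_iff[symmetric])
qed

lemma normer_subgroup:
  assumes A: "subgroup A G"
  shows "subgroup (normer A) G"
proof (rule subgroupI)
  have AC: "A \<subseteq> carrier G" using A by (rule subgroup.subset)
  show "normer A \<subseteq> carrier G" by (auto simp: normer_def)
  have "\<one> \<in> normer A" using AC by (auto simp: normer_def)
  then show "normer A \<noteq> {}" by blast
  fix g assume g: "g \<in> normer A"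
  then have g': "g \<in> carrier G" "conjug g A = A" by (simp_all add: normer_iff[OF A])
  then have "conjug (inv g) A = A" using conjug_cancel[OF AC g'(1)] by simp
  then show "inv g \<in> normer A" using g' by (simp add: normer_iff[OF A])
  fix h assume h: "h \<in> normer A"
  then show "g \<otimes> h \<in> normer A" using g AC by (simp add: normer_iff[OF A] conjug_mult[symmetric])
qed

lemma subset_normer:
  assumes A: "subgroup A G"
  shows "A \<subseteq> normer A"
  using subgroup.mem_carrier[OF A] subgroup.m_closed[OF A] subgroup.m_inv_closed[OF A]
  by (auto simp: normer_def)

lemma normal_iff_normer: "A \<lhd> G \<longleftrightarrow> subgroup A G \<and> normer A = carrier G"
  by (auto simp: normal_inv_iff normer_def)

lemma normal_mem:
  assumes "N \<lhd> G" "g \<in> carrier G" "a \<in> N"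
  shows "g \<otimes> a \<otimes> inv g \<in> N" "inv g \<otimes> a \<otimes> g \<in> N"
  using normal.inv_op_closed1[OF assms] normal.inv_op_closed2[OF assms] by auto

lemma normal_conjug_eq:
  assumes "N \<lhd> G" "g \<in> carrier G" shows "conjug g N = N"
  using assms normer_iff[of N g] by (simp add: normal_iff_normer)

text \<open>The index condition replaces the exact exponent of \<open>p\<close>. If \<open>B\<close>
  is a subgroup of order prime to the prime \<open>p\<close>, only the trivial subgroup
  qualifies.\<close>

definition sylow_sub :: "nat \<Rightarrow> 'a set \<Rightarrow> 'a set \<Rightarrow> bool" where
  "sylow_sub p S B \<longleftrightarrow> subgroup S G \<and> S \<subseteq> B \<and> (\<exists>k. card S = p ^ k) \<and> \<not> p dvd card B div card S"

lemma sylow_exists: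
  assumes p: "prime p" and B: "subgroup B G"
  shows "\<exists>S. sylow_sub p S B"
proof -
  interpret B: finite_group "G\<lparr>carrier := B\<rparr>" using B by (rule finite_group_subgroup)
  obtain m where m: "card B = p ^ multiplicity p (card B) * m" "\<not> p dvd m"
    using multiplicity_decompose'[of "card B" p] p subgroup_card_pos[OF B] by (metis gr_implies_not0 not_prime_unit)
  have "\<exists>S. subgroup S (G\<lparr>carrier := B\<rparr>) \<and> card S = p ^ multiplicity p (card B)"
    by (rule sylow_thm[where m = m]) (use p m B.finite_carrier B.is_group in \<open>auto simp: order_def\<close>)
  then obtain S where S: "subgroup S G" "S \<subseteq> B" "card S = p ^ multiplicity p (card B)"
    using subgroup_restrict_iff[OF B] by blast
  have "card B div card S = m"
    using m(1) S(3) p by (metis nonzero_mult_div_cancel_left not_prime_0 power_not_zero)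
  then show ?thesis using S m(2) by (auto simp: sylow_sub_def)
qed

lemma prime_order_subgroup_exists:
  assumes p: "prime p" and B: "subgroup B G" and "p dvd card B"
  shows "\<exists>A. subgroup A G \<and> A \<subseteq> B \<and> card A = p"
proof -
  interpret B: finite_group "G\<lparr>carrier := B\<rparr>" using B by (rule finite_group_subgroup)
  obtain m where m: "card B = p * m" using \<open>p dvd card B\<close> by blast
  have "\<exists>S. subgroup S (G\<lparr>carrier := B\<rparr>) \<and> card S = p ^ 1"
    by (rule sylow_thm[where m = m]) (use p m B.finite_carrier B.is_group in \<open>auto simp: order_def\<close>)
  then show ?thesis using subgroup_restrict_iff[OF B] by auto
qed

lemma sylow_subD:
  assumes "sylow_sub p S B"
  shows "subgroup S G" "S \<subseteq> B" "\<exists>k. card S = p ^ k"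
  using assms by (auto simp: sylow_sub_def)

lemma sylow_card:
  assumes "subgroup B G" "sylow_sub p S B"
  shows "card B = card S * (card B div card S)" "\<not> p dvd card B div card S"
  using assms subgroup_card_dvd by (auto simp: sylow_sub_def)

lemma sylow_nontrivial:
  assumes "subgroup B G" "sylow_sub p S B" "p dvd card B" "prime p"
  shows "p dvd card S"
  using sylow_card[OF assms(1,2)] assms(3,4) by (metis prime_dvd_mult_iff)

lemma sylow_card_eq:
  assumes p: "prime p" and B: "subgroup B G" and S: "sylow_sub p S B" and T: "sylow_sub p T B"
  shows "card S = card T"
proof -
  have "card R = p ^ multiplicity p (card B)" if R: "sylow_sub p R B" for R
  proof -
    obtain k where k: "card R = p ^ k" using R by (auto simp: sylow_sub_def)
    have "p \<noteq> 0" "\<not> p dvd 1" using p not_prime_unit by auto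
    then have "multiplicity p (p ^ k * (card B div card R)) = k"
      using sylow_card(2)[OF B R] by (intro multiplicity_eqI) auto
    then show ?thesis using sylow_card(1)[OF B R] k by simp
  qed
  then show ?thesis using S T by metis
qed

text \<open>\<open>P\<close> acts on the right cosets of \<open>S\<close>, whose number is prime to
  \<open>p\<close>, so some coset \<open>S #> b\<close> is fixed. Then
  \<open>S #> (b \<otimes> x) = S #> b\<close> for \<open>x\<close> in \<open>P\<close>, which says
  that \<open>b\<close> conjugates \<open>P\<close> into \<open>S\<close>.\<close>

lemma p_subgroup_conjugate_into_sylow:
  assumes p: "prime p" and S: "sylow_sub p S (carrier G)"
    and P: "subgroup P G" "card P = p ^ k"
  shows "\<exists>b\<in>carrier G. \<forall>x\<in>P. b \<otimes> x \<otimes> inv b \<in> S"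
proof -
  have SG: "subgroup S G" using S by (simp add: sylow_sub_def)
  define E where "E = rcosets S"
  \<comment> \<open>The inverse makes right multiplication of cosets a left action.\<close>
  define f where "f g X = X #> inv g" for g X
  note cl = subgroup.mem_carrier[OF P(1)] subgroup.mem_carrier[OF SG]
  interpret P: group "G\<lparr>carrier := P\<rparr>" using P subgroup_imp_group by blast
  have finE: "finite E" using finite_carrier rcosets_finite SG finite_subset[of E "Pow (carrier G)"]
    rcosets_subset_PowG[OF SG] unfolding E_def by blast
  have E: "X \<subseteq> carrier G" if "X \<in> E" for X
    using that rcosets_subset_PowG[OF SG] unfolding E_def by blast
  have "card E * card S = order G" unfolding E_def by (rule lagrange[OF SG])
  then have cardE: "card E = card (carrier G) div card S"
    using subgroup_card_pos[OF SG] by (simp add: order_def) (metis div_mult_self_is_m)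
  have "p dvd card {X \<in> E. \<exists>g\<in>carrier (G\<lparr>carrier := P\<rparr>). f g X \<noteq> X}"
  proof (rule prime_power_group_dvd_card_moved[where k = k])
    show "order (G\<lparr>carrier := P\<rparr>) = p ^ k" using P by (simp add: order_def)
    fix g X assume g: "g \<in> carrier (G\<lparr>carrier := P\<rparr>)" and X: "X \<in> E"
    from X obtain b where b: "b \<in> carrier G" "X = S #> b" by (auto simp: E_def RCOSETS_def)
    then have "f g X = S #> (b \<otimes> inv g)"
      using g cl SG by (simp add: f_def coset_mult_assoc subgroup.subset)
    then show "f g X \<in> E" using b g cl by (auto simp: E_def RCOSETS_def)
    fix h assume h: "h \<in> carrier (G\<lparr>carrier := P\<rparr>)"
    show "f (g \<otimes>\<^bsub>G\<lparr>carrier := P\<rparr>\<^esub> h) X = f g (f h X)"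
      using g h cl E[OF X] by (simp add: f_def inv_mult_group coset_mult_assoc)
  next
    fix X assume "X \<in> E"
    then show "f \<one>\<^bsub>G\<lparr>carrier := P\<rparr>\<^esub> X = X" using E by (simp add: f_def)
  qed (use p finE P.is_group in auto)
  then have "{X \<in> E. \<exists>g\<in>carrier (G\<lparr>carrier := P\<rparr>). f g X \<noteq> X} \<noteq> E"
    using S cardE by (auto simp: sylow_sub_def)
  then have "\<exists>X\<in>E. \<forall>g\<in>P. f g X = X" by (simp add: set_eq_iff) blast
  then obtain X where X: "X \<in> E" "\<forall>g\<in>P. f g X = X" by blast
  then obtain b where b: "b \<in> carrier G" "X = S #> b" by (auto simp: E_def RCOSETS_def)
  have "b \<otimes> x \<otimes> inv b \<in> S" if x: "x \<in> P" for x
  proof -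
    have "f (inv x) X = X" using X subgroup.m_inv_closed[OF P(1) x] by blast
    then have "(S #> b) #> x = S #> b" using x cl b by (simp add: f_def)
    then have "S #> (b \<otimes> x) = S #> b" using x cl b SG by (simp add: coset_mult_assoc subgroup.subset)
    then show ?thesis using rcos_eq_mult_inv[OF SG] b x cl by simp
  qed
  then show ?thesis using b by blast
qed

text \<open>Lets results about Sylow subgroups of the whole group be applied to a subgroup
  \<open>B\<close> by working in \<open>G\<lparr>carrier := B\<rparr>\<close>.\<close>

lemma sylow_sub_restrict:
  assumes B: "subgroup B G" and "A \<subseteq> B"
  shows "finite_group.sylow_sub (G\<lparr>carrier := B\<rparr>) p S A \<longleftrightarrow> sylow_sub p S A"
  using assms finite_group.sylow_sub_def[OF finite_group_subgroup[OF B]] subgroup_restrict_iff[OF B]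
  by (auto simp: sylow_sub_def)

lemma p_subgroup_conjugate_into_sylow':
  assumes p: "prime p" and B: "subgroup B G" and S: "sylow_sub p S B"
    and P: "subgroup P G" "P \<subseteq> B" "card P = p ^ k"
  shows "\<exists>b\<in>B. \<forall>x\<in>P. b \<otimes> x \<otimes> inv b \<in> S"
proof -
  interpret B: finite_group "G\<lparr>carrier := B\<rparr>" using B by (rule finite_group_subgroup)
  have "B.sylow_sub p S (carrier (G\<lparr>carrier := B\<rparr>))" using sylow_sub_restrict[OF B] S by simp
  from B.p_subgroup_conjugate_into_sylow[OF p this, of P k] P
  show ?thesis using subgroup_restrict_iff[OF B] m_inv_consistent[OF B] by fastforce
qed

lemma p_element_conjugate_into_sylow:
  assumes p: "prime p" and B: "subgroup B G" and S: "sylow_sub p S B"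
    and x: "x \<in> B" "x [^] (p ^ k) = \<one>"
  shows "\<exists>b\<in>B. b \<otimes> x \<otimes> inv b \<in> S"
proof -
  have xG: "x \<in> carrier G" using subgroup.mem_carrier[OF B x(1)] .
  have "ord x dvd p ^ k" using x xG by (simp add: pow_eq_id)
  then obtain j where "ord x = p ^ j" using p by (meson divides_primepow_nat)
  then have "card (generate G {x}) = p ^ j" using generate_pow_card[OF xG] by simp
  moreover have "subgroup (generate G {x}) G" using xG by (simp add: generate_is_subgroup)
  moreover have "generate G {x} \<subseteq> B" using generate_subgroup_incl[of "{x}" B] x B by simp
  ultimately obtain b where "b \<in> B" "\<forall>y\<in>generate G {x}. b \<otimes> y \<otimes> inv b \<in> S"
    using p_subgroup_conjugate_into_sylow'[OF p B S] by blast
  moreover have "x \<in> generate G {x}" by (simp add: generate.incl)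
  ultimately show ?thesis by blast
qed

lemma sylow_conjugate:
  assumes p: "prime p" and B: "subgroup B G" and S: "sylow_sub p S B" and T: "sylow_sub p T B"
  shows "\<exists>b\<in>B. conjug b T = S"
proof -
  obtain b where b: "b \<in> B" "\<forall>x\<in>T. b \<otimes> x \<otimes> inv b \<in> S"
    using p_subgroup_conjugate_into_sylow'[OF p B S] sylow_subD[OF T] by blast
  have "card (conjug b T) = card S"
    using card_conjug[OF subgroup.subset[OF sylow_subD(1)[OF T]] subgroup.mem_carrier[OF B b(1)]]
      sylow_card_eq[OF p B S T] by simp
  then have "conjug b T = S"
    using b subgroup_eqI_card[OF sylow_subD(1)[OF S]] by (simp add: conjug_subset_iff)
  then show ?thesis using b by blast
qed

lemma sylow_conjug:
  assumes S: "sylow_sub p S B" and B: "subgroup B G" and g: "g \<in> carrier G" and gB: "conjug g B = B"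
  shows "sylow_sub p (conjug g S) B"
proof -
  have "conjug g S \<subseteq> B" using conjug_mono[OF sylow_subD(2)[OF S], of g] gB by simp
  then show ?thesis using S card_conjug[of S g] g conjug_subgroup[of S g]
    by (auto simp: sylow_sub_def subgroup.subset)
qed

text \<open>The conjugate of \<open>S\<close> by any \<open>g\<close> is again a Sylow subgroup of
  \<open>N\<close>; some \<open>n\<close> in \<open>N\<close> carries it back to \<open>S\<close>,
  so \<open>n \<otimes> g\<close> normalizes \<open>S\<close>.\<close>

lemma frattini:
  assumes p: "prime p" and N: "N \<lhd> G" and S: "sylow_sub p S N"
  shows "N <#> normer S = carrier G"
proof
  have sub: "subgroup N G" using N by (simp add: normal_imp_subgroup)
  show "N <#> normer S \<subseteq> carrier G"
    using subgroup.mem_carrier[OF sub] by (auto simp: set_mult_def normer_def)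
  show "carrier G \<subseteq> N <#> normer S"
  proof
    fix g assume g: "g \<in> carrier G"
    have "sylow_sub p (conjug g S) N" using sylow_conjug[OF S sub g] normal_conjug_eq[OF N g] by simp
    then obtain n where n: "n \<in> N" "conjug n (conjug g S) = S" using sylow_conjugate[OF p sub S] by blast
    have nG: "n \<in> carrier G" using subgroup.mem_carrier[OF sub n(1)] .
    have SG: "S \<subseteq> carrier G" "subgroup S G" using sylow_subD[OF S] subgroup.subset by auto
    then have "n \<otimes> g \<in> normer S" using n nG g by (simp add: normer_iff conjug_mult)
    moreover have "g = inv n \<otimes> (n \<otimes> g)" using nG g by simp
    moreover have "inv n \<in> N" using subgroup.m_inv_closed[OF sub n(1)] .
    ultimately show "g \<in> N <#> normer S" unfolding set_mult_def by blast
  qed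
qed

text \<open>Class equation: conjugation moves a multiple of \<open>p\<close> elements, so the number
  of central elements is a multiple of \<open>p\<close> as well, and it is positive because of
  \<open>\<one>\<close>.\<close>

lemma p_group_center_nontrivial:
  assumes p: "prime p" and P: "subgroup P G" "card P = p ^ k" "P \<noteq> {\<one>}"
  shows "\<exists>z\<in>P. z \<noteq> \<one> \<and> (\<forall>x\<in>P. x \<otimes> z = z \<otimes> x)"
proof -
  interpret P: group "G\<lparr>carrier := P\<rparr>" using P subgroup_imp_group by blast
  note cl = subgroup.mem_carrier[OF P(1)]
  define M where "M = {z \<in> P. \<exists>g\<in>P. g \<otimes> z \<otimes> inv g \<noteq> z}"
  have "p dvd card {z \<in> P. \<exists>g\<in>carrier (G\<lparr>carrier := P\<rparr>). g \<otimes> z \<otimes> inv g \<noteq> z}"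
  proof (rule prime_power_group_dvd_card_moved[where k = k and f = "\<lambda>g z. g \<otimes> z \<otimes> inv g"])
    fix g z assume "g \<in> carrier (G\<lparr>carrier := P\<rparr>)" "z \<in> P"
    then show "g \<otimes> z \<otimes> inv g \<in> P"
      using P(1) by (simp add: subgroup.m_closed subgroup.m_inv_closed)
  qed (use p P P.is_group subgroup_finite cl in \<open>auto simp: order_def group_normalize\<close>)
  then have dM: "p dvd card M" by (simp add: M_def)
  have one: "\<one> \<in> P" using P(1) by (rule subgroup.one_closed)
  have "k \<noteq> 0"
  proof
    assume "k = 0"
    then obtain y where "P = {y}" using P by (auto simp: card_1_singleton_iff)
    then show False using P(3) one by simp
  qed
  then have dP: "p dvd card P" using P by simp
  have M: "M \<subseteq> P" "finite P" using subgroup_finite P by (auto simp: M_def)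
  have "p dvd card (P - M)"
    using card_Diff_subset[OF finite_subset[OF M] M(1)] dM dP by (simp add: dvd_diff_nat)
  have "\<one> \<in> P - M" using one cl by (auto simp: M_def)
  have "card (P - M) \<noteq> 1" using \<open>p dvd card (P - M)\<close> p by (metis not_prime_unit)
  then have "P - M \<noteq> {\<one>}" by auto
  then obtain z where z: "z \<in> P - M" "z \<noteq> \<one>" using \<open>\<one> \<in> P - M\<close> by blast
  have "x \<otimes> z = z \<otimes> x" if "x \<in> P" for x
  proof -
    have "x \<otimes> z \<otimes> inv x = z" using z that by (auto simp: M_def)
    then have "x \<otimes> z \<otimes> inv x \<otimes> x = z \<otimes> x" by simp
    then show ?thesis using cl z that by (simp add: m_assoc)
  qed
  then show ?thesis using z by blast
qed

text \<open>\<open>N\<close> permutes its Sylow \<open>q\<close>-subgroups transitively, so their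
  number divides \<open>card N\<close> and is prime to \<open>p\<close>. Hence \<open>P\<close>,
  acting on them by conjugation, fixes one.\<close>

lemma p_group_normalizes_sylow:
  assumes p: "prime p" and q: "prime q" and P: "subgroup P G" "card P = p ^ k"
    and N: "N \<lhd> G" and pN: "\<not> p dvd card N"
  shows "\<exists>Q. sylow_sub q Q N \<and> P \<subseteq> normer Q"
proof -
  have sub: "subgroup N G" using N by (simp add: normal_imp_subgroup)
  interpret NG: finite_group "G\<lparr>carrier := N\<rparr>" using sub by (rule finite_group_subgroup)
  interpret P: group "G\<lparr>carrier := P\<rparr>" using P subgroup_imp_group by blast
  define E where "E = {Q. sylow_sub q Q N}"
  have EN: "E \<subseteq> Pow N" by (auto simp: E_def sylow_sub_def)
  have EG: "X \<subseteq> carrier G" if "X \<in> E" for X using that EN sub subgroup.subset by blast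
  have finE: "finite E" using EN finite_subset subgroup_finite[OF sub] by blast
  have clE: "conjug g Q \<in> E" if "g \<in> carrier G" "Q \<in> E" for g Q
    using sylow_conjug[OF _ sub that(1) normal_conjug_eq[OF N that(1)]] that(2) by (simp add: E_def)
  note cl = subgroup.mem_carrier[OF sub] subgroup.mem_carrier[OF P(1)]
  obtain Q where Q: "Q \<in> E" using sylow_exists[OF q sub] by (auto simp: E_def)
  define \<phi> where "\<phi> g = restrict (conjug g) E" for g
  interpret act: group_action "G\<lparr>carrier := N\<rparr>" E \<phi>
    unfolding \<phi>_def
    by (rule group_actionI) (use NG.is_group clE cl EG in \<open>auto simp: conjug_one conjug_mult\<close>)
  have "orbit (G\<lparr>carrier := N\<rparr>) \<phi> Q = E"
  proof
    show "orbit (G\<lparr>carrier := N\<rparr>) \<phi> Q \<subseteq> E" using Q clE cl by (auto simp: orbit_def \<phi>_def)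
    show "E \<subseteq> orbit (G\<lparr>carrier := N\<rparr>) \<phi> Q"
    proof
      fix S assume "S \<in> E"
      then obtain b where "b \<in> N" "conjug b Q = S"
        using sylow_conjugate[OF q sub] Q unfolding E_def by blast
      then show "S \<in> orbit (G\<lparr>carrier := N\<rparr>) \<phi> Q" using Q by (auto simp: orbit_def \<phi>_def)
    qed
  qed
  then have "card E dvd card N"
    using act.orbit_stabilizer_theorem[OF Q] by (auto simp: order_def intro: dvdI[OF sym])
  then have pE: "\<not> p dvd card E" using pN dvd_trans by blast
  have "p dvd card {X \<in> E. \<exists>g\<in>carrier (G\<lparr>carrier := P\<rparr>). conjug g X \<noteq> X}"
    by (rule prime_power_group_dvd_card_moved[where k = k])
      (use p P P.is_group finE clE cl EG in \<open>auto simp: order_def conjug_one conjug_mult\<close>)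
  then have "{X \<in> E. \<exists>g\<in>carrier (G\<lparr>carrier := P\<rparr>). conjug g X \<noteq> X} \<noteq> E" using pE by auto
  then have "\<exists>X\<in>E. \<forall>g\<in>P. conjug g X = X" by (simp add: set_eq_iff) blast
  then obtain X where X: "X \<in> E" "\<forall>g\<in>P. conjug g X = X" by blast
  have "subgroup X G" using X(1) by (simp add: E_def sylow_sub_def)
  then have "P \<subseteq> normer X" using X(2) cl normer_iff[of X] by blast
  then show ?thesis using X by (auto simp: E_def)
qed

section \<open>Transfer and Burnside's normal complement theorem\<close>

lemma sylow_sub_mono:
  assumes Q: "sylow_sub q Q B" and C: "subgroup C G" "Q \<subseteq> C" "C \<subseteq> B" and B: "subgroup B G"
  shows "sylow_sub q Q C"
proof -
  have sub: "subgroup Q G" using Q by (rule sylow_subD)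
  have "card C div card Q dvd card B div card Q"
    using subgroup_card_dvd[OF C(1) B C(3)] subgroup_card_dvd[OF sub C(1,2)]
    by (metis div_dvd_div dvd_trans)
  then show ?thesis using Q C(2) by (auto simp: sylow_sub_def dest: dvd_trans)
qed

text \<open>Because \<open>Q\<close> is abelian, both \<open>Q\<close> and its conjugate by
  \<open>inv t\<close> are Sylow subgroups of the centralizer of \<open>x\<close>. Some
  \<open>c\<close> there conjugates the second onto the first, so \<open>c \<otimes> inv t\<close>
  normalizes \<open>Q\<close> and therefore commutes with
  \<open>t \<otimes> x \<otimes> inv t\<close>; as \<open>c\<close> commutes with \<open>x\<close>,
  the claim follows.\<close>

lemma sylow_fusion:
  assumes q: "prime q" and Q: "sylow_sub q Q (carrier G)"
    and central: "\<forall>g\<in>normer Q. \<forall>x\<in>Q. g \<otimes> x = x \<otimes> g"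
    and x: "x \<in> Q" and t: "t \<in> carrier G" and tx: "t \<otimes> x \<otimes> inv t \<in> Q"
  shows "t \<otimes> x \<otimes> inv t = x"
proof -
  have QG: "subgroup Q G" using Q by (rule sylow_subD)
  note cl = subgroup.mem_carrier[OF QG]
  have comm: "u \<otimes> v = v \<otimes> u" if "u \<in> Q" "v \<in> Q" for u v
    using central subset_normer[OF QG] that by blast
  define C where "C = {g \<in> carrier G. g \<otimes> x = x \<otimes> g}"
  have C: "subgroup C G"
    using centralizer_subgroup[OF subgroup_self, of "{x}"] cl[OF x] by (simp add: centralizer_def C_def)
  have CG: "C \<subseteq> carrier G" by (auto simp: C_def)
  have "Q \<subseteq> C" using comm x cl by (auto simp: C_def)
  then have Q1: "sylow_sub q Q C" using sylow_sub_mono[OF Q C _ CG] subgroup_self by blast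
  have "conjug (inv t) (carrier G) = carrier G" using t subgroup_self normer_iff[OF subgroup_self] by (auto simp: normer_def)
  then have "sylow_sub q (conjug (inv t) Q) (carrier G)" using sylow_conjug[OF Q subgroup_self] t by simp
  moreover have "conjug (inv t) Q \<subseteq> C"
  proof
    fix v assume "v \<in> conjug (inv t) Q"
    then obtain u where u: "u \<in> Q" "v = inv t \<otimes> u \<otimes> t" using t by (auto simp: conjug_def)
    have "u \<otimes> (t \<otimes> x \<otimes> inv t) = (t \<otimes> x \<otimes> inv t) \<otimes> u" using comm u tx by blast
    then have "inv t \<otimes> (u \<otimes> (t \<otimes> x \<otimes> inv t)) \<otimes> t = inv t \<otimes> ((t \<otimes> x \<otimes> inv t) \<otimes> u) \<otimes> t" by simp
    then have "v \<otimes> x = x \<otimes> v" using u t x cl by (simp add: m_assoc)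
    then show "v \<in> C" using u t cl by (simp add: C_def)
  qed
  ultimately have Q2: "sylow_sub q (conjug (inv t) Q) C" using sylow_sub_mono[OF _ C _ CG subgroup_self] by blast
  obtain c where c: "c \<in> C" "conjug c (conjug (inv t) Q) = Q" using sylow_conjugate[OF q C Q1 Q2] by blast
  have cG: "c \<in> carrier G" using c CG by blast
  have "conjug (c \<otimes> inv t) Q = Q" using c cG t QG by (simp add: conjug_mult subgroup.subset)
  then have "c \<otimes> inv t \<in> normer Q" using normer_iff[OF QG] cG t by simp
  then have "(c \<otimes> inv t) \<otimes> (t \<otimes> x \<otimes> inv t) = (t \<otimes> x \<otimes> inv t) \<otimes> (c \<otimes> inv t)" using central tx by blast
  then have "(c \<otimes> inv t) \<otimes> (t \<otimes> x \<otimes> inv t) \<otimes> t \<otimes> inv c = (t \<otimes> x \<otimes> inv t) \<otimes> (c \<otimes> inv t) \<otimes> t \<otimes> inv c" by simp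
  then have "c \<otimes> x \<otimes> inv c = t \<otimes> x \<otimes> inv t" using cG t cl[OF x] by (simp add: m_assoc)
  moreover have "c \<otimes> x \<otimes> inv c = x" using c cG cl[OF x] by (simp add: C_def m_assoc)
  ultimately show ?thesis by simp
qed

end

section \<open>The transfer into an abelian subgroup\<close>

locale transfer = finite_group G for G (structure) +
  fixes Q :: "'a set"
  assumes Q: "subgroup Q G" and Q_comm: "\<And>x y. x \<in> Q \<Longrightarrow> y \<in> Q \<Longrightarrow> x \<otimes> y = y \<otimes> x"
begin

abbreviation A where "A \<equiv> G\<lparr>carrier := Q\<rparr>"
abbreviation E where "E \<equiv> rcosets Q"

lemmas Q_carrier = subgroup.mem_carrier[OF Q]

sublocale A: comm_group A
proof -
  interpret A: group A using Q subgroup_imp_group by blast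
  show "comm_group A" by (rule A.group_comm_groupI) (use Q_comm in auto)
qed

definition rep :: "'a set \<Rightarrow> 'a" where "rep X = (SOME x. x \<in> X)"

text \<open>The factor from \<open>Q\<close> in
  \<open>rep X \<otimes> g = cocycle X g \<otimes> rep (X #> g)\<close>.\<close>

definition cocycle :: "'a set \<Rightarrow> 'a \<Rightarrow> 'a" where
  "cocycle X g = rep X \<otimes> g \<otimes> inv (rep (X #> g))"

text \<open>The transfer homomorphism from \<open>G\<close> to \<open>Q\<close>.\<close>

definition V :: "'a \<Rightarrow> 'a" where
  "V g = finprod A (\<lambda>X. cocycle X g) E"

lemma coset_carrier: "X \<in> E \<Longrightarrow> X \<subseteq> carrier G"
  using rcosets_subset_PowG[OF Q] by blast

lemma finite_cosets: "finite E"
  using finite_carrier finite_subset[OF rcosets_subset_PowG[OF Q]] by simp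

lemma rep_coset:
  assumes "X \<in> E"
  shows "rep X \<in> carrier G" "X = Q #> rep X"
proof -
  obtain a where a: "a \<in> carrier G" "X = Q #> a" using assms by (auto simp: RCOSETS_def)
  then have "a \<in> X" using rcos_self Q by blast
  then have r: "rep X \<in> X" unfolding rep_def by (rule someI)
  then show "rep X \<in> carrier G" using coset_carrier[OF assms] by blast
  show "X = Q #> rep X" using r a repr_independence[OF _ a(1) Q] by simp
qed

lemma coset_shift:
  assumes "X \<in> E" "g \<in> carrier G"
  shows "X #> g \<in> E"
proof -
  have "X #> g = Q #> (rep X \<otimes> g)"
    using rep_coset[OF assms(1)] assms(2) Q by (metis coset_mult_assoc subgroup.subset)
  then show ?thesis using rep_coset[OF assms(1)] assms(2) by (auto simp: RCOSETS_def)
qed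

lemma coset_shift_mult:
  assumes "X \<in> E" "g \<in> carrier G" "h \<in> carrier G"
  shows "X #> g #> h = X #> (g \<otimes> h)"
  using coset_mult_assoc coset_carrier assms by blast

lemma cocycle_closed:
  assumes X: "X \<in> E" and g: "g \<in> carrier G"
  shows "cocycle X g \<in> Q"
proof -
  note r = rep_coset[OF X] rep_coset[OF coset_shift[OF X g]]
  have "Q #> (rep X \<otimes> g) = Q #> rep (X #> g)"
    using r g Q by (metis coset_mult_assoc subgroup.subset)
  then show ?thesis using rcos_eq_mult_inv[OF Q] r g by (simp add: cocycle_def)
qed

lemma cocycle_mult:
  assumes "X \<in> E" "g \<in> carrier G" "h \<in> carrier G"
  shows "cocycle X (g \<otimes> h) = cocycle X g \<otimes> cocycle (X #> g) h"
  using assms rep_coset(1)[OF assms(1)] rep_coset(1)[OF coset_shift] coset_shift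
  by (simp add: cocycle_def m_assoc coset_shift_mult)

lemma cocycle_one: "X \<in> E \<Longrightarrow> cocycle X \<one> = \<one>"
  using rep_coset(1) coset_carrier by (simp add: cocycle_def)

lemma bij_shift: "g \<in> carrier G \<Longrightarrow> bij_betw (\<lambda>X. X #> g) E E"
  by (rule bij_betw_byWitness[where f' = "\<lambda>X. X #> inv g"])
    (auto simp: coset_shift coset_shift_mult coset_carrier)

text \<open>Right multiplication by \<open>g\<close> permutes the cosets, so the factors
  \<open>cocycle (X #> g) h\<close> of the cocycle identity are those of \<open>V h\<close> in
  another order, and \<open>Q\<close> is abelian.\<close>

lemma V_hom: "V \<in> hom G A"
proof (rule homI)
  fix g assume g: "g \<in> carrier G"
  show "V g \<in> carrier A" unfolding V_def using g cocycle_closed by (intro A.finprod_closed) auto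
  fix h assume h: "h \<in> carrier G"
  have "V (g \<otimes> h) = finprod A (\<lambda>X. cocycle X g \<otimes>\<^bsub>A\<^esub> cocycle (X #> g) h) E"
    unfolding V_def using g h by (intro A.finprod_cong') (auto simp: cocycle_mult coset_shift cocycle_closed subgroup.m_closed[OF Q])
  also have "\<dots> = V g \<otimes>\<^bsub>A\<^esub> finprod A (\<lambda>X. cocycle (X #> g) h) E"
    unfolding V_def using g h by (intro A.finprod_multf) (auto simp: coset_shift cocycle_closed)
  also have "finprod A (\<lambda>X. cocycle (X #> g) h) E = finprod A (\<lambda>X. cocycle X h) ((\<lambda>X. X #> g) ` E)"
    using g h bij_shift[OF g] by (intro A.finprod_reindex[symmetric]) (auto simp: bij_betw_def cocycle_closed coset_shift)
  also have "(\<lambda>X. X #> g) ` E = E" using bij_shift[OF g] by (simp add: bij_betw_def)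
  finally show "V (g \<otimes> h) = V g \<otimes>\<^bsub>A\<^esub> V h" by (simp add: V_def)
qed

text \<open>Along the path \<open>X\<close>, \<open>X #> x\<close>, \<open>X #> x [^] 2\<close>, ...
  the product telescopes by \<open>cocycle_mult\<close>. When \<open>x [^] n = \<one>\<close> its
  value is \<open>\<one>\<close>.\<close>

lemma cocycle_pow:
  assumes X: "X \<in> E" and x: "x \<in> carrier G"
  shows "finprod A (\<lambda>k. cocycle (X #> x [^] k) x) {..<n::nat} = cocycle X (x [^] n)"
proof (induction n)
  case 0
  then show ?case using X by (simp add: cocycle_one)
next
  case (Suc n)
  have "finprod A (\<lambda>k. cocycle (X #> x [^] k) x) {..<Suc n}
    = cocycle (X #> x [^] n) x \<otimes> finprod A (\<lambda>k. cocycle (X #> x [^] k) x) {..<n}"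
    unfolding lessThan_Suc using X x by (subst A.finprod_insert) (auto simp: cocycle_closed coset_shift)
  also have "\<dots> = cocycle X (x [^] n) \<otimes> cocycle (X #> x [^] n) x"
    unfolding Suc using X x by (intro Q_comm) (auto simp: cocycle_closed coset_shift)
  also have "\<dots> = cocycle X (x [^] Suc n)" using X x cocycle_mult by simp
  finally show ?case .
qed

text \<open>Each orbit of an element of prime order on the moved cosets is a full cycle, on which the cocycle telescopes to \<^term>\<open>\<one>\<close>.\<close>
lemma moved_cosets:
  assumes q: "prime q" and x: "x \<in> carrier G" "x [^] q = \<one>"
    and "finite M" "M \<subseteq> E" "\<forall>X\<in>M. X #> x \<in> M \<and> X #> x \<noteq> X"
  shows "finprod A (\<lambda>X. cocycle X x) M = \<one> \<and> q dvd card M"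
  using assms(4-6)
proof (induction M rule: finite_psubset_induct)
  case (psubset M)
  show ?case
  proof (cases "M = {}")
    case True
    then show ?thesis using A.finprod_empty by simp
  next
    case False
    then obtain X where X: "X \<in> M" by blast
    then have XE: "X \<in> E" using psubset by blast
    define z where "z k = X #> x [^] k" for k :: nat
    define Ob where "Ob = z ` {..<q}"
    have q0: "q > 0" using q by (simp add: prime_gt_0_nat)
    have pow_q: "x [^] (q * m) = \<one>" for m :: nat using x by (simp add: nat_pow_pow[symmetric])
    have z_Suc: "z k #> x = z (Suc k)" for k using XE x by (simp add: z_def coset_shift_mult)
    have z_mod: "z k = z (k mod q)" for k
    proof -
      have "x [^] k = x [^] (q * (k div q)) \<otimes> x [^] (k mod q)" using x by (simp add: nat_pow_mult)
      then show ?thesis using x by (simp add: z_def pow_q)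
    qed
    have zO: "z k \<in> Ob" for k unfolding Ob_def using z_mod[of k] q0 by auto
    have zM: "z k \<in> M" for k
    proof (induction k)
      case 0
      then show ?case using X coset_carrier[OF XE] by (simp add: z_def)
    next
      case (Suc k)
      then show ?case using psubset.prems(2) z_Suc by metis
    qed
    have "inj_on z {..<q}"
    proof (rule inj_onI, rule ccontr)
      have *: False if ij: "i < j" "j < q" "z i = z j" for i j
      proof -
        \<comment> \<open>The stabilizer of \<open>X\<close>. If two of the \<open>q\<close> points
          coincide, it contains \<open>x [^] (j - i)\<close> and \<open>x [^] q\<close>, whose
          exponents are coprime, hence \<open>x\<close> itself, although \<open>x\<close> moves
          every coset in \<open>M\<close>.\<close>
        define S where "S = {g \<in> carrier G. X #> g = X}"
        have S: "subgroup S G"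
        proof (rule subgroupI)
          show "S \<noteq> {}" using coset_carrier[OF XE] by (auto simp: S_def)
          fix g assume g: "g \<in> S"
          then have g': "g \<in> carrier G" "X #> g = X" by (simp_all add: S_def)
          have "X #> inv g = X #> g #> inv g" by (simp add: g'(2))
          also have "\<dots> = X" using g'(1) XE coset_carrier[OF XE] by (simp add: coset_shift_mult)
          finally show "inv g \<in> S" using g'(1) by (simp add: S_def)
          fix h assume h: "h \<in> S"
          then show "g \<otimes> h \<in> S" using g XE coset_shift_mult[OF XE, of g h] by (simp add: S_def)
        qed (auto simp: S_def)
        have "z i #> x [^] (q - i) = z j #> x [^] (q - i)" using ij by simp
        then have "z (i + (q - i)) = z (j + (q - i))" using XE x by (simp add: z_def coset_shift_mult nat_pow_mult)
        moreover have "z (i + (q - i)) = X" using ij x coset_carrier[OF XE] by (simp add: z_def)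
        moreover have "z (j + (q - i)) = z (j - i)"
          using z_mod[of "j + (q - i)"] ij by (simp add: mod_if)
        ultimately have "x [^] (j - i) \<in> S" using x by (simp add: S_def z_def)
        moreover have "x [^] q \<in> S" using x coset_carrier[OF XE] by (simp add: S_def)
        moreover have "coprime (j - i) q" using q ij by (metis coprime_commute diff_is_0_eq dvd_imp_le less_imp_diff_less not_le prime_imp_coprime zero_less_diff)
        ultimately have "x \<in> S" using subgroup_pow_coprime[OF S x(1)] by blast
        then show False using X psubset.prems(2) by (auto simp: S_def)
      qed
      fix i j assume "i \<in> {..<q}" "j \<in> {..<q}" "z i = z j" "i \<noteq> j"
      then show False using *[of i j] *[of j i] by (metis lessThan_iff linorder_neqE_nat)
    qed
    note inj = this
    have cardO: "card Ob = q" unfolding Ob_def using card_image[OF inj] by simp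
    have OM: "Ob \<subseteq> M" using zM by (auto simp: Ob_def)
    have "finprod A (\<lambda>X. cocycle X x) Ob = finprod A (\<lambda>k. cocycle (z k) x) {..<q}"
      unfolding Ob_def using inj zM subsetD[OF psubset.prems(1) zM] x by (intro A.finprod_reindex) (auto simp: cocycle_closed)
    also have "\<dots> = \<one>" using cocycle_pow[OF XE x(1), of q] x XE by (simp add: z_def cocycle_one)
    finally have prodO: "finprod A (\<lambda>X. cocycle X x) Ob = \<one>" .
    have closed: "Y #> x \<in> M - Ob \<and> Y #> x \<noteq> Y" if Y: "Y \<in> M - Ob" for Y
    proof -
      have YE: "Y \<in> E" using Y psubset.prems(1) by blast
      \<comment> \<open>Multiplication by \<open>x [^] (q - 1)\<close>, the inverse of
        \<open>x\<close>, would bring \<open>Y\<close> itself into the cycle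
        \<open>Ob\<close>.\<close>
      have "Y #> x \<notin> Ob"
      proof
        assume "Y #> x \<in> Ob"
        then obtain k where "Y #> x = z k" by (auto simp: Ob_def)
        then have "Y #> x #> x [^] (q - 1) = X #> (x [^] k \<otimes> x [^] (q - 1))"
          using XE x by (simp add: z_def coset_shift_mult)
        moreover have "Y #> x #> x [^] (q - 1) = Y #> x [^] (Suc (q - 1))"
          using YE x nat_pow_Suc2[OF x(1), of "q - 1"] by (simp add: coset_shift_mult del: nat_pow_Suc)
        moreover have "x [^] (Suc (q - 1)) = \<one>" using q0 x by simp
        ultimately have "Y = z (k + (q - 1))"
          using x coset_carrier[OF YE] by (simp add: z_def nat_pow_mult)
        then show False using Y zO by blast
      qed
      then show ?thesis using Y psubset.prems(2) by blast
    qed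
    have "M - Ob \<subset> M" using X zO[of 0] coset_carrier[OF XE] by (auto simp: z_def)
    then have IH: "finprod A (\<lambda>X. cocycle X x) (M - Ob) = \<one> \<and> q dvd card (M - Ob)"
      using psubset.IH[of "M - Ob"] psubset.prems(1) closed by blast
    have "M = Ob \<union> (M - Ob)" using OM by blast
    moreover have "finprod A (\<lambda>X. cocycle X x) (Ob \<union> (M - Ob)) = finprod A (\<lambda>X. cocycle X x) Ob \<otimes>\<^bsub>A\<^esub> finprod A (\<lambda>X. cocycle X x) (M - Ob)"
    proof (rule A.finprod_Un_disjoint)
      show "(\<lambda>X. cocycle X x) \<in> Ob \<rightarrow> carrier A" "(\<lambda>X. cocycle X x) \<in> M - Ob \<rightarrow> carrier A"
        using psubset.prems(1) OM x(1) cocycle_closed by auto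
    qed (use finite_subset[OF OM psubset.hyps(1)] psubset.hyps(1) in auto)
    ultimately have "finprod A (\<lambda>X. cocycle X x) M = finprod A (\<lambda>X. cocycle X x) Ob \<otimes> finprod A (\<lambda>X. cocycle X x) (M - Ob)"
      by simp
    moreover have "card M = card Ob + card (M - Ob)"
      using card_Un_disjoint[of Ob "M - Ob"] \<open>M = Ob \<union> (M - Ob)\<close> finite_subset[OF OM psubset.hyps(1)] psubset.hyps(1) by auto
    ultimately show ?thesis using IH prodO cardO by simp
  qed
qed

text \<open>A fixed coset contributes a conjugate of \<open>x\<close> lying in \<open>Q\<close>,
  which is \<open>x\<close> by fusion; the moved cosets together contribute \<open>\<one>\<close>,
  and their number is a multiple of \<open>q\<close>. So \<open>V x\<close> is a power of
  \<open>x\<close> whose exponent is congruent to \<open>card E\<close> modulo \<open>q\<close>,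
  hence prime to \<open>q\<close>.\<close>

lemma V_fixed:
  assumes q: "prime q" and x: "x \<in> Q" "x [^] q = \<one>"
    and fusion: "\<And>t. t \<in> carrier G \<Longrightarrow> t \<otimes> x \<otimes> inv t \<in> Q \<Longrightarrow> t \<otimes> x \<otimes> inv t = x"
    and nd: "\<not> q dvd card E" and V: "V x = \<one>"
  shows "x = \<one>"
proof -
  have xG: "x \<in> carrier G" using Q_carrier[OF x(1)] .
  define F where "F = {X \<in> E. X #> x = X}"
  define M where "M = E - F"
  have shift: "X #> x \<in> M" if "X \<in> M" for X
  proof -
    have XE: "X \<in> E" "X #> x \<noteq> X" using that by (auto simp: M_def F_def)
    have "X #> x #> x \<noteq> X #> x"
    proof
      assume "X #> x #> x = X #> x"
      then have "X #> x #> x #> inv x = X #> x #> inv x" by simp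
      then show False using XE xG coset_carrier[OF XE(1)] coset_shift by (simp add: coset_shift_mult m_assoc)
    qed
    then show ?thesis using coset_shift[OF XE(1) xG] by (simp add: M_def F_def)
  qed
  have M: "finprod A (\<lambda>X. cocycle X x) M = \<one> \<and> q dvd card M"
    by (rule moved_cosets[OF q xG x(2)]) (use finite_cosets shift in \<open>auto simp: M_def F_def\<close>)
  have fin: "finite M" "finite F" using finite_cosets by (auto simp: M_def F_def)
  have F: "cocycle X x = x" if "X \<in> F" for X
  proof -
    have X: "X \<in> E" "X #> x = X" using that by (auto simp: F_def)
    show ?thesis using cocycle_closed[OF X(1) xG] fusion[OF rep_coset(1)[OF X(1)]] X by (simp add: cocycle_def)
  qed
  have EU: "E = F \<union> M" by (auto simp: M_def F_def)
  have "V x = finprod A (\<lambda>X. cocycle X x) F \<otimes>\<^bsub>A\<^esub> finprod A (\<lambda>X. cocycle X x) M"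
    unfolding V_def EU using fin xG
    by (intro A.finprod_Un_disjoint) (auto simp: M_def F_def cocycle_closed)
  also have "\<dots> = finprod A (\<lambda>X. cocycle X x) F"
    using M A.finprod_closed[of "\<lambda>X. cocycle X x" F] xG by (simp add: F_def cocycle_closed Pi_def Q_carrier)
  also have "\<dots> = finprod A (\<lambda>X. x) F"
    using F x by (intro A.finprod_cong') auto
  also have "\<dots> = x [^] card F" using A.finprod_const[of x F] x by (simp add: nat_pow_consistent[symmetric])
  finally have "x [^] card F \<in> {\<one>}" using V by simp
  moreover have "x [^] q \<in> {\<one>}" using x by simp
  moreover have "card E = card F + card M"
    unfolding EU using fin by (intro card_Un_disjoint) (auto simp: M_def)
  then have "\<not> q dvd card F" using M nd by (simp add: dvd_add_left_iff)
  then have "coprime (card F) q" using q by (simp add: coprime_commute prime_imp_coprime)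
  ultimately show ?thesis using subgroup_pow_coprime[OF triv_subgroup xG] by blast
qed

end

context finite_group
begin

text \<open>The complement is the kernel of the transfer. If it met \<open>Q\<close> nontrivially,
  it would contain an element of order \<open>q\<close> of \<open>Q\<close>, which
  \<open>V_fixed\<close> excludes.\<close>

theorem burnside_normal_complement:
  assumes q: "prime q" and S: "sylow_sub q Q (carrier G)"
    and central: "\<forall>g\<in>normer Q. \<forall>x\<in>Q. g \<otimes> x = x \<otimes> g"
  obtains Y where "Y \<lhd> G" "card Y * card Q = card (carrier G)" "\<not> q dvd card Y"
proof -
  have Q: "subgroup Q G" using S by (rule sylow_subD)
  interpret transfer G Q
    by (intro transfer.intro transfer_axioms.intro finite_group_axioms Q)
      (use central subset_normer[OF Q] in blast)
  interpret V: group_hom G A V by unfold_locales (rule V_hom)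
  define Y where "Y = kernel G A V"
  have Y: "Y \<lhd> G" unfolding Y_def by (rule V.normal_kernel)
  then have subY: "subgroup Y G" by (rule normal_imp_subgroup)
  have cardE: "card E = card (carrier G) div card Q"
    using lagrange[OF Q] subgroup_card_pos[OF Q] by (simp add: order_def) (metis div_mult_self_is_m)
  then have nd: "\<not> q dvd card E" using S by (simp add: sylow_sub_def)
  have subYQ: "subgroup (Y \<inter> Q) G" using subgroups_Inter_pair[OF subY Q] .
  have YQ: "Y \<inter> Q = {\<one>}"
  proof (rule ccontr)
    assume ne: "Y \<inter> Q \<noteq> {\<one>}"
    obtain k where k: "card Q = q ^ k" using sylow_subD[OF S] by blast
    have "card (Y \<inter> Q) dvd q ^ k" using subgroup_card_dvd[OF subYQ Q] k by simp
    then obtain j where j: "card (Y \<inter> Q) = q ^ j" using q by (meson divides_primepow_nat)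
    have "j \<noteq> 0"
    proof
      assume "j = 0"
      then obtain y where "Y \<inter> Q = {y}" using j by (auto simp: card_1_singleton_iff)
      then show False using ne subgroup.one_closed[OF subYQ] by simp
    qed
    then have "q dvd card (Y \<inter> Q)" using j by simp
    then obtain B where B: "subgroup B G" "B \<subseteq> Y \<inter> Q" "card B = q"
      using prime_order_subgroup_exists[OF q subYQ] by blast
    have "B \<noteq> {\<one>}" using B q by auto
    then obtain x where x: "x \<in> B" "x \<noteq> \<one>" using subgroup.one_closed[OF B(1)] by blast
    have "x [^] q = \<one>" using pow_card_subgroup[OF B(1) x(1)] B by simp
    moreover have "V x = \<one>" using x B by (auto simp: Y_def kernel_def)
    moreover have "x \<in> Q" using x B by blast
    ultimately show False
      using V_fixed[OF q _ _ _ nd] sylow_fusion[OF q S central] x by blast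
  qed
  have "Y <#> Q = carrier G"
  proof
    show "Y <#> Q \<subseteq> carrier G" using set_mult_subset[OF subgroup_self] subgroup.subset subY Q by blast
    \<comment> \<open>Being injective on the finite set \<open>Q\<close>, the transfer maps
      \<open>Q\<close> onto itself; so every \<open>g\<close> has the same value as some
      \<open>u\<close> in \<open>Q\<close>, and \<open>g \<otimes> inv u\<close> lies in the
      kernel.\<close>
    have "inj_on V Q"
    proof (rule inj_onI)
      fix u v assume uv: "u \<in> Q" "v \<in> Q" "V u = V v"
      have "V (u \<otimes> inv v) = V u \<otimes>\<^bsub>A\<^esub> inv\<^bsub>A\<^esub> (V v)" using uv Q_carrier by simp
      also have "\<dots> = \<one>" using uv V.hom_closed[OF Q_carrier[of v]] A.r_inv by simp
      finally have "u \<otimes> inv v \<in> Y \<inter> Q"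
        using uv Q_carrier subgroup.m_closed[OF Q] subgroup.m_inv_closed[OF Q] by (simp add: Y_def kernel_def)
      then have "u \<otimes> inv v = \<one>" using YQ by blast
      then have "u \<otimes> inv v \<otimes> v = v" using Q_carrier uv by simp
      then show "u = v" using Q_carrier uv by (simp add: m_assoc)
    qed
    moreover have "V ` Q \<subseteq> Q" using V.hom_closed Q_carrier by auto
    ultimately have VQ: "V ` Q = Q" using subgroup_finite[OF Q] endo_inj_surj by blast
    show "carrier G \<subseteq> Y <#> Q"
    proof
      fix g assume g: "g \<in> carrier G"
      then have "V g \<in> Q" using V.hom_closed by auto
      then obtain u where u: "u \<in> Q" "V u = V g" using VQ by (metis imageE)
      have "V (g \<otimes> inv u) = V g \<otimes>\<^bsub>A\<^esub> inv\<^bsub>A\<^esub> (V u)" using g u Q_carrier by simp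
      also have "\<dots> = \<one>" using u V.hom_closed[OF g] A.r_inv by simp
      finally have "g \<otimes> inv u \<in> Y" using g u Q_carrier by (simp add: Y_def kernel_def)
      moreover have "g = (g \<otimes> inv u) \<otimes> u" using g u Q_carrier by (simp add: m_assoc)
      ultimately show "g \<in> Y <#> Q" using u unfolding set_mult_def by blast
    qed
  qed
  then have card: "card Y * card Q = card (carrier G)" using card_set_mult[OF subY Q] YQ by simp
  then have "card (carrier G) div card Q = card Y"
    using subgroup_card_pos[OF Q] by (metis div_mult_self_is_m)
  then have "\<not> q dvd card Y" using S by (simp add: sylow_sub_def)
  then show ?thesis using that Y card by blast
qed

section \<open>Solvability and maximal subgroups\<close>

lemma finite_group_quotient:
  assumes "N \<lhd> G"
  shows "finite_group (G Mod N)" "group_hom G (G Mod N) (\<lambda>x. N #> x)"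
    "(\<lambda>x. N #> x) ` carrier G = carrier (G Mod N)" "kernel G (G Mod N) (\<lambda>x. N #> x) = N"
proof -
  interpret N: normal N G by fact
  interpret Q: group "G Mod N" by (rule N.factorgroup_is_group)
  have sub: "subgroup N G" using assms by (rule normal_imp_subgroup)
  show img: "(\<lambda>x. N #> x) ` carrier G = carrier (G Mod N)"
    by (auto simp: FactGroup_def RCOSETS_def)
  show "finite_group (G Mod N)"
    by (intro finite_group.intro finite_group_axioms.intro Q.is_group)
      (use img finite_carrier in \<open>metis finite_imageI\<close>)
  show "group_hom G (G Mod N) (\<lambda>x. N #> x)"
    by unfold_locales (use N.r_coset_hom_Mod in auto)
  show "kernel G (G Mod N) (\<lambda>x. N #> x) = N"
    using coset_join1[OF _ _ sub] coset_join2[OF _ sub] N.mem_carrier by (auto simp: kernel_def)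
qed

lemma solvable_subgroup':
  assumes "subgroup H G" "solvable G"
  shows "solvable (G\<lparr>carrier := H\<rparr>)"
proof -
  interpret H: group_hom "G\<lparr>carrier := H\<rparr>" G id
    using subgroup_imp_group[OF assms(1)] subgroup.mem_carrier[OF assms(1)] is_group
    by (auto simp: group_hom_def group_hom_axioms_def hom_def)
  show ?thesis by (rule H.inj_hom_imp_solvable) (use assms in auto)
qed

lemma solvable_extension:
  assumes N: "N \<lhd> G" and "solvable (G\<lparr>carrier := N\<rparr>)" "solvable (G Mod N)"
  shows "solvable G"
proof -
  note q = finite_group_quotient[OF N]
  have sub: "subgroup N G" using N by (rule normal_imp_subgroup)
  have "group_hom (G\<lparr>carrier := N\<rparr>) G id"
    using subgroup_imp_group[OF sub] subgroup.mem_carrier[OF sub] is_group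
    by (auto simp: group_hom_def group_hom_axioms_def hom_def)
  then show ?thesis
    by (rule solvable_condition[OF _ q(2,3)]) (use q assms in auto)
qed

text \<open>Every coset of \<open>N\<close> meets \<open>H\<close>, so the quotient by
  \<open>N\<close> is an image of \<open>H\<close>.\<close>

lemma solvable_supplement:
  assumes N: "N \<lhd> G" "solvable (G\<lparr>carrier := N\<rparr>)"
    and H: "subgroup H G" "solvable (G\<lparr>carrier := H\<rparr>)" "N <#> H = carrier G"
  shows "solvable G"
proof (rule solvable_extension[OF N])
  interpret q: group_hom G "G Mod N" "\<lambda>x. N #> x" using finite_group_quotient[OF N(1)] by blast
  have sub: "subgroup N G" using N(1) by (rule normal_imp_subgroup)
  have NC: "N \<subseteq> carrier G" using sub by (rule subgroup.subset)
  interpret H: group_hom "G\<lparr>carrier := H\<rparr>" "G Mod N" "\<lambda>x. N #> x"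
    using subgroup_imp_group[OF H(1)] subgroup.mem_carrier[OF H(1)] q.H.is_group q.homh
    by (auto simp: group_hom_def group_hom_axioms_def hom_def)
  have "(\<lambda>x. N #> x) ` carrier (G\<lparr>carrier := H\<rparr>) = carrier (G Mod N)"
  proof
    show "carrier (G Mod N) \<subseteq> (\<lambda>x. N #> x) ` carrier (G\<lparr>carrier := H\<rparr>)"
    proof
      fix X assume "X \<in> carrier (G Mod N)"
      then obtain g where g: "g \<in> carrier G" "X = N #> g" using finite_group_quotient(3)[OF N(1)] by auto
      then obtain n h where nh: "n \<in> N" "h \<in> H" "g = n \<otimes> h" using H(3) unfolding set_mult_def by blast
      have hG: "h \<in> carrier G" using subgroup.mem_carrier[OF H(1) nh(2)] .
      have "g \<in> N #> h" using nh by (auto simp: r_coset_def)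
      then have "N #> h = N #> g" using repr_independence[OF _ hG sub] by blast
      then show "X \<in> (\<lambda>x. N #> x) ` carrier (G\<lparr>carrier := H\<rparr>)" using g nh by auto
    qed
  qed (use H.hom_closed in auto)
  then show "solvable (G Mod N)" by (rule H.surj_hom_imp_solvable) (rule H(2))
qed

text \<open>The set is the preimage of the centre of the quotient by \<open>N\<close>, written with
  commutators instead of cosets.\<close>

lemma normal_centralizer_mod:
  assumes N: "N \<lhd> G"
  shows "{x \<in> carrier G. \<forall>g\<in>carrier G. g \<otimes> x \<otimes> inv g \<otimes> inv x \<in> N} \<lhd> G" (is "?Z \<lhd> G")
proof (rule normal_invI)
  note nm = normal_mem[OF N]
  have sub: "subgroup N G" using N by (rule normal_imp_subgroup)
  have NG: "n \<in> carrier G" if "n \<in> N" for n using subgroup.mem_carrier[OF sub that] .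
  show "subgroup ?Z G"
  proof (rule subgroupI)
    have "\<one> \<in> ?Z" using subgroup.one_closed[OF sub] by simp
    then show "?Z \<noteq> {}" by blast
    fix x assume x: "x \<in> ?Z"
    have "g \<otimes> inv x \<otimes> inv g \<otimes> x \<in> N" if g: "g \<in> carrier G" for g
    proof -
      have "inv (inv x \<otimes> (g \<otimes> x \<otimes> inv g \<otimes> inv x) \<otimes> x) \<in> N"
        using x g nm(2) subgroup.m_inv_closed[OF sub] by blast
      then show ?thesis using x g by (simp add: group_normalize)
    qed
    then show "inv x \<in> ?Z" using x by simp
    fix y assume y: "y \<in> ?Z"
    have "g \<otimes> (x \<otimes> y) \<otimes> inv g \<otimes> inv (x \<otimes> y) \<in> N" if g: "g \<in> carrier G" for g
    proof -
      \<comment> \<open>The commutator identity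
        \<open>[g, xy] = [g, x] x [g, y] x^-1\<close>.\<close>
      have "(g \<otimes> x \<otimes> inv g \<otimes> inv x) \<otimes> (x \<otimes> (g \<otimes> y \<otimes> inv g \<otimes> inv y) \<otimes> inv x) \<in> N"
        using x y g nm(1) subgroup.m_closed[OF sub] by blast
      then show ?thesis using x y g by (simp add: group_normalize)
    qed
    then show "x \<otimes> y \<in> ?Z" using x y by simp
  qed auto
  fix h x assume h: "h \<in> carrier G" and x: "x \<in> ?Z"
  have "g \<otimes> (h \<otimes> x \<otimes> inv h) \<otimes> inv g \<otimes> inv (h \<otimes> x \<otimes> inv h) \<in> N" if g: "g \<in> carrier G" for g
  proof -
    have "h \<otimes> ((inv h \<otimes> g \<otimes> h) \<otimes> x \<otimes> inv (inv h \<otimes> g \<otimes> h) \<otimes> inv x) \<otimes> inv h \<in> N"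
      using x h g nm(1) by blast
    then show ?thesis using x h g by (simp add: group_normalize)
  qed
  then show "h \<otimes> x \<otimes> inv h \<in> ?Z" using x h by simp
qed

text \<open>Commutators of elements of this set lie in \<open>N\<close>, so one derivation leads
  into \<open>N\<close>, whose derived series reaches the trivial group.\<close>

lemma solvable_restrict_central_extension:
  assumes N: "N \<lhd> G" "solvable_seq G N"
  shows "solvable_seq G {x \<in> carrier G. \<forall>g\<in>carrier G. g \<otimes> x \<otimes> inv g \<otimes> inv x \<in> N}" (is "solvable_seq G ?Z")
proof -
  have Z: "subgroup ?Z G" using normal_centralizer_mod[OF N(1)] by (rule normal_imp_subgroup)
  have sub: "subgroup N G" using N(1) by (rule normal_imp_subgroup)
  obtain n where n: "(derived G ^^ n) N = {\<one>}" using solvable_imp_trivial_derived_seq[OF N(2)] by blast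
  have "derived G ?Z \<subseteq> N"
    unfolding derived_def by (rule generate_subgroup_incl[OF _ sub]) auto
  then have "(derived G ^^ n) (derived G ?Z) \<subseteq> {\<one>}"
    using mono_exp_of_derived[of "derived G ?Z" N n] n by simp
  then have "(derived G ^^ Suc n) ?Z \<subseteq> {\<one>}" by (simp add: funpow_Suc_right del: funpow.simps)
  moreover have "subgroup ((derived G ^^ Suc n) ?Z) G" by (rule exp_of_derived_is_subgroup[OF Z])
  ultimately have "(derived G ^^ Suc n) ?Z = {\<one>}" using subgroup.one_closed by blast
  then show ?thesis by (rule trivial_derived_seq_imp_solvable[OF Z])
qed

text \<open>Take a largest solvable normal subgroup: the preimage of the centre of the quotient would be larger.\<close>
lemma prime_power_order_solvable:
  assumes p: "prime p" and ord: "card (carrier G) = p ^ k"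
  shows "solvable G"
proof -
  define S where "S = {N. N \<lhd> G \<and> solvable_seq G N}"
  have "finite S"
    by (rule finite_subset[of _ "Pow (carrier G)"])
      (use finite_carrier subgroup.subset normal_imp_subgroup in \<open>auto simp: S_def\<close>)
  moreover have "{\<one>} \<in> S" using one_is_normal solvable_seq.unity by (auto simp: S_def)
  ultimately obtain N where N: "N \<in> S" "\<forall>M\<in>S. N \<subseteq> M \<longrightarrow> M = N"
    using finite_has_maximal[of S] by blast
  then have nN: "N \<lhd> G" "solvable_seq G N" by (auto simp: S_def)
  have sub: "subgroup N G" using nN(1) by (rule normal_imp_subgroup)
  have "N = carrier G"
  proof (rule ccontr)
    assume ne: "N \<noteq> carrier G"
    interpret Q: finite_group "G Mod N" using finite_group_quotient[OF nN(1)] by blast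
    interpret q: group_hom G "G Mod N" "\<lambda>x. N #> x" using finite_group_quotient[OF nN(1)] by blast
    have "card (carrier (G Mod N)) * card N = p ^ k"
      using lagrange[OF sub] ord by (simp add: FactGroup_def order_def)
    then have "card (carrier (G Mod N)) dvd p ^ k" by (metis dvd_triv_left)
    then obtain j where j: "card (carrier (G Mod N)) = p ^ j" using p by (meson divides_primepow_nat)
    obtain g where g: "g \<in> carrier G" "g \<notin> N" using ne subgroup.subset[OF sub] by blast
    then have "N #> g \<noteq> N" using coset_join1[OF _ _ sub] by blast
    then have "carrier (G Mod N) \<noteq> {\<one>\<^bsub>G Mod N\<^esub>}" using q.hom_closed[OF g(1)] by auto
    then obtain z where z: "z \<in> carrier (G Mod N)" "z \<noteq> \<one>\<^bsub>G Mod N\<^esub>" "\<forall>x\<in>carrier (G Mod N). x \<otimes>\<^bsub>G Mod N\<^esub> z = z \<otimes>\<^bsub>G Mod N\<^esub> x"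
      using Q.p_group_center_nontrivial[OF p Q.subgroup_self j] by blast
    obtain x where x: "x \<in> carrier G" "z = N #> x" using z(1) finite_group_quotient(3)[OF nN(1)] by auto
    define Z where "Z = {x \<in> carrier G. \<forall>g\<in>carrier G. g \<otimes> x \<otimes> inv g \<otimes> inv x \<in> N}"
    have "Z \<in> S" using normal_centralizer_mod[OF nN(1)] solvable_restrict_central_extension[OF nN] by (simp add: S_def Z_def)
    moreover have "N \<subseteq> Z"
      using normal_mem(1)[OF nN(1)] subgroup.m_inv_closed[OF sub] subgroup.m_closed[OF sub] subgroup.mem_carrier[OF sub]
      by (auto simp: Z_def)
    moreover have "x \<in> Z"
    proof -
      have "g \<otimes> x \<otimes> inv g \<otimes> inv x \<in> N" if g: "g \<in> carrier G" for g
      proof -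
        have "N #> (g \<otimes> x) = N #> (x \<otimes> g)"
          using z(3)[rule_format, OF q.hom_closed[OF g]] q.hom_mult[OF g x(1)] q.hom_mult[OF x(1) g] x(2) by simp
        then have "(g \<otimes> x) \<otimes> inv (x \<otimes> g) \<in> N" using rcos_eq_mult_inv[OF sub] g x(1) by simp
        then show ?thesis using g x(1) by (simp add: group_normalize)
      qed
      then show ?thesis using x by (simp add: Z_def)
    qed
    moreover have "x \<notin> N" using z(2) x coset_join2[OF x(1) sub] by auto
    ultimately show False using N(2) by blast
  qed
  then show ?thesis using nN(2) by (simp add: solvable_def)
qed

lemma prime_power_subgroup_solvable:
  assumes "prime p" and P: "subgroup P G" "card P = p ^ k"
  shows "solvable (G\<lparr>carrier := P\<rparr>)"
  using finite_group.prime_power_order_solvable[OF finite_group_subgroup[OF P(1)] assms(1)] P(2) by simp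

text \<open>Both sets are subgroups of the ambient group, so that chains of maximal subgroups can be
  treated without nested restrictions of the carrier.\<close>

definition maxin :: "'a set \<Rightarrow> 'a set \<Rightarrow> bool" where
  "maxin A B \<longleftrightarrow> subgroup A G \<and> subgroup B G \<and> A \<subset> B \<and> (\<forall>K. subgroup K G \<and> A \<subseteq> K \<and> K \<subseteq> B \<longrightarrow> K = A \<or> K = B)"

lemma maxinD:
  assumes "maxin A B"
  shows "subgroup A G" "subgroup B G" "A \<subset> B"
    and "\<And>K. subgroup K G \<Longrightarrow> A \<subseteq> K \<Longrightarrow> K \<subseteq> B \<Longrightarrow> K = A \<or> K = B"
  using assms by (auto simp: maxin_def)

lemma maxin_exists:
  assumes A: "subgroup A G" and B: "subgroup B G" and AB: "A \<subset> B"
  shows "\<exists>M. maxin M B \<and> A \<subseteq> M"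
proof -
  define S where "S = {K. subgroup K G \<and> A \<subseteq> K \<and> K \<subset> B}"
  have "finite S"
    by (rule finite_subset[of _ "Pow B"]) (use subgroup_finite[OF B] in \<open>auto simp: S_def\<close>)
  moreover have "A \<in> S" using A AB by (simp add: S_def)
  ultimately obtain M where "M \<in> S" "\<forall>K\<in>S. M \<subseteq> K \<longrightarrow> K = M"
    using finite_has_maximal[of S] by blast
  then have "maxin M B \<and> A \<subseteq> M" using B unfolding maxin_def S_def by blast
  then show ?thesis by blast
qed

text \<open>The product is a subgroup that contains \<open>M\<close> properly. Here \<open>M\<close>
  normalizes \<open>A\<close>; in the primed variant \<open>A\<close> normalizes
  \<open>M\<close>.\<close>

lemma maxin_set_mult:
  assumes M: "maxin M L" and A: "subgroup A G" "A \<subseteq> L" "\<not> A \<subseteq> M" and nrm: "normalizes M A"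
  shows "A <#> M = L"
proof -
  note m = maxinD[OF M]
  have "subgroup (A <#> M) G" by (rule set_mult_subgroup[OF A(1) m(1) nrm])
  moreover have "M \<subseteq> A <#> M" using subset_set_mult_right[OF A(1) subgroup.subset[OF m(1)]] .
  moreover have "A \<subseteq> A <#> M" using subset_set_mult_left[OF subgroup.subset[OF A(1)] m(1)] .
  moreover have "A <#> M \<subseteq> L" using set_mult_subset[OF m(2) A(2)] m(3) by blast
  ultimately show ?thesis using m(4)[of "A <#> M"] A(3) by blast
qed

lemma maxin_set_mult':
  assumes M: "maxin M L" and A: "subgroup A G" "A \<subseteq> L" "\<not> A \<subseteq> M" and nrm: "normalizes A M"
  shows "M <#> A = L"
proof -
  note m = maxinD[OF M]
  have "subgroup (M <#> A) G" by (rule set_mult_subgroup[OF m(1) A(1) nrm])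
  moreover have "M \<subseteq> M <#> A" using subset_set_mult_left[OF subgroup.subset[OF m(1)] A(1)] .
  moreover have "A \<subseteq> M <#> A" using subset_set_mult_right[OF m(1) subgroup.subset[OF A(1)]] .
  moreover have "M <#> A \<subseteq> L" using set_mult_subset[OF m(2) _ A(2)] m(3) by blast
  ultimately show ?thesis using m(4)[of "M <#> A"] A(3) by blast
qed

lemma prime_power_coprime_subgroups:
  assumes "subgroup A G" "subgroup B G" "coprime (card A) (card B)"
  shows "A \<inter> B = {\<one>}"
proof -
  have AB: "subgroup (A \<inter> B) G" using assms subgroups_Inter_pair by blast
  have "card (A \<inter> B) dvd card A" "card (A \<inter> B) dvd card B"
    using subgroup_card_dvd[OF AB] assms by auto
  then have "card (A \<inter> B) = 1" using assms(3) coprime_common_divisor_nat by blast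
  then obtain y where "A \<inter> B = {y}" by (auto simp: card_1_singleton_iff)
  then show ?thesis using subgroup.one_closed[OF AB] by simp
qed

lemma subgroup_trivialI_card:
  assumes "subgroup P G" "card P = 1" shows "P = {\<one>}"
  using assms subgroup.one_closed[OF assms(1)] by (auto simp: card_1_singleton_iff)

lemma self_normalizing_not_normal:
  assumes "maxin P (carrier G)" "\<not> P \<lhd> G"
  shows "normer P = P"
  using maxinD(4)[OF assms(1) normer_subgroup[OF maxinD(1)[OF assms(1)]] subset_normer[OF maxinD(1)[OF assms(1)]]]
    assms normal_iff_normer[of P] maxinD(1)[OF assms(1)] by (auto simp: normer_def)

text \<open>For a prime \<open>r\<close> dividing the index of \<open>P\<close>, a Sylow
  \<open>r\<close>-subgroup cannot lie in \<open>P\<close>, so it supplements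
  \<open>P\<close>.\<close>

lemma solvable_of_normal_maximal:
  assumes P: "maxin P (carrier G)" "P \<lhd> G" and solP: "solvable (G\<lparr>carrier := P\<rparr>)"
  shows "solvable G"
proof -
  note m = maxinD[OF P(1)]
  have lt: "card P < card (carrier G)" using m(3) finite_carrier psubset_card_mono by blast
  have "card P dvd card (carrier G)" using subgroup_card_dvd[OF m(1,2)] m(3) by blast
  then obtain c where c: "card (carrier G) = card P * c" by blast
  have "c \<noteq> 1" using lt c by auto
  then obtain r where r: "prime r" "r dvd c" using prime_factor_nat by blast
  obtain S where S: "sylow_sub r S (carrier G)" using sylow_exists[OF r(1) subgroup_self] by blast
  have subS: "subgroup S G" using S by (rule sylow_subD)
  have notP: "\<not> S \<subseteq> P"
  proof
    assume "S \<subseteq> P"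
    then have "card S dvd card P" using subgroup_card_dvd[OF subS m(1)] by blast
    then obtain d where d: "card P = card S * d" by blast
    then have "card (carrier G) div card S = d * c"
      using c subgroup_card_pos[OF subS] by (simp add: mult.assoc)
    then show False using r(2) sylow_card(2)[OF subgroup_self S] by simp
  qed
  have "P <#> S = carrier G"
    by (rule maxin_set_mult'[OF P(1) subS sylow_subD(2)[OF S] notP])
      (use normal_mem(1)[OF P(2)] subgroup.mem_carrier[OF subS] in blast)
  moreover obtain j where "card S = r ^ j" using sylow_subD(3)[OF S] by blast
  ultimately show ?thesis
    using solvable_supplement[OF P(2) solP subS] prime_power_subgroup_solvable[OF r(1) subS] by blast
qed

text \<open>If \<open>P\<close> is not normal, it is its own normalizer; unless \<open>G\<close> is
  a \<open>p\<close>-group, \<open>P\<close> is then a Sylow subgroup and Burnside's theorem gives a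
  normal complement \<open>Y\<close>. A Sylow subgroup \<open>R\<close> of \<open>Y\<close>
  normalized by \<open>P\<close> satisfies \<open>R P = G\<close> by maximality, so \<open>R\<close>
  is normal and is supplemented by \<open>P\<close>.\<close>

theorem solvable_of_abelian_prime_power_maximal:
  assumes p: "prime p" and P: "maxin P (carrier G)" "card P = p ^ k" and comm: "\<forall>x\<in>P. \<forall>y\<in>P. x \<otimes> y = y \<otimes> x"
  shows "solvable G"
proof -
  note m = maxinD[OF P(1)]
  have solP: "solvable (G\<lparr>carrier := P\<rparr>)" by (rule prime_power_subgroup_solvable[OF p m(1) P(2)])
  show ?thesis
  proof (cases "P \<lhd> G")
    case True
    then show ?thesis by (rule solvable_of_normal_maximal[OF P(1) _ solP])
  next
    case False
    have nP: "normer P = P" using self_normalizing_not_normal[OF P(1) False] .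
    obtain S where S: "sylow_sub p S (carrier G)" using sylow_exists[OF p subgroup_self] by blast
    then obtain b where b: "b \<in> carrier G" "\<forall>x\<in>P. b \<otimes> x \<otimes> inv b \<in> S"
      using p_subgroup_conjugate_into_sylow[OF p S m(1) P(2)] by blast
    \<comment> \<open>Conjugating the Sylow subgroup back, instead of \<open>P\<close> forward,
      gives one that contains \<open>P\<close>.\<close>
    define T where "T = conjug (inv b) S"
    have T: "sylow_sub p T (carrier G)" unfolding T_def
      by (rule sylow_conjug[OF S subgroup_self])
        (use b normer_iff[OF subgroup_self, of "inv b"] in \<open>auto simp: normer_def\<close>)
    have "conjug (inv b) (conjug b P) \<subseteq> T" unfolding T_def using b by (intro conjug_mono) (simp add: conjug_subset_iff)
    then have "P \<subseteq> T" using conjug_cancel[OF subgroup.subset[OF m(1)] b(1)] by simp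
    then have "T = P \<or> T = carrier G" using m(4)[OF sylow_subD(1)[OF T]] sylow_subD(2)[OF T] by blast
    then show ?thesis
    proof
      assume "T = carrier G"
      then show ?thesis using sylow_subD(3)[OF T] prime_power_order_solvable[OF p] by blast
    next
      assume TP: "T = P"
      then obtain Y where Y: "Y \<lhd> G" "card Y * card P = card (carrier G)" "\<not> p dvd card Y"
        using burnside_normal_complement[OF p, of P] T comm nP by auto
      have subY: "subgroup Y G" using Y(1) by (rule normal_imp_subgroup)
      have "card Y \<noteq> 1"
      proof
        assume "card Y = 1"
        then have "P = carrier G" using Y(2) m(3) finite_carrier by (intro card_subset_eq) auto
        then show False using m(3) by blast
      qed
      then obtain r where r: "prime r" "r dvd card Y" using prime_factor_nat by blast
      have rp: "r \<noteq> p" using r Y(3) by blast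
      obtain R where R: "sylow_sub r R Y" "P \<subseteq> normer R"
        using p_group_normalizes_sylow[OF p r(1) m(1) P(2) Y(1,3)] by blast
      have subR: "subgroup R G" using R(1) by (rule sylow_subD)
      obtain j where j: "card R = r ^ j" using sylow_subD(3)[OF R(1)] by blast
      have "r dvd card R" using sylow_nontrivial[OF subY R(1) r(2,1)] .
      have "\<not> R \<subseteq> P"
      proof
        assume "R \<subseteq> P"
        then have "r dvd p ^ k" using \<open>r dvd card R\<close> subgroup_card_dvd[OF subR m(1)] P(2) dvd_trans by metis
        then show False using r(1) p rp by (metis prime_dvd_power primes_dvd_imp_eq)
      qed
      then have RP: "R <#> P = carrier G"
        using maxin_set_mult[OF P(1) subR] subgroup.subset[OF subR] R(2) by (auto simp: normer_def)
      have "R <#> P \<subseteq> normer R"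
        using set_mult_subset[OF normer_subgroup[OF subR] subset_normer[OF subR] R(2)] .
      then have "R \<lhd> G" using RP normal_iff_normer[of R] subR by (auto simp: normer_def)
      then show ?thesis using solvable_supplement[OF _ _ m(1) solP RP] prime_power_subgroup_solvable[OF r(1) subR j] by blast
    qed
  qed
qed

section \<open>Minimal normal subgroups and \<sigma>-subnormality\<close>

text \<open>By the second isomorphism theorem the index of \<open>C \<inter> D\<close> in
  \<open>D\<close> is the index of \<open>C\<close> in the product \<open>C D\<close>, a subgroup of
  \<open>B\<close>.\<close>

lemma index_Int_dvd:
  assumes B: "subgroup B G" and C: "subgroup C G" "C \<subseteq> B" "normalizes B C"
    and D: "subgroup D G" "D \<subseteq> B"
  shows "card D div card (C \<inter> D) dvd card B div card C"
proof -
  have CD: "subgroup (C \<inter> D) G" using subgroups_Inter_pair[OF C(1) D(1)] .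
  have P: "subgroup (C <#> D) G" using set_mult_subgroup[OF C(1) D(1)] C(3) D(2) by blast
  have CP: "C \<subseteq> C <#> D" using subset_set_mult_left[OF subgroup.subset[OF C(1)] D(1)] .
  obtain e where e: "card (C <#> D) = card C * e" using subgroup_card_dvd[OF C(1) P CP] by blast
  have "card C * (e * card (C \<inter> D)) = card C * card D" using card_set_mult[OF C(1) D(1)] e by (simp add: mult.assoc)
  then have "e * card (C \<inter> D) = card D" using subgroup_card_pos[OF C(1)] by simp
  then have "card D div card (C \<inter> D) = e" using subgroup_card_pos[OF CD] by (metis div_mult_self_is_m)
  moreover have "card (C <#> D) div card C = e" using e subgroup_card_pos[OF C(1)] by simp
  moreover have "card (C <#> D) div card C dvd card B div card C"
    using subgroup_card_dvd[OF P B set_mult_subset[OF B C(2) D(2)]] subgroup_card_dvd[OF C(1) P CP]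
    by (metis div_dvd_div dvd_trans)
  ultimately show ?thesis by simp
qed

text \<open>Modulo \<open>A\<close> the elements \<open>a \<otimes> n\<close> and \<open>n\<close>
  have the same powers; each new factor \<open>a\<close> is moved to the left past a power of
  \<open>n\<close>.\<close>

lemma normal_mult_pow:
  assumes A: "subgroup A G" and B: "subgroup B G" "A \<subseteq> B" "normalizes B A"
    and a: "a \<in> A" and n: "n \<in> B"
  shows "\<exists>c\<in>A. (a \<otimes> n) [^] (m::nat) = c \<otimes> n [^] m"
proof (induction m)
  case 0
  show ?case by (rule bexI[OF _ subgroup.one_closed[OF A]]) simp
next
  case (Suc m)
  then obtain c where c: "c \<in> A" "(a \<otimes> n) [^] m = c \<otimes> n [^] m" by blast
  have cl: "a \<in> carrier G" "n \<in> carrier G" "c \<in> carrier G"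
    using subgroup.mem_carrier[OF A] subgroup.mem_carrier[OF B(1)] a n c(1) by auto
  have "n [^] m \<otimes> a \<otimes> inv (n [^] m) \<in> A" using B(3) a pow_in_subgroup[OF B(1) n] by blast
  then have "c \<otimes> (n [^] m \<otimes> a \<otimes> inv (n [^] m)) \<in> A" using subgroup.m_closed[OF A c(1)] by blast
  moreover have "(a \<otimes> n) [^] Suc m = c \<otimes> (n [^] m \<otimes> a \<otimes> inv (n [^] m)) \<otimes> n [^] Suc m"
    using cl c(2) by (simp add: m_assoc)
  ultimately show ?case by blast
qed

text \<open>The commutator of \<open>n\<close> and \<open>a\<close> lies in both \<open>A\<close>
  and \<open>N\<close>. The assumptions concern this one pair, so \<open>A\<close> may be a subgroup
  whose normality is not yet known.\<close>

lemma commute_of_trivial_Int: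
  assumes "A \<inter> N = {\<one>}" and "a \<in> A" "n \<in> N" and A: "subgroup A G" and N: "subgroup N G"
    and "n \<otimes> a \<otimes> inv n \<in> A" "a \<otimes> n \<otimes> inv a \<in> N"
  shows "a \<otimes> n = n \<otimes> a"
proof -
  have cl: "a \<in> carrier G" "n \<in> carrier G" using assms subgroup.mem_carrier by metis+
  have "n \<otimes> a \<otimes> inv n \<otimes> inv a \<in> A" using assms(6) subgroup.m_closed[OF A] subgroup.m_inv_closed[OF A assms(2)] by blast
  moreover have "n \<otimes> inv (a \<otimes> n \<otimes> inv a) \<in> N" using assms(7) subgroup.m_closed[OF N assms(3)] subgroup.m_inv_closed[OF N] by blast
  then have "n \<otimes> a \<otimes> inv n \<otimes> inv a \<in> N" using cl by (simp add: group_normalize)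
  ultimately have "n \<otimes> a \<otimes> inv n \<otimes> inv a = \<one>" using assms(1) by blast
  then have "n \<otimes> a \<otimes> inv n \<otimes> inv a \<otimes> (a \<otimes> n) = a \<otimes> n" using cl by simp
  then show ?thesis using cl by (simp add: m_assoc)
qed

lemma normal_subgroups_commute:
  assumes A: "A \<lhd> G" and N: "N \<lhd> G" and "A \<inter> N = {\<one>}" and "a \<in> A" "n \<in> N"
  shows "a \<otimes> n = n \<otimes> a"
proof -
  note sub = normal_imp_subgroup[OF A] normal_imp_subgroup[OF N]
  show ?thesis
    using commute_of_trivial_Int[OF assms(3-5) sub] normal_mem(1)[OF A subgroup.mem_carrier[OF sub(2) assms(5)] assms(4)]
      normal_mem(1)[OF N subgroup.mem_carrier[OF sub(1) assms(4)] assms(5)] by blast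
qed

definition minimal_normal :: "'a set \<Rightarrow> bool" where
  "minimal_normal N \<longleftrightarrow> N \<lhd> G \<and> N \<noteq> {\<one>} \<and> (\<forall>K. K \<lhd> G \<and> K \<subseteq> N \<longrightarrow> K = {\<one>} \<or> K = N)"

lemma conj_nat_pow:
  assumes "g \<in> carrier G" "h \<in> carrier G"
  shows "(g \<otimes> h \<otimes> inv g) [^] (m :: nat) = g \<otimes> h [^] m \<otimes> inv g"
  using assms by (induction m) (auto simp: group_normalize)

lemma normal_generate_p_elements:
  assumes N: "N \<lhd> G"
  shows "generate G {x \<in> N. \<exists>k. x [^] (p ^ k :: nat) = \<one>} \<lhd> G"
proof (rule normal_generateI)
  note sub = normal_imp_subgroup[OF N]
  show "{x \<in> N. \<exists>k. x [^] (p ^ k) = \<one>} \<subseteq> carrier G" using subgroup.mem_carrier[OF sub] by blast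
  fix h g assume h: "h \<in> {x \<in> N. \<exists>k. x [^] (p ^ k) = \<one>}" and g: "g \<in> carrier G"
  then obtain k where k: "h [^] (p ^ k) = \<one>" by blast
  have hG: "h \<in> carrier G" using h subgroup.mem_carrier[OF sub] by blast
  have "(g \<otimes> h \<otimes> inv g) [^] (p ^ k) = \<one>" using conj_nat_pow[OF g hG] g k by simp
  then show "g \<otimes> h \<otimes> inv g \<in> {x \<in> N. \<exists>k. x [^] (p ^ k) = \<one>}"
    using g h normal_mem(1)[OF N g] by blast
qed

lemma p_elements_nontrivial:
  assumes "prime p" and N: "subgroup N G" "p dvd card N"
  obtains x where "x \<in> N" "x \<noteq> \<one>" "x [^] p = \<one>"
proof -
  obtain A where A: "subgroup A G" "A \<subseteq> N" "card A = p"
    using prime_order_subgroup_exists[OF assms] by blast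
  have "A \<noteq> {\<one>}" using A(3) assms(1) by auto
  then obtain x where "x \<in> A" "x \<noteq> \<one>" using subgroup.one_closed[OF A(1)] by blast
  then show ?thesis using that A pow_card_subgroup[OF A(1)] by auto
qed

text \<open>The \<open>p\<close>-elements of \<open>N\<close> generate a normal subgroup of
  \<open>G\<close>, nontrivial by Cauchy's theorem, hence all of \<open>N\<close>. Thus an inclusion
  in \<open>B\<close> can be checked on \<open>p\<close>-elements for a single prime divisor of
  \<open>card N\<close>.\<close>

lemma minimal_normal_subsetI:
  assumes N: "minimal_normal N" and p: "prime p" "p dvd card N" and B: "subgroup B G"
    and el: "\<And>x k. x \<in> N \<Longrightarrow> x [^] (p ^ k :: nat) = \<one> \<Longrightarrow> x \<in> B"
  shows "N \<subseteq> B"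
proof -
  define W where "W = generate G {x \<in> N. \<exists>k. x [^] (p ^ k :: nat) = \<one>}"
  have nN: "N \<lhd> G" using N by (simp add: minimal_normal_def)
  note sub = normal_imp_subgroup[OF nN]
  obtain x where x: "x \<in> N" "x \<noteq> \<one>" "x [^] p = \<one>" using p_elements_nontrivial[OF p(1) sub p(2)] by blast
  then have "x [^] (p ^ 1) = \<one>" by simp
  then have "x \<in> W" unfolding W_def using x by (intro generate.incl) blast
  moreover have "W \<subseteq> N" unfolding W_def by (rule generate_subgroup_incl[OF _ sub]) blast
  moreover have "W \<lhd> G" unfolding W_def by (rule normal_generate_p_elements[OF nN])
  ultimately have "W = N" using N x by (auto simp: minimal_normal_def)
  moreover have "W \<subseteq> B" unfolding W_def by (rule generate_subgroup_incl[OF _ B]) (use el in blast)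
  ultimately show ?thesis by blast
qed

end

text \<open>The arithmetic form of \<open>pi_group\<close>: it tests an index
  \<open>card B div card C\<close> without forming a quotient group.\<close>

definition pi_number :: "nat set \<Rightarrow> nat \<Rightarrow> bool" where
  "pi_number \<pi> n \<longleftrightarrow> (\<forall>p. prime p \<and> p dvd n \<longrightarrow> p \<in> \<pi>)"

lemma pi_number_dvd: "pi_number \<pi> n \<Longrightarrow> m dvd n \<Longrightarrow> pi_number \<pi> m"
  using dvd_trans by (auto simp: pi_number_def)

section \<open>Chains of \<sigma>-steps and the subgroups they connect to \<open>G\<close>\<close>

locale sigma_group = finite_group +
  fixes \<sigma> :: "nat set set"
  assumes partition: "partition_on {p::nat. prime p} \<sigma>"
begin

lemma class_unique: "\<pi> \<in> \<sigma> \<Longrightarrow> \<tau> \<in> \<sigma> \<Longrightarrow> p \<in> \<pi> \<Longrightarrow> p \<in> \<tau> \<Longrightarrow> \<pi> = \<tau>"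
  using partition by (auto simp: partition_on_def disjoint_def)

lemma class_exists: "prime p \<Longrightarrow> \<exists>\<pi>\<in>\<sigma>. p \<in> \<pi>"
  using partition by (auto simp: partition_on_def)

lemma pi_number_coprime:
  assumes "pi_number \<pi> m" "pi_number \<tau> n" "\<pi> \<in> \<sigma>" "\<tau> \<in> \<sigma>" "\<pi> \<noteq> \<tau>"
  shows "coprime m n"
proof (rule ccontr)
  assume "\<not> coprime m n"
  then have "gcd m n \<noteq> 1" by (simp add: coprime_iff_gcd_eq_1)
  then obtain p where "prime p" "p dvd gcd m n" using prime_factor_nat by blast
  then have "p \<in> \<pi>" "p \<in> \<tau>" using assms(1,2) by (auto simp: pi_number_def)
  then show False using class_unique assms(3-5) by blast
qed

lemma pi_number_coprime_prime_power:
  assumes "pi_number \<pi> m" "prime p" "p \<notin> \<pi>"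
  shows "coprime (p ^ k) m"
proof -
  have "\<not> p dvd m" using assms by (auto simp: pi_number_def)
  then show ?thesis using assms(2) prime_imp_coprime by auto
qed

text \<open>The normal subgroup \<^term>\<open>C\<close> stands for the core of \<^term>\<open>A\<close> in \<^term>\<open>B\<close>: enlarging it only shrinks the index.\<close>
definition sigma_step :: "'a set \<Rightarrow> 'a set \<Rightarrow> bool" where
  "sigma_step A B \<longleftrightarrow> subgroup A G \<and> subgroup B G \<and> A \<subseteq> B \<and>
     (normalizes B A \<or>
      (\<exists>C \<pi>. subgroup C G \<and> C \<subseteq> A \<and> normalizes B C \<and> \<pi> \<in> \<sigma> \<and> pi_number \<pi> (card B div card C)))"

abbreviation sn_in :: "'a set \<Rightarrow> 'a set \<Rightarrow> bool" where
  "sn_in \<equiv> sigma_step\<^sup>*\<^sup>*"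

abbreviation sn :: "'a set \<Rightarrow> bool" where
  "sn A \<equiv> sn_in A (carrier G)"

lemma sigma_stepE:
  assumes "sigma_step A B"
  obtains "normalizes B A"
  | C \<pi> where "subgroup C G" "C \<subseteq> A" "normalizes B C" "\<pi> \<in> \<sigma>" "pi_number \<pi> (card B div card C)"
  using assms unfolding sigma_step_def by blast

lemma sigma_step_subgroups:
  assumes "sigma_step A B"
  shows "subgroup A G" "subgroup B G" "A \<subseteq> B"
  using assms by (auto simp: sigma_step_def)

lemma sigma_group_subgroup:
  assumes "subgroup M G"
  shows "sigma_group (G\<lparr>carrier := M\<rparr>) \<sigma>"
  using finite_group_subgroup[OF assms] partition by (simp add: sigma_group_def sigma_group_axioms_def)

lemma sigma_step_restrict:
  assumes M: "subgroup M G"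
  shows "sigma_group.sigma_step (G\<lparr>carrier := M\<rparr>) \<sigma> A B \<longleftrightarrow> sigma_step A B \<and> B \<subseteq> M"
proof -
  interpret M: sigma_group "G\<lparr>carrier := M\<rparr>" \<sigma> using M by (rule sigma_group_subgroup)
  have *: "b \<otimes> a \<otimes> inv\<^bsub>G\<lparr>carrier := M\<rparr>\<^esub> b = b \<otimes> a \<otimes> inv b" if "b \<in> B" "B \<subseteq> M" for a b
    using that m_inv_consistent[OF M, of b] by auto
  show ?thesis
  proof (cases "A \<subseteq> B \<and> B \<subseteq> M")
    case True
    have ex: "(\<exists>C \<pi>. (subgroup C G \<and> C \<subseteq> M) \<and> C \<subseteq> A \<and> R C \<pi>) \<longleftrightarrow> (\<exists>C \<pi>. subgroup C G \<and> C \<subseteq> A \<and> R C \<pi>)" for R :: "'a set \<Rightarrow> nat set \<Rightarrow> bool"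
      using True by blast
    show ?thesis
      unfolding M.sigma_step_def sigma_step_def subgroup_restrict_iff[OF M] ex
      using True * by auto
  next
    case False
    then show ?thesis
      unfolding M.sigma_step_def sigma_step_def subgroup_restrict_iff[OF M] by blast
  qed
qed

lemma sn_restrict:
  assumes M: "subgroup M G" and A: "A \<subseteq> M"
  shows "(sigma_group.sigma_step (G\<lparr>carrier := M\<rparr>) \<sigma>)\<^sup>*\<^sup>* A M \<longleftrightarrow> sn_in A M"
proof
  assume "(sigma_group.sigma_step (G\<lparr>carrier := M\<rparr>) \<sigma>)\<^sup>*\<^sup>* A M"
  then show "sn_in A M"
    by (rule rtranclp_mono[THEN predicate2D, rotated]) (auto simp: sigma_step_restrict[OF M])
next
  assume "sn_in A M"
  then show "(sigma_group.sigma_step (G\<lparr>carrier := M\<rparr>) \<sigma>)\<^sup>*\<^sup>* A M"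
  proof (induction rule: converse_rtranclp_induct)
    case (step y z)
    have "z \<subseteq> M" using step(2) by (induction rule: converse_rtranclp_induct) (auto simp: sigma_step_def)
    then show ?case using step sigma_step_restrict[OF M] converse_rtranclp_into_rtranclp by metis
  qed simp
qed

text \<open>In the second case the witness \<open>C \<inter> M\<close> need not be the core of
  \<open>A \<inter> M\<close>; here it pays that \<open>sigma_step\<close> admits any suitable
  normal subgroup.\<close>

lemma sigma_step_Int:
  assumes AB: "sigma_step A B" and M: "subgroup M G"
  shows "sigma_step (A \<inter> M) (B \<inter> M)"
proof -
  note sub = sigma_step_subgroups[OF AB]
  have subM: "subgroup (A \<inter> M) G" "subgroup (B \<inter> M) G" using sub M subgroups_Inter_pair by auto
  have cM: "b \<otimes> a \<otimes> inv b \<in> M" if "b \<in> M" "a \<in> M" for a b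
    using that M subgroup.m_closed[OF M] subgroup.m_inv_closed[OF M] by blast
  from AB show ?thesis
  proof (cases rule: sigma_stepE)
    case n: 1
    then have "normalizes (B \<inter> M) (A \<inter> M)" using cM by blast
    then show ?thesis unfolding sigma_step_def using subM sub(3) by blast
  next
    case p: (2 C \<pi>)
    have CM: "subgroup (C \<inter> M) G" using p(1) M subgroups_Inter_pair by auto
    have CB: "C \<subseteq> B" using p(2) sub(3) by blast
    have "C \<inter> (B \<inter> M) = C \<inter> M" using CB by blast
    then have "card (B \<inter> M) div card (C \<inter> M) dvd card B div card C"
      using index_Int_dvd[OF sub(2) p(1) CB p(3) subM(2)] by auto
    then have "pi_number \<pi> (card (B \<inter> M) div card (C \<inter> M))" using p(5) pi_number_dvd by blast
    moreover have "normalizes (B \<inter> M) (C \<inter> M)" using cM p(3) by blast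
    moreover have "C \<inter> M \<subseteq> A \<inter> M" using p(2) by blast
    ultimately show ?thesis unfolding sigma_step_def using subM sub(3) CM p(4) by blast
  qed
qed

lemma sn_Int:
  assumes "sn_in A B" and M: "subgroup M G"
  shows "sn_in (A \<inter> M) (B \<inter> M)"
  using assms(1)
proof (induction rule: rtranclp_induct)
  case (step y z)
  then show ?case using sigma_step_Int[OF _ M] rtranclp.rtrancl_into_rtrancl by metis
qed simp

lemma sn_subgroup:
  assumes "sn A" "subgroup M G" "A \<subseteq> M"
  shows "sn_in A M"
  using sn_Int[OF assms(1,2)] assms(3) subgroup.subset[OF assms(2)] by (simp add: Int_absorb1 Int_absorb2)

lemma sn_imp_subgroup: "sn A \<Longrightarrow> subgroup A G"
  by (induction rule: converse_rtranclp_induct) (auto simp: sigma_step_def subgroup_self)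

text \<open>Modulo each term of the chain, \<^term>\<open>a \<otimes> n\<close> is congruent to \<^term>\<open>n\<close>, whose order is a \<^term>\<open>\<pi>\<close>-number.\<close>
lemma p_element_mem_sn:
  assumes A: "sn A" and N: "N \<lhd> G" "\<pi> \<in> \<sigma>" "pi_number \<pi> (card N)"
    and p: "prime p" "p \<notin> \<pi>" and a: "a \<in> A" and n: "n \<in> N" and el: "(a \<otimes> n) [^] (p ^ k :: nat) = \<one>"
  shows "a \<otimes> n \<in> A"
proof -
  have subN: "subgroup N G" using N(1) by (rule normal_imp_subgroup)
  have nG: "n \<in> carrier G" using subgroup.mem_carrier[OF subN n] .
  have aG: "a \<in> carrier G" using subgroup.mem_carrier[OF sn_imp_subgroup[OF A] a] .
  have npow: "n [^] card N = \<one>" by (rule pow_card_subgroup[OF subN n])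
  \<comment> \<open>Induction down the chain from \<open>G\<close> with \<open>a\<close> and
    \<open>n\<close> fixed: once \<open>a\<close> lies in a term, it lies in all larger
    ones.\<close>
  have "a \<in> A \<longrightarrow> a \<otimes> n \<in> A" using A
  proof (induction rule: converse_rtranclp_induct)
    case base
    then show ?case using aG nG by simp
  next
    case (step y z)
    show ?case
    proof
      assume ay: "a \<in> y"
      note sub = sigma_step_subgroups[OF step(1)]
      have xz: "a \<otimes> n \<in> z" using step ay sub by blast
      have "inv a \<otimes> (a \<otimes> n) \<in> z" using subgroup.m_closed[OF sub(2) subgroup.m_inv_closed[OF sub(2) subsetD[OF sub(3) ay]] xz] .
      then have nz: "n \<in> z" using aG nG by simp
      from step(1) show "a \<otimes> n \<in> y"
      proof (cases rule: sigma_stepE)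
        case n: 1
        \<comment> \<open>From \<open>c \<otimes> n [^] (p ^ k) = \<one>\<close> the power
          \<open>n [^] (p ^ k)\<close> lies in \<open>y\<close>. As \<open>card N\<close> is prime
          to \<open>p\<close>, so does \<open>n\<close>.\<close>
        obtain c where c: "c \<in> y" "(a \<otimes> n) [^] (p ^ k) = c \<otimes> n [^] (p ^ k)"
          using normal_mult_pow[OF sub(1,2,3) n ay nz] by blast
        have cG: "c \<in> carrier G" using subgroup.mem_carrier[OF sub(1) c(1)] .
        have "n [^] (p ^ k) = inv c \<otimes> (c \<otimes> n [^] (p ^ k))" using cG nG by simp
        also have "\<dots> = inv c \<otimes> \<one>" by (simp only: c(2)[symmetric] el)
        also have "\<dots> = inv c" using cG by simp
        finally have "n [^] (p ^ k) = inv c" .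
        then have 1: "n [^] (p ^ k) \<in> y" using subgroup.m_inv_closed[OF sub(1) c(1)] by simp
        have 2: "n [^] card N \<in> y" using npow subgroup.one_closed[OF sub(1)] by simp
        have "n \<in> y"
          using subgroup_pow_coprime[OF sub(1) nG 1 2 pi_number_coprime_prime_power[OF N(3) p]] .
        then show ?thesis using subgroup.m_closed[OF sub(1) ay] by blast
      next
        case p': (2 C \<tau>)
        have Cz: "C \<subseteq> z" using p' sub by blast
        \<comment> \<open>If \<open>p \<in> \<tau>\<close>, the index of \<open>C\<close> in
          \<open>z\<close> is prime to \<open>card N\<close> and \<open>n\<close> falls into
          \<open>C\<close>; otherwise the index is prime to \<open>p\<close> and the
          \<open>p\<close>-element \<open>a \<otimes> n\<close> does.\<close>
        show ?thesis
        proof (cases "p \<in> \<tau>")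
          case True
          then have ne: "\<pi> \<noteq> \<tau>" using p by blast
          have "n [^] card N \<in> C" using npow subgroup.one_closed[OF p'(1)] by simp
          then have "n \<in> C"
            using mem_of_coprime_index[OF sub(2) p'(1) Cz p'(3) nz] pi_number_coprime[OF N(3) p'(5) N(2) p'(4) ne] by blast
          then show ?thesis using subgroup.m_closed[OF sub(1) ay] p'(2) by blast
        next
          case False
          have "(a \<otimes> n) [^] (p ^ k) \<in> C" using el subgroup.one_closed[OF p'(1)] by simp
          then have "a \<otimes> n \<in> C"
            using mem_of_coprime_index[OF sub(2) p'(1) Cz p'(3) xz] pi_number_coprime_prime_power[OF p'(5) p(1) False] by blast
          then show ?thesis using p'(2) by blast
        qed
      qed
    qed
  qed
  then show ?thesis using a by blast
qed

definition nonprimary :: "nat \<Rightarrow> bool" where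
  "nonprimary n \<longleftrightarrow> (\<forall>\<pi>\<in>\<sigma>. \<not> pi_number \<pi> n)"

text \<open>\<open>card N\<close> has a prime divisor \<open>r\<close> outside
  \<open>\<tau>\<close>; the \<open>r\<close>-elements of \<open>N\<close> are trivial modulo
  \<open>C\<close>, and they generate \<open>N\<close>.\<close>

lemma minimal_normal_subset_of_primary_index:
  assumes N: "minimal_normal N" "nonprimary (card N)" and B: "subgroup B G" "N \<subseteq> B"
    and C: "subgroup C G" "C \<subseteq> B" "normalizes B C" "\<tau> \<in> \<sigma>" "pi_number \<tau> (card B div card C)"
  shows "N \<subseteq> C"
proof -
  obtain r where r: "prime r" "r dvd card N" "r \<notin> \<tau>"
    using N(2) C(4) by (auto simp: nonprimary_def pi_number_def)
  show ?thesis
  proof (rule minimal_normal_subsetI[OF N(1) r(1,2) C(1)])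
    fix x k assume x: "x \<in> N" "x [^] (r ^ k :: nat) = \<one>"
    then show "x \<in> C"
      using mem_of_coprime_index[OF B(1) C(1-3) subsetD[OF B(2) x(1)], of "r ^ k"] subgroup.one_closed[OF C(1)]
        pi_number_coprime_prime_power[OF C(5) r(1,3)] by simp
  qed
qed

text \<open>Induction down the chain. In a normal step the lower term contains with \<open>Q\<close>
  all conjugates of \<open>Q\<close> under \<open>N\<close>, hence every \<open>q\<close>-element of
  \<open>N\<close>. In a step of primary index it contains \<open>N\<close> because \<open>N\<close>
  is not primary.\<close>

lemma sn_contains_minimal_normal:
  assumes A: "sn A" and N: "minimal_normal N" "nonprimary (card N)"
    and q: "prime q" "q dvd card N" and Q: "sylow_sub q Q N" "Q \<subseteq> A"
  shows "N \<subseteq> A"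
proof -
  have nN: "N \<lhd> G" using N(1) by (simp add: minimal_normal_def)
  have subN: "subgroup N G" using nN by (rule normal_imp_subgroup)
  have "Q \<subseteq> A \<longrightarrow> N \<subseteq> A" using A
  proof (induction rule: converse_rtranclp_induct)
    case base
    then show ?case using subgroup.subset[OF subN] by simp
  next
    case (step y z)
    show ?case
    proof
      assume Qy: "Q \<subseteq> y"
      note sub = sigma_step_subgroups[OF step(1)]
      have Nz: "N \<subseteq> z" using step sub Qy by blast
      from step(1) show "N \<subseteq> y"
      proof (cases rule: sigma_stepE)
        case n: 1
        show ?thesis
        proof (rule minimal_normal_subsetI[OF N(1) q sub(1)])
          fix x k assume x: "x \<in> N" "x [^] (q ^ k :: nat) = \<one>"
          then obtain b where b: "b \<in> N" "b \<otimes> x \<otimes> inv b \<in> Q"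
            using p_element_conjugate_into_sylow[OF q(1) subN Q(1)] by blast
          have cl: "b \<in> carrier G" "x \<in> carrier G" using b x subgroup.mem_carrier[OF subN] by auto
          have "inv b \<in> z" using Nz b subgroup.m_inv_closed[OF subN] by blast
          then have "inv b \<otimes> (b \<otimes> x \<otimes> inv b) \<otimes> inv (inv b) \<in> y" using n b Qy by blast
          then show "x \<in> y" using cl by (simp add: group_normalize)
        qed
      next
        case p: (2 C \<tau>)
        have "C \<subseteq> z" using p(2) sub(3) by blast
        then have "N \<subseteq> C" by (rule minimal_normal_subset_of_primary_index[OF N sub(2) Nz p(1) _ p(3-5)])
        then show ?thesis using p(2) by blast
      qed
    qed
  qed
  then show ?thesis using Q(2) by blast
qed

text \<open>Let \<open>y\<close> be the term directly below \<open>G\<close>. If \<open>y\<close> is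
  normal and meets \<open>N\<close> trivially, it centralizes \<open>N\<close>, so \<open>y\<close>
  and with it \<open>A\<close> are trivial. In all other cases \<open>y\<close> contains
  \<open>N\<close>, hence the product of \<open>N\<close> and \<open>A\<close>.\<close>

lemma sn_supplement_eq_carrier:
  assumes A: "sn A" and N: "minimal_normal N" "nonprimary (card N)"
    and cent: "\<forall>x\<in>carrier G. (\<forall>n\<in>N. x \<otimes> n = n \<otimes> x) \<longrightarrow> x = \<one>"
    and ne: "A \<noteq> {\<one>}" and sup: "N <#> A = carrier G"
  shows "A = carrier G"
proof -
  have nN: "N \<lhd> G" using N(1) by (simp add: minimal_normal_def)
  have subN: "subgroup N G" using nN by (rule normal_imp_subgroup)
  \<comment> \<open>Stated for every \<open>B\<close> above \<open>A\<close>, so that the induction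
    down the chain always has \<open>G\<close> as the upper term of the current step.\<close>
  have "A \<subseteq> B \<longrightarrow> B = carrier G" if "sn B" for B
    using that
  proof (induction rule: converse_rtranclp_induct)
    case base
    then show ?case by simp
  next
    case (step y z)
    show ?case
    proof
      assume Ay: "A \<subseteq> y"
      note sub = sigma_step_subgroups[OF step(1)]
      have z: "z = carrier G" using step sub Ay by blast
      have Ny: "y = carrier G" if "N \<subseteq> y"
        using set_mult_subset[OF sub(1) that Ay] sup subgroup.subset[OF sub(1)] by blast
      from step(1) show "y = carrier G"
      proof (cases rule: sigma_stepE)
        case n: 1
        have y: "y \<lhd> G" using normal_invI[OF sub(1)] n z by blast
        then have "y \<inter> N \<lhd> G" using nN normal_subgroup_intersect by blast
        then consider "y \<inter> N = {\<one>}" | "y \<inter> N = N" using N(1) by (auto simp: minimal_normal_def)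
        then show ?thesis
        proof cases
          case 1
          have "x = \<one>" if x: "x \<in> y" for x
          proof -
            have xG: "x \<in> carrier G" using subgroup.mem_carrier[OF sub(1) x] .
            have "x \<otimes> n = n \<otimes> x" if n: "n \<in> N" for n
              by (rule normal_subgroups_commute[OF y nN 1 x n])
            then show ?thesis using cent xG by blast
          qed
          then have "A = {\<one>}" using Ay subgroup.one_closed[OF sn_imp_subgroup[OF A]] by blast
          then show ?thesis using ne by blast
        next
          case 2
          then show ?thesis using Ny by blast
        qed
      next
        case p: (2 C \<tau>)
        have "C \<subseteq> z" "N \<subseteq> z" using p(2) sub(3) z subgroup.subset[OF subN] by auto
        then have "N \<subseteq> C" by (intro minimal_normal_subset_of_primary_index[OF N sub(2) _ p(1) _ p(3-5)])
        then show ?thesis using p(2) Ny by blast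
      qed
    qed
  qed
  then show ?thesis using A by blast
qed

end

section \<open>Sylow subgroups of a minimal normal subgroup\<close>

context finite_group
begin

text \<open>\<open>Q\<close> is nontrivial and lies properly in the minimal normal \<open>N\<close>,
  so it is not normal in \<open>G\<close> and its normalizer is proper. The Frattini argument
  supplies the rest.\<close>

lemma maximal_over_normer:
  assumes N: "minimal_normal N" and q: "prime q" "q dvd card N" and Q: "sylow_sub q Q N" "Q \<noteq> N"
  obtains L where "maxin L (carrier G)" "normer Q \<subseteq> L" "N <#> L = carrier G" "\<not> N \<subseteq> L"
proof -
  have nN: "N \<lhd> G" using N by (simp add: minimal_normal_def)
  have subN: "subgroup N G" using nN by (rule normal_imp_subgroup)
  have subQ: "subgroup Q G" using Q(1) by (rule sylow_subD)
  have "q dvd card Q" using sylow_nontrivial[OF subN Q(1) q(2,1)] .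
  then have "Q \<noteq> {\<one>}" using q(1) by auto
  then have "\<not> Q \<lhd> G" using N Q(2) sylow_subD(2)[OF Q(1)] by (auto simp: minimal_normal_def)
  then have "normer Q \<subset> carrier G" using subQ normal_iff_normer[of Q] by (auto simp: normer_def)
  then obtain L where L: "maxin L (carrier G)" "normer Q \<subseteq> L"
    using maxin_exists[OF normer_subgroup[OF subQ] subgroup_self] by blast
  note l = maxinD[OF L(1)]
  have "N <#> normer Q \<subseteq> N <#> L" using L(2) by (auto simp: set_mult_def)
  then have NL: "N <#> L = carrier G"
    using frattini[OF q(1) nN Q(1)] set_mult_subset[OF subgroup_self, of N L] l(3) subgroup.subset[OF subN] by blast
  then have "\<not> N \<subseteq> L" using set_mult_subset[OF l(1), of N L] l(3) by blast
  then show ?thesis using that L NL by blast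
qed

text \<open>The centre of \<^term>\<open>Q\<close> is normalised by the maximal subgroup \<^term>\<open>P\<close>, so \<^term>\<open>Q\<close> is abelian, and
  Burnside's theorem applies inside \<^term>\<open>N\<close>.\<close>
lemma minimal_normal_eq_sylow:
  assumes N: "minimal_normal N" and p: "prime p" and q: "prime q" "q dvd card N" "q \<noteq> p"
    and Q: "sylow_sub q Q N" and P: "card P = p ^ k" and L: "maxin P L" "Q \<subseteq> L"
    and QL: "normalizes L Q" and NL: "N \<inter> normer Q \<subseteq> Q"
  shows "N = Q"
proof -
  have nN: "N \<lhd> G" using N by (simp add: minimal_normal_def)
  have subN: "subgroup N G" using nN by (rule normal_imp_subgroup)
  have subQ: "subgroup Q G" using Q by (rule sylow_subD)
  note m = maxinD[OF L(1)]
  obtain j where j: "card Q = q ^ j" using sylow_subD(3)[OF Q] by blast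
  have qQ: "q dvd card Q" using sylow_nontrivial[OF subN Q q(2,1)] .
  have Q1: "Q \<noteq> {\<one>}" using qQ q(1) by auto
  have "coprime (card Q) (card P)"
    unfolding j P using p q primes_coprime by auto
  then have QP: "Q \<inter> P = {\<one>}" using prime_power_coprime_subgroups[OF subQ m(1)] by blast
  define Z where "Z = {z \<in> Q. \<forall>x\<in>Q. z \<otimes> x = x \<otimes> z}"
  have Z: "subgroup Z G"
    using centralizer_subgroup[OF subQ subgroup.subset[OF subQ]] by (simp add: Z_def centralizer_def)
  obtain z where z: "z \<in> Z" "z \<noteq> \<one>"
    using p_group_center_nontrivial[OF q(1) subQ j Q1] unfolding Z_def by force
  have "z \<notin> P" using z QP by (auto simp: Z_def)
  \<comment> \<open>\<open>Z\<close> is the centre of \<open>Q\<close>, hence stable under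
    everything that normalizes \<open>Q\<close>, in particular under \<open>P\<close>.\<close>
  have ZP: "y \<otimes> w \<otimes> inv y \<in> Z" if y: "y \<in> P" and w: "w \<in> Z" for y w
  proof -
    have yL: "y \<in> L" "inv y \<in> L" using y m(3) subgroup.m_inv_closed[OF m(2)] by auto
    have yG: "y \<in> carrier G" "w \<in> carrier G" using subgroup.mem_carrier[OF m(1) y] subgroup.mem_carrier[OF Z w] .
    have wQ: "w \<in> Q" using w by (simp add: Z_def)
    have "y \<otimes> w \<otimes> inv y \<otimes> x = x \<otimes> (y \<otimes> w \<otimes> inv y)" if x: "x \<in> Q" for x
    proof -
      have xG: "x \<in> carrier G" using subgroup.mem_carrier[OF subQ x] .
      have "inv y \<otimes> x \<otimes> inv (inv y) \<in> Q" using QL yL x by blast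
      then have e: "(inv y \<otimes> x \<otimes> y) \<otimes> w = w \<otimes> (inv y \<otimes> x \<otimes> y)" using w yG by (simp add: Z_def)
      have "x \<otimes> (y \<otimes> w \<otimes> inv y) = y \<otimes> ((inv y \<otimes> x \<otimes> y) \<otimes> w) \<otimes> inv y" using xG yG by (simp add: m_assoc)
      also have "\<dots> = y \<otimes> w \<otimes> inv y \<otimes> x" unfolding e using xG yG by (simp add: m_assoc)
      finally show ?thesis ..
    qed
    moreover have "y \<otimes> w \<otimes> inv y \<in> Q" using QL yL wQ by blast
    ultimately show ?thesis by (simp add: Z_def)
  qed
  have ZL: "Z <#> P = L"
    by (rule maxin_set_mult[OF L(1) Z]) (use z \<open>z \<notin> P\<close> L(2) ZP in \<open>auto simp: Z_def\<close>)
  \<comment> \<open>Dedekind's argument for \<open>L = Z P\<close>: the \<open>P\<close>-factor of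
    an element of \<open>Q\<close> lies in \<open>Q \<inter> P\<close>.\<close>
  have "Q \<subseteq> Z"
  proof
    fix x assume x: "x \<in> Q"
    then obtain w y where wy: "w \<in> Z" "y \<in> P" "x = w \<otimes> y" using ZL L(2) unfolding set_mult_def by blast
    have cl: "w \<in> carrier G" "y \<in> carrier G" using subgroup.mem_carrier[OF Z wy(1)] subgroup.mem_carrier[OF m(1) wy(2)] .
    have "inv w \<otimes> x \<in> Q" using wy(1) x subgroup.m_closed[OF subQ] subgroup.m_inv_closed[OF subQ] by (simp add: Z_def)
    then have "y \<in> Q" using wy(3) cl by simp
    then have "y = \<one>" using wy(2) QP by blast
    then show "x \<in> Z" using wy cl by simp
  qed
  then have comm: "x \<otimes> y = y \<otimes> x" if "x \<in> Q" "y \<in> Q" for x y using that by (auto simp: Z_def)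
  interpret NG: finite_group "G\<lparr>carrier := N\<rparr>" using subN by (rule finite_group_subgroup)
  have QN: "NG.sylow_sub q Q (carrier (G\<lparr>carrier := N\<rparr>))" using sylow_sub_restrict[OF subN] Q by simp
  have "NG.normer Q \<subseteq> N \<inter> normer Q"
    using subgroup.mem_carrier[OF subN] by (auto simp: NG.normer_def normer_def m_inv_consistent[OF subN])
  then have cen: "\<forall>g\<in>NG.normer Q. \<forall>x\<in>Q. g \<otimes>\<^bsub>G\<lparr>carrier := N\<rparr>\<^esub> x = x \<otimes>\<^bsub>G\<lparr>carrier := N\<rparr>\<^esub> g"
    using NL comm by auto
  obtain Y where Y: "Y \<lhd> G\<lparr>carrier := N\<rparr>" "card Y * card Q = card N" "\<not> q dvd card Y"
    using NG.burnside_normal_complement[OF q(1) QN cen] by auto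
  have Y': "subgroup Y G" "Y \<subseteq> N" "normalizes N Y"
    using Y(1) normal_restrict_iff[OF subN] by auto
  have "card N div card Y = card Q" using Y(2) subgroup_card_pos[OF Y'(1)] by (metis nonzero_mult_div_cancel_left neq0_conv)
  moreover have "coprime (card Y) (card Q)"
    unfolding j using Y(3) q(1) by (simp add: coprime_commute prime_imp_coprime)
  \<comment> \<open>\<open>Y\<close> is recognized inside \<open>N\<close> by orders alone, as the
    elements killed by \<open>card Y\<close>; hence it is normal in \<open>G\<close>, not just in
    \<open>N\<close>.\<close>
  ultimately have mem: "x \<in> Y" if "x \<in> N" "x [^] card Y = \<one>" for x
    using mem_of_coprime_index[OF subN Y' that(1), of "card Y"] that(2) subgroup.one_closed[OF Y'(1)] by simp
  have "Y \<lhd> G"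
  proof (rule normal_invI[OF Y'(1)])
    fix g h assume g: "g \<in> carrier G" and h: "h \<in> Y"
    have hG: "h \<in> carrier G" using subgroup.mem_carrier[OF Y'(1) h] .
    have "(g \<otimes> h \<otimes> inv g) [^] card Y = \<one>" using conj_nat_pow[OF g hG] pow_card_subgroup[OF Y'(1) h] g by simp
    then show "g \<otimes> h \<otimes> inv g \<in> Y" using mem normal_mem(1)[OF nN g] h Y'(2) by blast
  qed
  then consider "Y = {\<one>}" | "Y = N" using N Y'(2) by (auto simp: minimal_normal_def)
  then show ?thesis
  proof cases
    case 1
    then have "card Q = card N" using Y(2) by simp
    then show ?thesis using card_subset_eq[OF subgroup_finite[OF subN] sylow_subD(2)[OF Q]] by simp
  next
    case 2
    then show ?thesis using Y(3) q(2) by simp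
  qed
qed

end

section \<open>Quotients\<close>

text \<open>An arbitrary epimorphism, so that the projection to a quotient and conjugation by an
  element of \<open>G\<close> are both instances.\<close>

locale sigma_epi =
  G: sigma_group G \<sigma> + H: sigma_group H \<sigma> + group_hom G H h
  for G :: "('a, 'm) monoid_scheme" (structure) and H :: "('c, 'n) monoid_scheme" (structure)
    and h :: "'a \<Rightarrow> 'c" and \<sigma> :: "nat set set" +
  assumes surj: "h ` carrier G = carrier H"
begin

definition pre :: "'c set \<Rightarrow> 'a set" where
  "pre A = {x \<in> carrier G. h x \<in> A}"

lemma image_pre: "A \<subseteq> carrier H \<Longrightarrow> h ` pre A = A"
  using surj by (auto simp: pre_def image_iff)

lemma pre_mono: "A \<subseteq> B \<Longrightarrow> pre A \<subseteq> pre B"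
  by (auto simp: pre_def)

lemma pre_carrier: "pre (carrier H) = carrier G"
  by (auto simp: pre_def)

lemma pre_subgroup:
  assumes A: "subgroup A H"
  shows "subgroup (pre A) G"
proof (rule G.subgroupI)
  have "\<one> \<in> pre A" using subgroup.one_closed[OF A] by (simp add: pre_def)
  then show "pre A \<noteq> {}" by blast
qed (use subgroup.m_closed[OF A] subgroup.m_inv_closed[OF A] in \<open>auto simp: pre_def\<close>)

lemma kernel_subset_pre: "subgroup A H \<Longrightarrow> kernel G H h \<subseteq> pre A"
  using subgroup.one_closed[of A H] by (auto simp: pre_def kernel_def)

lemma pre_image:
  assumes A: "subgroup A G" and "kernel G H h \<subseteq> A"
  shows "pre (h ` A) = A"
proof
  show "A \<subseteq> pre (h ` A)" using subgroup.mem_carrier[OF A] by (auto simp: pre_def)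
  show "pre (h ` A) \<subseteq> A"
  proof
    fix x assume "x \<in> pre (h ` A)"
    then obtain a where a: "x \<in> carrier G" "a \<in> A" "h x = h a" by (auto simp: pre_def)
    have aG: "a \<in> carrier G" using subgroup.mem_carrier[OF A a(2)] .
    have "h (x \<otimes> inv a) = \<one>\<^bsub>H\<^esub>" using a aG by (simp add: H.r_inv)
    then have "x \<otimes> inv a \<in> A" using assms(2) a aG by (auto simp: kernel_def)
    then have "x \<otimes> inv a \<otimes> a \<in> A" using a subgroup.m_closed[OF A] by blast
    then show "x \<in> A" using a aG by (simp add: G.m_assoc)
  qed
qed

lemma card_image_mult:
  assumes A: "subgroup A G"
  shows "card (h ` A) * card (A \<inter> kernel G H h) = card A"
proof -
  note cl = subgroup.mem_carrier[OF A]
  define F where "F y = {a \<in> A. h a = y}" for y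
  have fin: "finite A" using G.subgroup_finite[OF A] .
  have card_F: "card (F y) = card (A \<inter> kernel G H h)" if y: "y \<in> h ` A" for y
  proof -
    obtain a where a: "a \<in> A" "y = h a" using y by blast
    have aG: "a \<in> carrier G" using cl a by blast
    have "bij_betw (\<lambda>c. a \<otimes> c) (A \<inter> kernel G H h) (F y)"
    proof (rule bij_betw_byWitness[where f' = "\<lambda>x. inv a \<otimes> x"])
      show "(\<lambda>c. a \<otimes> c) ` (A \<inter> kernel G H h) \<subseteq> F y"
      proof
        fix z assume "z \<in> (\<lambda>c. a \<otimes> c) ` (A \<inter> kernel G H h)"
        then obtain c where c: "c \<in> A" "c \<in> carrier G" "h c = \<one>\<^bsub>H\<^esub>" "z = a \<otimes> c" by (auto simp: kernel_def)
        then show "z \<in> F y" using a aG subgroup.m_closed[OF A a(1) c(1)] by (simp add: F_def)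
      qed
      show "(\<lambda>x. inv a \<otimes> x) ` F y \<subseteq> A \<inter> kernel G H h"
        using a aG cl subgroup.m_closed[OF A subgroup.m_inv_closed[OF A a(1)]]
        by (auto simp: F_def kernel_def H.l_inv)
    qed (use a aG cl in \<open>auto simp: F_def\<close>)
    then show ?thesis by (simp add: bij_betw_same_card)
  qed
  have AU: "A = (\<Union>y\<in>h ` A. F y)" by (auto simp: F_def)
  have "card A = (\<Sum>y\<in>h ` A. card (F y))"
    by (subst AU, rule card_UN_disjoint) (use fin in \<open>auto simp: F_def\<close>)
  also have "\<dots> = card (h ` A) * card (A \<inter> kernel G H h)" using card_F by simp
  finally show ?thesis by simp
qed

lemma kernel_subgroup: "subgroup (kernel G H h) G"
  by (rule subgroup_kernel)

text \<open>The index of \<open>A\<close> in \<open>B\<close> is the index of the images times the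
  index of the intersections with the kernel.\<close>

lemma index_image_dvd:
  assumes A: "subgroup A G" and B: "subgroup B G" and AB: "A \<subseteq> B"
  shows "card (h ` B) div card (h ` A) dvd card B div card A"
proof -
  let ?K = "kernel G H h"
  have sub: "subgroup (A \<inter> ?K) G" "subgroup (B \<inter> ?K) G"
    using A B kernel_subgroup G.subgroups_Inter_pair by auto
  have hAB: "subgroup (h ` A) H" "subgroup (h ` B) H" using A B subgroup_img_is_subgroup by auto
  obtain c where c: "card B = card A * c" using G.subgroup_card_dvd[OF A B AB] by blast
  obtain d where d: "card (B \<inter> ?K) = card (A \<inter> ?K) * d" using G.subgroup_card_dvd[OF sub] AB by blast
  obtain e where e: "card (h ` B) = card (h ` A) * e" using H.subgroup_card_dvd[OF hAB] AB by blast
  have "card (h ` A) * card (A \<inter> ?K) * (e * d) = card (h ` A) * e * (card (A \<inter> ?K) * d)"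
    by (simp only: mult_ac)
  also have "\<dots> = card B" using card_image_mult[OF B] d e by simp
  also have "\<dots> = card (h ` A) * card (A \<inter> ?K) * c" using card_image_mult[OF A] c by simp
  finally have "card (h ` A) * card (A \<inter> ?K) * (e * d) = card (h ` A) * card (A \<inter> ?K) * c" .
  moreover have "card (h ` A) \<noteq> 0" "card (A \<inter> ?K) \<noteq> 0"
    using G.subgroup_card_pos[OF sub(1)] H.subgroup_card_pos[OF hAB(1)] by auto
  ultimately have "e * d = c" by (simp add: mult.commute)
  moreover have "card (h ` B) div card (h ` A) = e" using e H.subgroup_card_pos[OF hAB(1)] by simp
  moreover have "card B div card A = c" using c G.subgroup_card_pos[OF A] by simp
  ultimately show ?thesis by auto
qed

lemma image_normalized:
  assumes "G.normalizes B C" "B \<subseteq> carrier G" "C \<subseteq> carrier G"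
  shows "\<forall>b\<in>h ` B. \<forall>c\<in>h ` C. b \<otimes>\<^bsub>H\<^esub> c \<otimes>\<^bsub>H\<^esub> inv\<^bsub>H\<^esub> b \<in> h ` C"
proof (intro ballI)
  fix b c assume "b \<in> h ` B" "c \<in> h ` C"
  then obtain x y where xy: "x \<in> B" "y \<in> C" "b = h x" "c = h y" by blast
  then have "x \<in> carrier G" "y \<in> carrier G" using assms(2,3) by blast+
  then have "b \<otimes>\<^bsub>H\<^esub> c \<otimes>\<^bsub>H\<^esub> inv\<^bsub>H\<^esub> b = h (x \<otimes> y \<otimes> inv x)" using xy by simp
  then show "b \<otimes>\<^bsub>H\<^esub> c \<otimes>\<^bsub>H\<^esub> inv\<^bsub>H\<^esub> b \<in> h ` C" using assms(1) xy by blast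
qed

lemma sigma_step_image:
  assumes "G.sigma_step A B"
  shows "H.sigma_step (h ` A) (h ` B)"
proof -
  note sub = G.sigma_step_subgroups[OF assms]
  have hsub: "subgroup (h ` A) H" "subgroup (h ` B) H" "h ` A \<subseteq> h ` B" using sub subgroup_img_is_subgroup by auto
  note cl = subgroup.subset[OF sub(1)] subgroup.subset[OF sub(2)]
  from assms show ?thesis
  proof (cases rule: G.sigma_stepE)
    case n: 1
    then show ?thesis unfolding H.sigma_step_def using hsub image_normalized[OF n cl(2,1)] by blast
  next
    case p: (2 C \<pi>)
    have "C \<subseteq> B" using p(2) sub(3) by blast
    then have "pi_number \<pi> (card (h ` B) div card (h ` C))"
      using index_image_dvd[OF p(1) sub(2)] p(5) pi_number_dvd by blast
    moreover have "subgroup (h ` C) H" using p(1) subgroup_img_is_subgroup by blast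
    moreover have "h ` C \<subseteq> h ` A" using p(2) by blast
    ultimately show ?thesis unfolding H.sigma_step_def
      using hsub image_normalized[OF p(3) cl(2) subgroup.subset[OF p(1)]] p(4) by blast
  qed
qed

lemma sn_image:
  assumes "G.sn A"
  shows "H.sn (h ` A)"
  using assms
proof (induction rule: converse_rtranclp_induct)
  case base
  then show ?case by (simp add: surj)
next
  case (step y z)
  then show ?case using sigma_step_image converse_rtranclp_into_rtranclp by metis
qed

text \<open>A maximal chain of \<open>H\<close> pulls back to one of \<open>G\<close> of the same
  length, so hypotheses about all maximal chains pass to quotients.\<close>

lemma maxin_pre:
  assumes "H.maxin A B"
  shows "G.maxin (pre A) (pre B)"
proof -
  note m = H.maxinD[OF assms]
  have AB: "h ` pre A = A" "h ` pre B = B" using image_pre subgroup.subset m(1,2) by metis+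
  have "K = pre A \<or> K = pre B" if K: "subgroup K G" "pre A \<subseteq> K" "K \<subseteq> pre B" for K
  proof -
    have "subgroup (h ` K) H" using K(1) subgroup_img_is_subgroup by blast
    moreover have "A \<subseteq> h ` K" "h ` K \<subseteq> B" using AB K(2,3) by blast+
    ultimately have "h ` K = A \<or> h ` K = B" using m(4) by blast
    moreover have "pre (h ` K) = K" using pre_image[OF K(1)] kernel_subset_pre[OF m(1)] K(2) by blast
    ultimately show ?thesis by auto
  qed
  moreover have "pre A \<noteq> pre B"
  proof
    assume "pre A = pre B"
    then have "h ` pre A = h ` pre B" by (rule arg_cong)
    then show False unfolding AB using m(3) by simp
  qed
  then have "pre A \<subset> pre B" using m(3) pre_mono[of A B] by blast
  ultimately show ?thesis using pre_subgroup m(1,2) by (auto simp: G.maxin_def)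
qed

lemma normal_pre:
  assumes "K \<lhd> H"
  shows "pre K \<lhd> G"
proof (rule G.normal_invI)
  show "subgroup (pre K) G" using assms pre_subgroup normal_imp_subgroup by blast
  fix x y assume "x \<in> carrier G" "y \<in> pre K"
  then show "x \<otimes> y \<otimes> inv x \<in> pre K" using H.normal_mem(1)[OF assms, of "h x" "h y"] by (simp add: pre_def)
qed

lemma normal_image:
  assumes "K \<lhd> G"
  shows "h ` K \<lhd> H"
proof (rule H.normal_invI)
  have K: "subgroup K G" using assms by (rule normal_imp_subgroup)
  show "subgroup (h ` K) H" using subgroup_img_is_subgroup[OF K] .
  fix x y assume "x \<in> carrier H" "y \<in> h ` K"
  then show "x \<otimes>\<^bsub>H\<^esub> y \<otimes>\<^bsub>H\<^esub> inv\<^bsub>H\<^esub> x \<in> h ` K"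
    using image_normalized[of "carrier G" K] G.normal_mem(1)[OF assms] surj subgroup.subset[OF K] by blast
qed

end

context sigma_group
begin

lemma sigma_epi_quotient:
  assumes "N \<lhd> G"
  shows "sigma_epi G (G Mod N) (\<lambda>x. N #> x) \<sigma>"
proof -
  note q = finite_group_quotient[OF assms]
  have "sigma_group (G Mod N) \<sigma>" using q(1) partition by (simp add: sigma_group_def sigma_group_axioms_def)
  then show ?thesis using q(2,3) sigma_group_axioms by (simp add: sigma_epi_def sigma_epi_axioms_def)
qed

lemma sigma_epi_conj:
  assumes "g \<in> carrier G"
  shows "sigma_epi G G (\<lambda>x. g \<otimes> x \<otimes> inv g) \<sigma>"
proof -
  have "(\<lambda>x. g \<otimes> x \<otimes> inv g) \<in> hom G G" using assms by (auto simp: hom_def group_normalize)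
  then have "group_hom G G (\<lambda>x. g \<otimes> x \<otimes> inv g)" by (simp add: group_hom_def group_hom_axioms_def)
  moreover have "(\<lambda>x. g \<otimes> x \<otimes> inv g) ` carrier G = carrier G"
    using normal_conjug_eq[OF normal_self assms] by (simp add: conjug_def)
  ultimately show ?thesis using sigma_group_axioms by (simp add: sigma_epi_def sigma_epi_axioms_def)
qed

lemma sn_conjug:
  assumes "sn A" "g \<in> carrier G"
  shows "sn (conjug g A)"
  using sigma_epi.sn_image[OF sigma_epi_conj[OF assms(2)] assms(1)] by (simp add: conjug_def)

section \<open>Maximal chains of length three\<close>

text \<open>The hypothesis of (i) in terms of \<open>maxin\<close> and \<open>sn\<close>; the link
  is \<open>sn_chains3_iff\<close>.\<close>

definition sn_chains3 :: bool where
  "sn_chains3 \<longleftrightarrow> (\<forall>M1 M2 M3. maxin M1 (carrier G) \<longrightarrow> maxin M2 M1 \<longrightarrow> maxin M3 M2 \<longrightarrow>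
     sn M3 \<or> sn M2 \<or> sn M1)"

lemma nonprimary_not_prime_power:
  assumes "nonprimary n" "prime q"
  shows "n \<noteq> q ^ k"
proof
  assume n: "n = q ^ k"
  obtain \<pi> where \<pi>: "\<pi> \<in> \<sigma>" "q \<in> \<pi>" using class_exists[OF assms(2)] by blast
  have "pi_number \<pi> n" unfolding pi_number_def n using \<pi>(2) assms(2) primes_dvd_imp_eq prime_dvd_power by metis
  then show False using assms(1) \<pi>(1) by (simp add: nonprimary_def)
qed

lemma maximal_over_sylow_normalizer:
  assumes N: "minimal_normal N" "nonprimary (card N)" and chains: sn_chains3
    and q: "prime q" "q dvd card N"
  obtains Q L where "sylow_sub q Q N" "maxin L (carrier G)" "normer Q \<subseteq> L" "N <#> L = carrier G"
    "Q = L \<or> maxin Q L"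
proof -
  have nN: "N \<lhd> G" using N(1) by (simp add: minimal_normal_def)
  have subN: "subgroup N G" using nN by (rule normal_imp_subgroup)
  obtain Q where Q: "sylow_sub q Q N" using sylow_exists[OF q(1) subN] by blast
  have subQ: "subgroup Q G" using Q by (rule sylow_subD)
  obtain j where j: "card Q = q ^ j" using sylow_subD(3)[OF Q] by blast
  have "Q \<noteq> N" using nonprimary_not_prime_power[OF N(2) q(1)] j by auto
  then obtain L where L: "maxin L (carrier G)" "normer Q \<subseteq> L" and NL: "N <#> L = carrier G" and notN: "\<not> N \<subseteq> L"
    by (rule maximal_over_normer[OF N(1) q Q])
  note l = maxinD[OF L(1)]
  have QL: "Q \<subseteq> L" using subset_normer[OF subQ] L(2) by blast
  have not_sn: "\<not> sn A" if "Q \<subseteq> A" "A \<subseteq> L" for A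
    using sn_contains_minimal_normal[OF _ N q Q that(1)] that(2) notN by blast
  have "maxin Q L" if ne: "Q \<noteq> L"
  proof -
    obtain K where K: "maxin K L" "Q \<subseteq> K" using maxin_exists[OF subQ l(1)] QL ne by blast
    have "K = Q"
    proof (rule ccontr)
      assume "K \<noteq> Q"
      \<comment> \<open>A proper inclusion of \<open>Q\<close> in \<open>K\<close> leaves room for a
        third term, and no subgroup between \<open>Q\<close> and \<open>L\<close> is
        \<sigma>-subnormal.\<close>
      then obtain K3 where K3: "maxin K3 K" "Q \<subseteq> K3" using maxin_exists[OF subQ maxinD(1)[OF K(1)]] K(2) by blast
      have "K3 \<subseteq> L" "K \<subseteq> L" using maxinD(3)[OF K(1)] maxinD(3)[OF K3(1)] by auto
      then have "\<not> sn K3" "\<not> sn K" "\<not> sn L"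
        using not_sn[OF K3(2)] not_sn[OF K(2)] not_sn[OF QL] by simp_all
      then show False using chains L(1) K(1) K3(1) unfolding sn_chains3_def by blast
    qed
    then show ?thesis using K(1) by simp
  qed
  then show ?thesis using that Q L NL by blast
qed

text \<open>For \<open>N = G\<close> every nontrivial subgroup is a supplement, so a proper
  \<sigma>-subnormal subgroup is trivial; among the three terms only the last can be.\<close>

lemma simple_nonprimary_sn_chain:
  assumes N: "minimal_normal (carrier G)" "nonprimary (card (carrier G))"
    and cent: "\<forall>x\<in>carrier G. (\<forall>n\<in>carrier G. x \<otimes> n = n \<otimes> x) \<longrightarrow> x = \<one>" and chains: sn_chains3
    and M: "maxin M1 (carrier G)" "maxin M2 M1" "maxin M3 M2"
  shows "M3 = {\<one>}"
proof -
  have triv: "A = {\<one>}" if "sn A" "A \<noteq> carrier G" for A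
  proof (rule ccontr)
    assume ne: "A \<noteq> {\<one>}"
    have "carrier G <#> A = carrier G"
      using subset_set_mult_left[of "carrier G" A] sn_imp_subgroup[OF that(1)]
        set_mult_subset[OF subgroup_self, of "carrier G" A] subgroup.subset by blast
    then show False using sn_supplement_eq_carrier[OF that(1) N cent ne] that(2) by blast
  qed
  note m = maxinD[OF M(1)] maxinD[OF M(2)] maxinD[OF M(3)]
  have one: "\<one> \<in> M3" "\<one> \<in> M2" using m(9,5) subgroup.one_closed by blast+
  have "M1 \<noteq> {\<one>}" "M2 \<noteq> {\<one>}" using one m(7,11) by auto
  moreover have "M1 \<noteq> carrier G" "M2 \<noteq> carrier G" "M3 \<noteq> carrier G" using m(3,7,11) by auto
  ultimately show ?thesis using chains M triv unfolding sn_chains3_def by blast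
qed

lemma prime_order_of_trivial_maxin:
  assumes Q: "maxin {\<one>} Q" and q: "prime q" "q dvd card Q"
  shows "card Q = q"
proof -
  obtain A where A: "subgroup A G" "A \<subseteq> Q" "card A = q"
    using prime_order_subgroup_exists[OF q(1) maxinD(2)[OF Q] q(2)] by blast
  have "A = {\<one>} \<or> A = Q" using maxinD(4)[OF Q A(1) _ A(2)] subgroup.one_closed[OF A(1)] by blast
  then show ?thesis using A(3) q(1) by auto
qed

text \<open>If \<^term>\<open>Q\<close> were its own centralizer in \<^term>\<open>L\<close>, the conjugacy class of \<^term>\<open>x\<close> in \<^term>\<open>L\<close> would have
  \<^term>\<open>card L div card Q\<close> elements, all nontrivial elements of \<^term>\<open>Q\<close>; but this index has only prime factors \<open>\<ge> q\<close>.\<close>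
lemma prime_order_normal_maximal_central:
  assumes L: "maxin Q L" and QL: "normalizes L Q" and cardQ: "card Q = q"
    and comm: "\<forall>x\<in>Q. \<forall>y\<in>Q. x \<otimes> y = y \<otimes> x"
    and min: "\<And>r. prime r \<Longrightarrow> r dvd card L \<Longrightarrow> q \<le> r" and x: "x \<in> Q" and g: "g \<in> L"
  shows "g \<otimes> x = x \<otimes> g"
proof (cases "x = \<one>")
  case True
  then show ?thesis using subgroup.mem_carrier[OF maxinD(2)[OF L] g] by simp
next
  case x1: False
  note m = maxinD[OF L]
  have xG: "x \<in> carrier G" using subgroup.mem_carrier[OF m(1) x] .
  define C where "C = centralizer L {x}"
  have C: "subgroup C G" unfolding C_def using centralizer_subgroup[OF m(2)] xG by blast
  have "Q \<subseteq> C" using comm x m(3) by (auto simp: C_def centralizer_def)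
  then have "C = Q \<or> C = L" using m(4)[OF C] by (auto simp: C_def centralizer_def)
  moreover have "C \<noteq> Q"
  proof
    assume CQ: "C = Q"
    interpret L: group "G\<lparr>carrier := L\<rparr>" using m(2) subgroup_imp_group by blast
    define \<phi> where "\<phi> g = restrict (\<lambda>y. g \<otimes> y \<otimes> inv g) Q" for g
    interpret act: group_action "G\<lparr>carrier := L\<rparr>" Q \<phi>
      unfolding \<phi>_def
      by (rule group_actionI)
        (use L.is_group QL subgroup.mem_carrier[OF m(1)] subgroup.mem_carrier[OF m(2)] in \<open>auto simp: group_normalize\<close>)
    have stab: "stabilizer (G\<lparr>carrier := L\<rparr>) \<phi> x = C"
    proof -
      have "g \<otimes> x \<otimes> inv g = x \<longleftrightarrow> g \<otimes> x = x \<otimes> g" if "g \<in> L" for g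
        using inv_solve_right'[of "g \<otimes> x" x g] subgroup.mem_carrier[OF m(2) that] xG by (metis inv_closed inv_inv inv_solve_right' m_closed)
      then show ?thesis using x by (auto simp: stabilizer_def \<phi>_def C_def centralizer_def)
    qed
    define O' where "O' = orbit (G\<lparr>carrier := L\<rparr>) \<phi> x"
    have card_O: "card O' * card Q = card L"
      using act.orbit_stabilizer_theorem[OF x] stab CQ by (simp add: O'_def order_def)
    have "O' \<subseteq> Q - {\<one>}"
    proof
      fix z assume "z \<in> O'"
      then obtain g where g: "g \<in> L" "z = g \<otimes> x \<otimes> inv g" using x by (auto simp: O'_def orbit_def \<phi>_def)
      have gG: "g \<in> carrier G" using subgroup.mem_carrier[OF m(2) g(1)] .
      have "z \<noteq> \<one>"
      proof
        assume "z = \<one>"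
        then have "inv g \<otimes> (g \<otimes> x \<otimes> inv g) \<otimes> g = inv g \<otimes> \<one> \<otimes> g" using g(2) by simp
        then show False using gG xG x1 by (simp add: m_assoc)
      qed
      then show "z \<in> Q - {\<one>}" using g QL x by blast
    qed
    then have "card O' \<le> card (Q - {\<one>})" using subgroup_finite[OF m(1)] by (intro card_mono) auto
    then have less: "card O' < q" using cardQ subgroup_card_pos[OF m(1)] subgroup.one_closed[OF m(1)] subgroup_finite[OF m(1)] by simp
    have "card O' \<noteq> 1"
    proof
      assume "card O' = 1"
      then have "card Q = card L" using card_O by simp
      then show False using m(3) subgroup_finite[OF m(2)] card_subset_eq by blast
    qed
    then obtain r where r: "prime r" "r dvd card O'" using prime_factor_nat by blast
    then have "q \<le> r" using min card_O by (metis dvd_mult2 dvd_triv_left dvd_trans)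
    moreover have "card O' > 0" using card_O subgroup_card_pos[OF m(2)] by (cases "card O' = 0") auto
    ultimately show False using r(2) less dvd_imp_le[OF r(2)] by simp
  qed
  ultimately have "g \<in> C" using g by blast
  then show ?thesis by (simp add: C_def centralizer_def)
qed

text \<open>\<open>q\<close> is the least prime divisor of the order. \<open>Q\<close> is abelian,
  since otherwise some chain of length 3 ends above its nontrivial centre. If the normalizer exceeds
  \<open>Q\<close>, then it equals \<open>L\<close> and \<open>Q\<close> has order \<open>q\<close>,
  so the choice of \<open>q\<close> makes \<open>Q\<close> central in it.\<close>

lemma no_simple_nonprimary:
  assumes N: "minimal_normal (carrier G)" "nonprimary (card (carrier G))"
    and cent: "\<forall>x\<in>carrier G. (\<forall>n\<in>carrier G. x \<otimes> n = n \<otimes> x) \<longrightarrow> x = \<one>" and chains: sn_chains3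
  shows False
proof -
  note triv = simple_nonprimary_sn_chain[OF N cent chains]
  let ?n = "card (carrier G)"
  \<comment> \<open>\<open>1\<close> is the prime power \<open>2 ^ 0\<close>.\<close>
  have "?n \<noteq> 1" using nonprimary_not_prime_power[OF N(2), of 2 0] by simp
  then have "\<exists>q. prime q \<and> q dvd ?n" using prime_factor_nat by blast
  then obtain q where q: "prime q" "q dvd ?n" and min: "\<And>r. prime r \<Longrightarrow> r dvd ?n \<Longrightarrow> q \<le> r"
    using exists_least_iff[of "\<lambda>q. prime q \<and> q dvd ?n"] by (metis not_le)
  obtain Q L where Q: "sylow_sub q Q (carrier G)" and L: "maxin L (carrier G)" "normer Q \<subseteq> L" "carrier G <#> L = carrier G"
    and QL: "Q = L \<or> maxin Q L"
    by (rule maximal_over_sylow_normalizer[OF N chains q])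
  note l = maxinD[OF L(1)]
  have subQ: "subgroup Q G" using Q by (rule sylow_subD)
  obtain j where j: "card Q = q ^ j" using sylow_subD(3)[OF Q] by blast
  have qQ: "q dvd card Q" using sylow_nontrivial[OF subgroup_self Q q(2,1)] .
  then have Q1: "Q \<noteq> {\<one>}" using q(1) by auto
  define Z where "Z = centralizer Q Q"
  have Z: "subgroup Z G" unfolding Z_def by (rule centralizer_subgroup[OF subQ subgroup.subset[OF subQ]])
  have Z1: "Z \<noteq> {\<one>}" using p_group_center_nontrivial[OF q(1) subQ j Q1] by (force simp: Z_def centralizer_def)
  have ZQ: "Z \<subseteq> Q" by (auto simp: Z_def centralizer_def)
  have "Z = Q"
  proof (rule ccontr)
    assume ne: "Z \<noteq> Q"
    from QL show False
    proof
      assume M: "maxin Q L"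
      obtain K where K: "maxin K Q" "Z \<subseteq> K" using maxin_exists[OF Z subQ] ZQ ne by blast
      then have "K = {\<one>}" using triv[OF L(1) M K(1)] by simp
      then show False using K(2) Z1 subgroup.one_closed[OF Z] by blast
    next
      assume eq: "Q = L"
      \<comment> \<open>Here \<open>Q\<close> is the first term of the chain, so two more terms
        above \<open>Z\<close> are wanted. The centralizer in \<open>Q\<close> of a noncentral
        \<open>x\<close> lies properly between \<open>Z\<close> and \<open>Q\<close> and makes room
        for them.\<close>
      obtain x where x: "x \<in> Q" "x \<notin> Z" using ZQ ne by blast
      have xG: "x \<in> carrier G" using subgroup.mem_carrier[OF subQ x(1)] .
      define C where "C = centralizer Q {x}"
      have C: "subgroup C G" unfolding C_def using centralizer_subgroup[OF subQ] xG by blast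
      have xC: "x \<in> C" using x by (simp add: C_def centralizer_def)
      have ZC: "Z \<subseteq> C" using x by (auto simp: C_def Z_def centralizer_def)
      have "C \<subseteq> Q" by (auto simp: C_def centralizer_def)
      moreover have "C \<noteq> Q" using x by (force simp: C_def Z_def centralizer_def)
      ultimately obtain K2 where K2: "maxin K2 Q" "C \<subseteq> K2" using maxin_exists[OF C subQ] by blast
      have "Z \<subset> K2" using ZC K2(2) xC x(2) by blast
      then obtain K3 where K3: "maxin K3 K2" "Z \<subseteq> K3" using maxin_exists[OF Z maxinD(1)[OF K2(1)]] by blast
      have "K3 = {\<one>}" using triv[OF L(1) _ K3(1)] K2(1) eq by simp
      then show False using K3(2) Z1 subgroup.one_closed[OF Z] by blast
    qed
  qed
  then have comm: "\<forall>x\<in>Q. \<forall>y\<in>Q. x \<otimes> y = y \<otimes> x" by (auto simp: Z_def centralizer_def)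
  have cen: "\<forall>g\<in>normer Q. \<forall>x\<in>Q. g \<otimes> x = x \<otimes> g"
  proof (cases "normer Q = Q")
    case True
    then show ?thesis using comm by simp
  next
    case False
    then have "Q \<noteq> L" using L(2) subset_normer[OF subQ] by blast
    then have M: "maxin Q L" using QL by blast
    then have nL: "normer Q = L"
      using maxinD(4)[OF M normer_subgroup[OF subQ] subset_normer[OF subQ] L(2)] False by blast
    obtain K where K: "maxin K Q"
      using maxin_exists[OF triv_subgroup subQ] Q1 subgroup.one_closed[OF subQ] by blast
    then have "maxin {\<one>} Q" using triv[OF L(1) M K] by simp
    then have cardQ: "card Q = q" using prime_order_of_trivial_maxin[OF _ q(1) qQ] by blast
    have "q \<le> r" if "prime r" "r dvd card L" for r
      using min[OF that(1)] that(2) subgroup_card_dvd[OF l(1,2)] l(3) dvd_trans by blast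
    moreover have "normalizes L Q" using nL by (auto simp: normer_def)
    ultimately show ?thesis
      using prime_order_normal_maximal_central[OF M _ cardQ comm] nL by blast
  qed
  obtain Y where Y: "Y \<lhd> G" "card Y * card Q = ?n" "\<not> q dvd card Y"
    using burnside_normal_complement[OF q(1) Q cen] by blast
  have "Y = {\<one>} \<or> Y = carrier G"
    using N(1) Y(1) subgroup.subset[OF normal_imp_subgroup[OF Y(1)]] by (simp add: minimal_normal_def)
  then show False
  proof
    assume "Y = {\<one>}"
    then show False using Y(2) j nonprimary_not_prime_power[OF N(2) q(1), of j] by simp
  next
    assume "Y = carrier G"
    then show False using Y(3) q(2) by simp
  qed
qed

text \<open>A prime \<open>p\<close> dividing the index of \<open>N\<close> gives a second chain
  argument: besides \<open>Q\<close>, a Sylow \<open>p\<close>-subgroup \<open>P\<close> of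
  \<open>L\<close> is maximal in \<open>L\<close>. With \<open>N \<inter> L = Q\<close> normal in
  \<open>L\<close>, \<open>minimal_normal_eq_sylow\<close> makes \<open>N\<close> a
  \<open>q\<close>-group.\<close>

lemma no_faithful_nonprimary_minimal_normal:
  assumes N: "minimal_normal N" "nonprimary (card N)"
    and cent: "\<forall>x\<in>carrier G. (\<forall>n\<in>N. x \<otimes> n = n \<otimes> x) \<longrightarrow> x = \<one>" and chains: sn_chains3
  shows False
proof (cases "N = carrier G")
  case True
  then show False using no_simple_nonprimary assms by blast
next
  case False
  have nN: "N \<lhd> G" using N(1) by (simp add: minimal_normal_def)
  have subN: "subgroup N G" using nN by (rule normal_imp_subgroup)
  have NG: "N \<subseteq> carrier G" by (rule subgroup.subset[OF subN])
  obtain c where c: "card (carrier G) = card N * c" using subgroup_card_dvd[OF subN subgroup_self NG] by blast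
  have "c \<noteq> 1" using False card_subset_eq[OF finite_carrier NG] c by auto
  then obtain p where p: "prime p" "p dvd c" using prime_factor_nat by blast
  obtain \<pi> where \<pi>: "\<pi> \<in> \<sigma>" "p \<in> \<pi>" using class_exists[OF p(1)] by blast
  then obtain q where q: "prime q" "q dvd card N" "q \<notin> \<pi>" using N(2) by (auto simp: nonprimary_def pi_number_def)
  have qp: "q \<noteq> p" using q(3) \<pi>(2) by blast
  obtain Q L where Q: "sylow_sub q Q N" and L: "maxin L (carrier G)" "normer Q \<subseteq> L" "N <#> L = carrier G"
    and QL: "Q = L \<or> maxin Q L"
    by (rule maximal_over_sylow_normalizer[OF N chains q(1,2)])
  note l = maxinD[OF L(1)]
  have subQ: "subgroup Q G" using Q by (rule sylow_subD)
  have QN: "Q \<subseteq> N" using Q by (rule sylow_subD)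
  obtain j where j: "card Q = q ^ j" using sylow_subD(3)[OF Q] by blast
  have qQ: "q dvd card Q" using sylow_nontrivial[OF subN Q q(2,1)] .
  have notLN: "\<not> L \<subseteq> N" using set_mult_subset[OF subN subset_refl, of L] L(3) False NG by blast
  then have M: "maxin Q L" using QL QN by blast
  note m = maxinD[OF M]
  have subNL: "subgroup (N \<inter> L) G" using subgroups_Inter_pair[OF subN l(1)] .
  \<comment> \<open>\<open>N \<inter> L\<close> contains \<open>Q\<close> and is not all of
    \<open>L\<close>, while \<open>Q\<close> is maximal in \<open>L\<close>.\<close>
  have NL: "N \<inter> L = Q" using m(4)[OF subNL] QN m(3) notLN by blast
  have Lnorm: "normalizes L Q"
  proof (intro ballI)
    fix l x assume lx: "l \<in> L" "x \<in> Q"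
    have lG: "l \<in> carrier G" using subgroup.mem_carrier[OF l(1) lx(1)] .
    have "l \<otimes> x \<otimes> inv l \<in> N" using normal_mem(1)[OF nN lG subsetD[OF QN lx(2)]] .
    moreover have "x \<in> L" using lx(2) m(3) by blast
    then have "l \<otimes> x \<otimes> inv l \<in> L" by (rule conj_mem[OF l(1) lx(1)])
    ultimately show "l \<otimes> x \<otimes> inv l \<in> Q" using NL by blast
  qed
  have "card (carrier G) * card Q = card N * card L" using card_set_mult[OF subN l(1)] L(3) NL by simp
  then have "card L = c * card Q" using c subgroup_card_pos[OF subN] by simp
  then have pL: "p dvd card L" using p(2) by simp
  obtain P where P: "sylow_sub p P L" using sylow_exists[OF p(1) l(1)] by blast
  have subP: "subgroup P G" using P by (rule sylow_subD)
  have PL: "P \<subseteq> L" using P by (rule sylow_subD)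
  obtain k where k: "card P = p ^ k" using sylow_subD(3)[OF P] by blast
  have pP: "p dvd card P" using sylow_nontrivial[OF l(1) P pL p(1)] .
  have cop: "coprime (card Q) (card P)" unfolding j k using p q qp primes_coprime by auto
  have QP: "Q \<inter> P = {\<one>}" using prime_power_coprime_subgroups[OF subQ subP cop] .
  have P1: "P \<noteq> {\<one>}" using pP p(1) by auto
  have Q1: "Q \<noteq> {\<one>}" using qQ q(1) by auto
  have "\<not> P \<subseteq> Q" using QP P1 subgroup.one_closed[OF subP] by blast
  then have QPL: "Q <#> P = L" using maxin_set_mult'[OF M subP PL] Lnorm PL by blast
  \<comment> \<open>The product of \<open>N\<close> and \<open>A\<close> contains \<open>Q\<close>
    and \<open>P\<close>, hence \<open>L\<close>, hence it is \<open>G\<close>. This brings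
    \<open>A\<close> into the scope of \<open>sn_supplement_eq_carrier\<close>.\<close>
  have not_sn: "\<not> sn A" if A: "P \<subseteq> A" "A \<subseteq> L" for A
  proof
    assume sn: "sn A"
    have subA: "subgroup A G" by (rule sn_imp_subgroup[OF sn])
    have NA: "subgroup (N <#> A) G"
      by (rule set_mult_subgroup[OF subN subA]) (use normal_mem(1)[OF nN] subgroup.mem_carrier[OF subA] in blast)
    have 1: "N \<subseteq> N <#> A" using subset_set_mult_left[OF NG subA] .
    have 2: "A \<subseteq> N <#> A" using subset_set_mult_right[OF subN subgroup.subset[OF subA]] .
    have "L \<subseteq> N <#> A" using set_mult_subset[OF NA, of Q P] QPL QN 1 2 A(1) by blast
    then have "N <#> A = carrier G"
      using set_mult_subset[OF NA 1, of L] L(3) subgroup.subset[OF NA] by blast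
    moreover have "A \<noteq> {\<one>}" using A(1) P1 subgroup.one_closed[OF subP] by blast
    ultimately have "A = carrier G" using sn_supplement_eq_carrier[OF sn N cent] by blast
    then show False using A(2) l(3) by blast
  qed
  have "\<not> Q \<subseteq> P" using QP Q1 subgroup.one_closed[OF subQ] by blast
  then have "P \<subset> L" using PL m(3) by blast
  then obtain K where K: "maxin K L" "P \<subseteq> K" using maxin_exists[OF subP l(1)] by blast
  have "K = P"
  proof (rule ccontr)
    assume "K \<noteq> P"
    then obtain K3 where K3: "maxin K3 K" "P \<subseteq> K3" using maxin_exists[OF subP maxinD(1)[OF K(1)]] K(2) by blast
    have "K3 \<subseteq> L" "K \<subseteq> L" using maxinD(3)[OF K(1)] maxinD(3)[OF K3(1)] by auto
    then have "\<not> sn K3" "\<not> sn K" "\<not> sn L"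
      using not_sn[OF K3(2)] not_sn[OF K(2)] not_sn[OF PL] by simp_all
    then show False using chains L(1) K(1) K3(1) unfolding sn_chains3_def by blast
  qed
  then have PM: "maxin P L" using K(1) by simp
  have "N \<inter> normer Q \<subseteq> Q" using L(2) NL by blast
  then have "N = Q"
    using minimal_normal_eq_sylow[OF N(1) p(1) q(1,2) qp Q k PM _ Lnorm] m(3) by blast
  then show False using j nonprimary_not_prime_power[OF N(2) q(1), of j] by simp
qed

end

context sigma_epi
begin

lemma sn_chains3_image:
  assumes "G.sn_chains3"
  shows "H.sn_chains3"
  unfolding H.sn_chains3_def
proof (intro allI impI)
  fix M1 M2 M3 assume M: "H.maxin M1 (carrier H)" "H.maxin M2 M1" "H.maxin M3 M2"
  then have "G.sn (pre M3) \<or> G.sn (pre M2) \<or> G.sn (pre M1)"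
    using assms maxin_pre[OF M(1)] maxin_pre[OF M(2)] maxin_pre[OF M(3)] unfolding G.sn_chains3_def pre_carrier by blast
  moreover have "h ` pre M1 = M1" "h ` pre M2 = M2" "h ` pre M3 = M3"
    using H.maxinD(1)[OF M(1)] H.maxinD(1)[OF M(2)] H.maxinD(1)[OF M(3)] image_pre subgroup.subset by metis+
  ultimately show "H.sn M3 \<or> H.sn M2 \<or> H.sn M1"
    using sn_image by metis
qed

lemma minimal_normal_image:
  assumes N: "G.minimal_normal N" and NK: "N \<inter> kernel G H h = {\<one>}"
  shows "H.minimal_normal (h ` N)" "card (h ` N) = card N"
proof -
  have nN: "N \<lhd> G" using N by (simp add: G.minimal_normal_def)
  have subN: "subgroup N G" using nN by (rule normal_imp_subgroup)
  show card: "card (h ` N) = card N" using card_image_mult[OF subN] NK by simp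
  have "h ` N \<noteq> {\<one>\<^bsub>H\<^esub>}"
  proof
    assume "h ` N = {\<one>\<^bsub>H\<^esub>}"
    then have "card N = 1" using card by simp
    then show False using N G.subgroup_trivialI_card[OF subN] by (simp add: G.minimal_normal_def)
  qed
  moreover have "K = {\<one>\<^bsub>H\<^esub>} \<or> K = h ` N" if K: "K \<lhd> H" "K \<subseteq> h ` N" for K
  proof -
    have "pre K \<inter> N \<lhd> G" using normal_pre[OF K(1)] nN G.normal_subgroup_intersect by blast
    then have "pre K \<inter> N = {\<one>} \<or> pre K \<inter> N = N" using N by (simp add: G.minimal_normal_def)
    moreover have "h ` (pre K \<inter> N) = K" using K(2) subgroup.mem_carrier[OF subN] by (auto simp: pre_def)
    ultimately show ?thesis by auto
  qed
  ultimately show "H.minimal_normal (h ` N)" using normal_image[OF nN] by (simp add: H.minimal_normal_def)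
qed

end

context sigma_group
begin

text \<open>If \<open>N\<close> meets its centralizer \<open>C\<close> trivially, it embeds in the
  quotient by \<open>C\<close>, where the image has trivial centralizer. Otherwise \<open>N\<close>
  is abelian, so a Sylow \<open>q\<close>-subgroup contains all its \<open>q\<close>-elements and
  \<open>N\<close> is a \<open>q\<close>-group.\<close>

lemma minimal_normal_not_nonprimary:
  assumes N: "minimal_normal N" and chains: sn_chains3
  shows "\<not> nonprimary (card N)"
proof
  assume np: "nonprimary (card N)"
  have nN: "N \<lhd> G" using N by (simp add: minimal_normal_def)
  have subN: "subgroup N G" using nN by (rule normal_imp_subgroup)
  have NG: "N \<subseteq> carrier G" by (rule subgroup.subset[OF subN])
  define C where "C = centralizer (carrier G) N"
  have subC: "subgroup C G" unfolding C_def by (rule centralizer_subgroup[OF subgroup_self NG])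
  have C: "C \<lhd> G"
  proof (rule normal_invI[OF subC])
    fix g c assume g: "g \<in> carrier G" and c: "c \<in> C"
    have cG: "c \<in> carrier G" using subgroup.mem_carrier[OF subC c] .
    have "g \<otimes> c \<otimes> inv g \<otimes> n = n \<otimes> (g \<otimes> c \<otimes> inv g)" if n: "n \<in> N" for n
    proof -
      have nG: "n \<in> carrier G" using n NG by blast
      have e: "c \<otimes> (inv g \<otimes> n \<otimes> g) = inv g \<otimes> n \<otimes> g \<otimes> c"
        using c normal_mem(2)[OF nN g n] by (simp add: C_def centralizer_def)
      have "g \<otimes> c \<otimes> inv g \<otimes> n = g \<otimes> (c \<otimes> (inv g \<otimes> n \<otimes> g)) \<otimes> inv g" using g cG nG by (simp add: m_assoc)
      also have "\<dots> = n \<otimes> (g \<otimes> c \<otimes> inv g)" unfolding e using g cG nG by (simp add: m_assoc)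
      finally show ?thesis .
    qed
    then show "g \<otimes> c \<otimes> inv g \<in> C" using g cG by (simp add: C_def centralizer_def)
  qed
  have "N \<inter> C \<lhd> G" using nN C normal_subgroup_intersect by blast
  then consider "N \<inter> C = {\<one>}" | "N \<inter> C = N" using N by (auto simp: minimal_normal_def)
  then show False
  proof cases
    case 1
    interpret q: sigma_epi G "G Mod C" "\<lambda>x. C #> x" \<sigma> by (rule sigma_epi_quotient[OF C])
    have ker: "kernel G (G Mod C) (\<lambda>x. C #> x) = C" using finite_group_quotient(4)[OF C] .
    note mn = q.minimal_normal_image[OF N, unfolded ker, OF 1]
    have "q.H.nonprimary (card ((\<lambda>x. C #> x) ` N))" using mn(2) np by (simp add: q.H.nonprimary_def nonprimary_def)
    moreover have "y = \<one>\<^bsub>G Mod C\<^esub>"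
      if y: "y \<in> carrier (G Mod C)" "\<forall>n\<in>(\<lambda>x. C #> x) ` N. y \<otimes>\<^bsub>G Mod C\<^esub> n = n \<otimes>\<^bsub>G Mod C\<^esub> y" for y
    proof -
      obtain x where x: "x \<in> carrier G" "y = C #> x" using y(1) q.surj by (metis imageE)
      have "x \<otimes> n = n \<otimes> x" if n: "n \<in> N" for n
      proof -
        have nG: "n \<in> carrier G" using n NG by blast
        \<comment> \<open>So the commutator of \<open>x\<close> and \<open>n\<close> lies in
          \<open>C\<close>. It lies in \<open>N\<close> as well, hence is trivial.\<close>
        have "C #> (x \<otimes> n) = C #> (n \<otimes> x)"
          using y(2)[rule_format, OF imageI[OF n]] q.hom_mult[OF x(1) nG] q.hom_mult[OF nG x(1)] x(2) by simp
        then have "(x \<otimes> n) \<otimes> inv (n \<otimes> x) \<in> C" using rcos_eq_mult_inv[OF subC] x(1) nG by simp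
        moreover have e: "(x \<otimes> n) \<otimes> inv (n \<otimes> x) = (x \<otimes> n \<otimes> inv x) \<otimes> inv n" using nG x(1) by (simp add: group_normalize)
        moreover have "\<dots> \<in> N" using subgroup.m_closed[OF subN normal_mem(1)[OF nN x(1) n] subgroup.m_inv_closed[OF subN n]] .
        ultimately have "(x \<otimes> n) \<otimes> inv (n \<otimes> x) = \<one>" using 1 by auto
        then have "(x \<otimes> n) \<otimes> inv (n \<otimes> x) \<otimes> (n \<otimes> x) = n \<otimes> x" using x(1) nG by simp
        then show ?thesis using x(1) nG by (simp add: m_assoc)
      qed
      then have "x \<in> C" using x(1) by (simp add: C_def centralizer_def)
      then show ?thesis using x coset_join2[OF x(1) subC] by simp
    qed
    ultimately show False
      using q.H.no_faithful_nonprimary_minimal_normal[OF mn(1)] q.sn_chains3_image[OF chains] by blast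
  next
    case 2
    then have comm: "x \<otimes> y = y \<otimes> x" if "x \<in> N" "y \<in> N" for x y
      using that unfolding C_def centralizer_def by blast
    have "card N \<noteq> 1" using nonprimary_not_prime_power[OF np, of 2 0] by simp
    then obtain q where q: "prime q" "q dvd card N" using prime_factor_nat by blast
    obtain Q where Q: "sylow_sub q Q N" using sylow_exists[OF q(1) subN] by blast
    have subQ: "subgroup Q G" using Q by (rule sylow_subD)
    obtain j where j: "card Q = q ^ j" using sylow_subD(3)[OF Q] by blast
    have "N \<subseteq> Q"
    proof (rule minimal_normal_subsetI[OF N q subQ])
      fix x k assume x: "x \<in> N" "x [^] (q ^ k :: nat) = \<one>"
      obtain b where b: "b \<in> N" "b \<otimes> x \<otimes> inv b \<in> Q" using p_element_conjugate_into_sylow[OF q(1) subN Q x] by blast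
      have "b \<in> carrier G" "x \<in> carrier G" using b(1) x(1) NG by auto
      then have "b \<otimes> x \<otimes> inv b = x" using comm[OF b(1) x(1)] by (simp add: m_assoc)
      then show "x \<in> Q" using b(2) by simp
    qed
    then have "N = Q" using sylow_subD(2)[OF Q] by blast
    then show False using j nonprimary_not_prime_power[OF np q(1), of j] by simp
  qed
qed

end

section \<open>Maximal subgroups that are not \<sigma>-subnormal\<close>

context finite_group
begin

lemma maxin_restrict_iff:
  assumes "subgroup M G"
  shows "finite_group.maxin (G\<lparr>carrier := M\<rparr>) A B \<longleftrightarrow> maxin A B \<and> B \<subseteq> M"
proof (cases "A \<subset> B \<and> B \<subseteq> M")
  case True
  then have *: "(subgroup K G \<and> K \<subseteq> M) \<and> A \<subseteq> K \<and> K \<subseteq> B \<longleftrightarrow> subgroup K G \<and> A \<subseteq> K \<and> K \<subseteq> B" for K by blast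
  show ?thesis
    unfolding finite_group.maxin_def[OF finite_group_subgroup[OF assms]] subgroup_restrict_iff[OF assms] maxin_def *
    using True by auto
next
  case False
  then show ?thesis
    unfolding finite_group.maxin_def[OF finite_group_subgroup[OF assms]] subgroup_restrict_iff[OF assms] maxin_def
    by auto
qed

text \<open>Centralizers are subgroups: \<open>P\<close> centralizes its generator \<open>x\<close>,
  so \<open>x\<close> is central in \<open>P\<close>, and then all of \<open>P\<close> is.\<close>

lemma generate_singleton_abelian:
  assumes x: "x \<in> carrier G" and P: "generate G {x} = P"
  shows "\<forall>y\<in>P. \<forall>z\<in>P. y \<otimes> z = z \<otimes> y"
proof -
  have subP: "subgroup P G" using generate_is_subgroup[of "{x}"] x P by auto
  have xP: "x \<in> P" using P generate.incl[of x "{x}" G] by auto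
  have gen: "P \<subseteq> A" if "subgroup A G" "x \<in> A" for A
    using generate_subgroup_incl[of "{x}" A] that P by auto
  have "P \<subseteq> centralizer P {x}"
    by (rule gen) (use centralizer_subgroup[OF subP, of "{x}"] x xP in \<open>auto simp: centralizer_def\<close>)
  then have "x \<in> centralizer P P" using xP by (auto simp: centralizer_def)
  then have "P \<subseteq> centralizer P P"
    using gen[OF centralizer_subgroup[OF subP subgroup.subset[OF subP]]] by blast
  then show ?thesis by (auto simp: centralizer_def)
qed

end

context sigma_group
begin

text \<open>\<open>n \<otimes> a \<otimes> inv n\<close> is a \<open>p\<close>-element differing
  from \<open>a\<close> by a factor in \<open>N\<close>, so it lies in \<open>A\<close>. Thus
  \<open>N\<close> and \<open>A\<close> normalize each other and meet trivially.\<close>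

lemma sn_p_subgroup_centralizes:
  assumes A: "sn A" "card A = p ^ k" and N: "N \<lhd> G" "\<pi> \<in> \<sigma>" "pi_number \<pi> (card N)"
    and p: "prime p" "p \<notin> \<pi>" and a: "a \<in> A" and n: "n \<in> N"
  shows "a \<otimes> n = n \<otimes> a"
proof -
  have subA: "subgroup A G" using sn_imp_subgroup[OF A(1)] .
  have subN: "subgroup N G" using N(1) by (rule normal_imp_subgroup)
  have aG: "a \<in> carrier G" and nG: "n \<in> carrier G"
    using subgroup.mem_carrier[OF subA a] subgroup.mem_carrier[OF subN n] .
  have "coprime (card A) (card N)" using pi_number_coprime_prime_power[OF N(3) p] A(2) by simp
  then have AN: "A \<inter> N = {\<one>}" using prime_power_coprime_subgroups[OF subA subN] by blast
  have "(n \<otimes> a \<otimes> inv n) [^] (p ^ k) = \<one>"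
    using conj_nat_pow[OF nG aG] pow_card_subgroup[OF subA a] A(2) nG by simp
  moreover have "n \<otimes> a \<otimes> inv n = a \<otimes> ((inv a \<otimes> n \<otimes> a) \<otimes> inv n)" using aG nG by (simp add: m_assoc)
  moreover have "(inv a \<otimes> n \<otimes> a) \<otimes> inv n \<in> N"
    using subgroup.m_closed[OF subN normal_mem(2)[OF N(1) aG n] subgroup.m_inv_closed[OF subN n]] .
  ultimately have "n \<otimes> a \<otimes> inv n \<in> A" using p_element_mem_sn[OF A(1) N p a] by metis
  then show ?thesis
    using commute_of_trivial_Int[OF AN a n subA subN] normal_mem(1)[OF N(1) aG n] by blast
qed

text \<open>As \<open>NL = G\<close>, the hypothesis puts every Sylow \<^term>\<open>p\<close>-subgroup into \<^term>\<open>L\<close>; \<^term>\<open>W\<close> is generated by the \<^term>\<open>p\<close>-elements.\<close>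
lemma normal_closure_of_sylow:
  assumes p: "prime p" "p dvd card (carrier G)" and P: "sylow_sub p P (carrier G)"
    and N: "N \<lhd> G" and L: "subgroup L G" "N <#> L = carrier G"
    and conj: "\<forall>m\<in>L. \<forall>y\<in>P. \<forall>n\<in>N. n \<otimes> (m \<otimes> y \<otimes> inv m) \<otimes> inv n \<in> L"
  obtains W where "W \<lhd> G" "W \<subseteq> L" "W \<noteq> {\<one>}" "P \<subseteq> W"
proof
  define W where "W = generate G {x \<in> carrier G. \<exists>k. x [^] (p ^ k :: nat) = \<one>}"
  have inW: "x \<in> W" if "x \<in> carrier G" "x [^] (p ^ k :: nat) = \<one>" for x k
    unfolding W_def using that by (intro generate.incl) blast
  have subP: "subgroup P G" using P by (rule sylow_subD)
  have subN: "subgroup N G" using N by (rule normal_imp_subgroup)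
  show "W \<lhd> G" unfolding W_def by (rule normal_generate_p_elements[OF normal_self])
  show "W \<subseteq> L" unfolding W_def
  proof (rule generate_subgroup_incl[OF _ L(1)], rule subsetI)
    fix x assume "x \<in> {x \<in> carrier G. \<exists>k. x [^] (p ^ k :: nat) = \<one>}"
    then obtain k where x: "x \<in> carrier G" "x [^] (p ^ k :: nat) = \<one>" by blast
    obtain b where b: "b \<in> carrier G" "b \<otimes> x \<otimes> inv b \<in> P"
      using p_element_conjugate_into_sylow[OF p(1) subgroup_self P x] by blast
    have "inv b \<in> N <#> L" using L(2) b by simp
    then obtain n m where nm: "n \<in> N" "m \<in> L" "inv b = n \<otimes> m" unfolding set_mult_def by blast
    have cl: "n \<in> carrier G" "m \<in> carrier G"
      using subgroup.mem_carrier[OF subN nm(1)] subgroup.mem_carrier[OF L(1) nm(2)] .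
    have "n \<otimes> (m \<otimes> (b \<otimes> x \<otimes> inv b) \<otimes> inv m) \<otimes> inv n = (n \<otimes> m) \<otimes> (b \<otimes> x \<otimes> inv b) \<otimes> inv (n \<otimes> m)"
      using cl b(1) x(1) by (simp add: group_normalize)
    also have "\<dots> = x" unfolding nm(3)[symmetric] using b(1) x(1) by (simp add: group_normalize)
    finally show "x \<in> L" using conj nm b(2) by metis
  qed
  obtain x where x: "x \<in> carrier G" "x \<noteq> \<one>" "x [^] p = \<one>"
    using p_elements_nontrivial[OF p(1) subgroup_self p(2)] by blast
  then have "x \<in> W" using inW[of x 1] by simp
  then show "W \<noteq> {\<one>}" using x(2) by blast
  obtain k where k: "card P = p ^ k" using sylow_subD(3)[OF P] by blast
  show "P \<subseteq> W"
    using inW pow_card_subgroup[OF subP] k subgroup.mem_carrier[OF subP] by auto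
qed

text \<open>For \<open>m\<close> in \<open>L\<close> the conjugate of \<open>A\<close> by
  \<open>m\<close> is again \<sigma>-subnormal and inside \<open>L\<close>. Conjugating one of its
  \<open>p\<close>-elements by \<open>n\<close> in \<open>N\<close> changes it by a factor in
  \<open>N\<close> only, so the result stays in that conjugate.\<close>

lemma normal_closure_of_sylow_below_sn:
  assumes p: "prime p" "p dvd card (carrier G)" "p \<notin> \<pi>" and P: "sylow_sub p P (carrier G)"
    and N: "N \<lhd> G" "\<pi> \<in> \<sigma>" "pi_number \<pi> (card N)" and L: "subgroup L G" "N <#> L = carrier G"
    and A: "sn A" "P \<subseteq> A" "A \<subseteq> L"
  obtains W where "W \<lhd> G" "W \<subseteq> L" "W \<noteq> {\<one>}" "P \<subseteq> W"
proof -
  have subP: "subgroup P G" using P by (rule sylow_subD)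
  have subN: "subgroup N G" using N(1) by (rule normal_imp_subgroup)
  obtain k where k: "card P = p ^ k" using sylow_subD(3)[OF P] by blast
  have "n \<otimes> (m \<otimes> y \<otimes> inv m) \<otimes> inv n \<in> L" if m: "m \<in> L" and y: "y \<in> P" and n: "n \<in> N" for m y n
  proof -
    have cl: "m \<in> carrier G" "y \<in> carrier G" "n \<in> carrier G"
      using subgroup.mem_carrier[OF L(1) m] subgroup.mem_carrier[OF subP y] subgroup.mem_carrier[OF subN n] .
    define a where "a = m \<otimes> y \<otimes> inv m"
    have aG: "a \<in> carrier G" using cl by (simp add: a_def)
    have a: "a \<in> conjug m A" using y A(2) by (auto simp: a_def conjug_def)
    have "a [^] (p ^ k) = \<one>"
      unfolding a_def using conj_nat_pow[OF cl(1,2)] pow_card_subgroup[OF subP y] k cl by simp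
    then have "(n \<otimes> a \<otimes> inv n) [^] (p ^ k) = \<one>" using conj_nat_pow[OF cl(3) aG] cl by simp
    moreover have "n \<otimes> a \<otimes> inv n = a \<otimes> ((inv a \<otimes> n \<otimes> a) \<otimes> inv n)" using aG cl by (simp add: m_assoc)
    moreover have "(inv a \<otimes> n \<otimes> a) \<otimes> inv n \<in> N"
      using subgroup.m_closed[OF subN normal_mem(2)[OF N(1) aG n] subgroup.m_inv_closed[OF subN n]] .
    ultimately have "n \<otimes> a \<otimes> inv n \<in> conjug m A"
      using p_element_mem_sn[OF sn_conjug[OF A(1) cl(1)] N p(1,3) a] by metis
    then show ?thesis using conjug_in_subgroup[OF L(1) A(3) m] by (auto simp: a_def)
  qed
  then show ?thesis using normal_closure_of_sylow[OF p(1,2) P N(1) L] that by blast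
qed

end

text \<open>Models the quotient by the core of a maximal subgroup that is not \<sigma>-subnormal;
  instances come from \<open>faithful_maximal_quotient\<close>.\<close>

locale faithful_maximal = sigma_group +
  fixes M N :: "'a set" and \<pi> :: "nat set" and p :: nat
  assumes M: "maxin M (carrier G)" and core: "\<And>K. K \<lhd> G \<Longrightarrow> K \<subseteq> M \<Longrightarrow> K = {\<one>}"
    and N: "minimal_normal N" and \<pi>: "\<pi> \<in> \<sigma>" "pi_number \<pi> (card N)"
    and p: "prime p" "p \<notin> \<pi>" "p dvd card (carrier G)"
begin

lemma N_normal: "N \<lhd> G" using N by (simp add: minimal_normal_def)

lemma N_subgroup: "subgroup N G" using N_normal by (rule normal_imp_subgroup)

lemma M_subgroup: "subgroup M G" using maxinD(1)[OF M] .

lemma N_not_subset: "\<not> N \<subseteq> M"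
  using core[OF N_normal] N by (auto simp: minimal_normal_def)

lemma supplement: "N <#> M = carrier G"
  by (rule maxin_set_mult[OF M N_subgroup subgroup.subset[OF N_subgroup] N_not_subset])
    (use normal_mem(1)[OF N_normal] subgroup.mem_carrier[OF M_subgroup] in blast)

lemma p_not_dvd: "\<not> p dvd card N"
  using \<pi>(2) p by (auto simp: pi_number_def)

lemma index_dvd: "card (carrier G) div card M dvd card N"
proof -
  have "card M dvd card (carrier G)" using subgroup_card_dvd maxinD[OF M] by blast
  then obtain e where e: "card (carrier G) = card M * e" by blast
  have "card M * (e * card (N \<inter> M)) = card M * card N"
    using card_set_mult[OF N_subgroup M_subgroup] supplement e by (simp add: mult_ac)
  then have "e * card (N \<inter> M) = card N" using subgroup_card_pos[OF M_subgroup] by auto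
  then have "e dvd card N" by (metis dvd_triv_left)
  then show ?thesis using e subgroup_card_pos[OF M_subgroup] by simp
qed

text \<open>The index of \<open>M\<close> divides \<open>card N\<close>, which is prime to
  \<open>p\<close>.\<close>

lemma sylow_carrier:
  assumes P: "sylow_sub p P M"
  shows "sylow_sub p P (carrier G)"
proof -
  have subP: "subgroup P G" using P by (rule sylow_subD)
  obtain e where e: "card (carrier G) = card M * e" "e dvd card N"
    using index_dvd subgroup_card_dvd[OF M_subgroup subgroup_self subgroup.subset[OF M_subgroup]]
    by (metis dvd_mult_div_cancel)
  have "card (carrier G) = card P * ((card M div card P) * e)"
    using e(1) sylow_card(1)[OF M_subgroup P] by (metis mult.assoc)
  then have "card (carrier G) div card P = (card M div card P) * e" using subgroup_card_pos[OF subP] by simp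
  moreover have "\<not> p dvd e" using e(2) p_not_dvd dvd_trans by blast
  ultimately have "\<not> p dvd card (carrier G) div card P"
    using sylow_card(2)[OF M_subgroup P] p(1) by (simp add: prime_dvd_mult_iff)
  then show ?thesis using P subgroup.subset[OF subP] by (simp add: sylow_sub_def)
qed

text \<open>Otherwise \<open>M\<close> would contain a nontrivial normal subgroup of
  \<open>G\<close>, generated by \<open>p\<close>-elements, against \<open>core\<close>.\<close>

lemma no_sn_between:
  assumes P: "sylow_sub p P M" and A: "sn A" "P \<subseteq> A" "A \<subseteq> M"
  shows False
proof -
  obtain W where "W \<lhd> G" "W \<subseteq> M" "W \<noteq> {\<one>}" "P \<subseteq> W"
    by (rule normal_closure_of_sylow_below_sn[OF p(1,3,2) sylow_carrier[OF P] N_normal \<pi> M_subgroup supplement A])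
  then show False using core by blast
qed

text \<open>If \<open>P\<close> centralized \<open>N\<close>, so would its conjugates under
  \<open>M\<close>; conjugation by \<open>N\<close> would leave them inside \<open>M\<close>, and
  \<open>normal_closure_of_sylow\<close> would contradict \<open>core\<close>.\<close>

lemma sylow_not_centralizing:
  assumes P: "sylow_sub p P M"
  shows "\<exists>y\<in>P. \<exists>n\<in>N. y \<otimes> n \<noteq> n \<otimes> y"
proof (rule ccontr)
  assume c: "\<not> (\<exists>y\<in>P. \<exists>n\<in>N. y \<otimes> n \<noteq> n \<otimes> y)"
  have subP: "subgroup P G" using P by (rule sylow_subD)
  have PM: "P \<subseteq> M" using P by (rule sylow_subD)
  have "n \<otimes> (m \<otimes> y \<otimes> inv m) \<otimes> inv n \<in> M" if m: "m \<in> M" and y: "y \<in> P" and n: "n \<in> N" for m y n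
  proof -
    have cl: "m \<in> carrier G" "y \<in> carrier G" "n \<in> carrier G"
      using subgroup.mem_carrier[OF M_subgroup m] subgroup.mem_carrier[OF subP y] subgroup.mem_carrier[OF N_subgroup n] .
    have e: "y \<otimes> (inv m \<otimes> n \<otimes> m) = inv m \<otimes> n \<otimes> m \<otimes> y" using c y normal_mem(2)[OF N_normal cl(1) n] by blast
    have "n \<otimes> (m \<otimes> y \<otimes> inv m) \<otimes> inv n = m \<otimes> (inv m \<otimes> n \<otimes> m \<otimes> y) \<otimes> inv m \<otimes> inv n" using cl by (simp add: m_assoc)
    also have "\<dots> = m \<otimes> y \<otimes> inv m" unfolding e[symmetric] using cl by (simp add: m_assoc)
    finally show ?thesis using conj_mem[OF M_subgroup m subsetD[OF PM y]] by simp
  qed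
  then have "\<forall>m\<in>M. \<forall>y\<in>P. \<forall>n\<in>N. n \<otimes> (m \<otimes> y \<otimes> inv m) \<otimes> inv n \<in> M" by blast
  then obtain W where "W \<lhd> G" "W \<subseteq> M" "W \<noteq> {\<one>}" "P \<subseteq> W"
    by (rule normal_closure_of_sylow[OF p(1,3) sylow_carrier[OF P] N_normal M_subgroup supplement])
  then show False using core by blast
qed

text \<open>\<open>M\<close> normalizes a Sylow \<open>q\<close>-subgroup \<open>Q\<close> of
  \<open>N\<close> that is not contained in \<open>M\<close>; by maximality \<open>Q\<close> is
  normal in \<open>G\<close>, hence equal to \<open>N\<close>.\<close>

lemma minimal_normal_prime_power_of_p_group:
  assumes k: "card M = p ^ k"
  obtains q j where "prime q" "card N = q ^ j"
proof -
  have "card N \<noteq> 1" using N subgroup_trivialI_card[OF N_subgroup] by (auto simp: minimal_normal_def)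
  then obtain q where q: "prime q" "q dvd card N" using prime_factor_nat by blast
  obtain Q where Q: "sylow_sub q Q N" "M \<subseteq> normer Q"
    using p_group_normalizes_sylow[OF p(1) q(1) M_subgroup k N_normal p_not_dvd] by blast
  have subQ: "subgroup Q G" using Q(1) by (rule sylow_subD)
  have QN: "Q \<subseteq> N" using Q(1) by (rule sylow_subD)
  obtain j where j: "card Q = q ^ j" using sylow_subD(3)[OF Q(1)] by blast
  have qQ: "q dvd card Q" using sylow_nontrivial[OF N_subgroup Q(1) q(2,1)] .
  have "\<not> q dvd card M"
    using k p_not_dvd q p(1) by (metis prime_dvd_power primes_dvd_imp_eq)
  then have "\<not> Q \<subseteq> M" using subgroup_card_dvd[OF subQ M_subgroup] qQ dvd_trans by blast
  then have "normer Q \<noteq> M" using subset_normer[OF subQ] by blast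
  then have "normer Q = carrier G"
    using maxinD(4)[OF M normer_subgroup[OF subQ] Q(2)] by (auto simp: normer_def)
  then have "Q \<lhd> G" using subQ normal_iff_normer by blast
  then have "Q = N" using N QN qQ q(1) by (auto simp: minimal_normal_def)
  then show ?thesis using that q(1) j by blast
qed

text \<open>Take \<open>Q\<close> normalized by \<open>P\<close> and suppose it is proper in
  \<open>N\<close>. A \<sigma>-subnormal subgroup between \<open>P\<close> and a maximal
  \<open>L\<close> over the normalizer of \<open>Q\<close> would give a normal \<open>W\<close>
  inside \<open>L\<close> containing \<open>P\<close>; it meets \<open>N\<close> trivially, so
  \<open>P\<close> would centralize \<open>N\<close>. Hence \<open>P\<close> is maximal in
  \<open>L\<close>, and \<open>minimal_normal_eq_sylow\<close> applies.\<close>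

lemma minimal_normal_prime_power:
  assumes P: "sylow_sub p P M"
    and sn3: "\<And>M1 M2 M3. maxin M1 (carrier G) \<Longrightarrow> maxin M2 M1 \<Longrightarrow> maxin M3 M2 \<Longrightarrow> sn M3"
  obtains q j where "prime q" "card N = q ^ j"
proof -
  have "card N \<noteq> 1" using N subgroup_trivialI_card[OF N_subgroup] by (auto simp: minimal_normal_def)
  then obtain q where q: "prime q" "q dvd card N" using prime_factor_nat by blast
  have qp: "q \<noteq> p" using q(2) p_not_dvd by blast
  have subP: "subgroup P G" using P by (rule sylow_subD)
  obtain k where k: "card P = p ^ k" using sylow_subD(3)[OF P] by blast
  note PG = sylow_carrier[OF P]
  obtain Q where Q: "sylow_sub q Q N" "P \<subseteq> normer Q"
    using p_group_normalizes_sylow[OF p(1) q(1) subP k N_normal p_not_dvd] by blast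
  have subQ: "subgroup Q G" using Q(1) by (rule sylow_subD)
  have QN: "Q \<subseteq> N" using Q(1) by (rule sylow_subD)
  obtain j where j: "card Q = q ^ j" using sylow_subD(3)[OF Q(1)] by blast
  have qQ: "q dvd card Q" using sylow_nontrivial[OF N_subgroup Q(1) q(2,1)] .
  have "Q = N"
  proof (rule ccontr)
    assume ne: "Q \<noteq> N"
    then obtain L where L: "maxin L (carrier G)" "normer Q \<subseteq> L" and NL: "N <#> L = carrier G" and notN: "\<not> N \<subseteq> L"
      by (rule maximal_over_normer[OF N q Q(1)])
    note l = maxinD[OF L(1)]
    have QL: "Q \<subseteq> L" using subset_normer[OF subQ] L(2) by blast
    have PL: "P \<subseteq> L" using Q(2) L(2) by blast
    have not_sn: "\<not> sn A" if A: "P \<subseteq> A" "A \<subseteq> L" for A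
    proof
      assume sn: "sn A"
      obtain W where W: "W \<lhd> G" "W \<subseteq> L" "W \<noteq> {\<one>}" "P \<subseteq> W"
        by (rule normal_closure_of_sylow_below_sn[OF p(1,3,2) PG N_normal \<pi> l(1) NL sn A])
      have "W \<inter> N \<lhd> G" using W(1) N_normal normal_subgroup_intersect by blast
      then have WN: "W \<inter> N = {\<one>}" using N W(2) notN by (auto simp: minimal_normal_def)
      have "y \<otimes> n = n \<otimes> y" if y: "y \<in> P" and n: "n \<in> N" for y n
        by (rule normal_subgroups_commute[OF W(1) N_normal WN subsetD[OF W(4) y] n])
      then show False using sylow_not_centralizing[OF P] by blast
    qed
    have "coprime (card Q) (card P)" unfolding j k using p q qp primes_coprime by auto
    then have QP: "Q \<inter> P = {\<one>}" using prime_power_coprime_subgroups[OF subQ subP] by blast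
    moreover have "Q \<noteq> {\<one>}" using qQ q(1) by auto
    ultimately have notQ: "\<not> Q \<subseteq> P" using subgroup.one_closed[OF subQ] by blast
    then have "P \<subset> L" using PL QL by blast
    then obtain K where K: "maxin K L" "P \<subseteq> K" using maxin_exists[OF subP l(1)] by blast
    have "K = P"
    proof (rule ccontr)
      assume "K \<noteq> P"
      then obtain K3 where K3: "maxin K3 K" "P \<subseteq> K3" using maxin_exists[OF subP maxinD(1)[OF K(1)]] K(2) by blast
      have "K3 \<subseteq> L" using maxinD(3)[OF K(1)] maxinD(3)[OF K3(1)] by auto
      then show False using not_sn[OF K3(2)] sn3[OF L(1) K(1) K3(1)] by blast
    qed
    then have PM: "maxin P L" using K(1) by simp
    have QPL: "Q <#> P = L"
      by (rule maxin_set_mult[OF PM subQ QL notQ]) (use Q(2) in \<open>auto simp: normer_def\<close>)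
    have "Q <#> P \<subseteq> normer Q"
      using set_mult_subset[OF normer_subgroup[OF subQ] subset_normer[OF subQ] Q(2)] .
    then have Lnorm: "normalizes L Q" using QPL by (auto simp: normer_def)
    have "coprime (card N) (card P)"
      using pi_number_coprime_prime_power[OF \<pi>(2) p(1,2), of k] k by (simp add: coprime_commute)
    then have NP: "N \<inter> P = {\<one>}" using prime_power_coprime_subgroups[OF N_subgroup subP] by blast
    \<comment> \<open>Dedekind's argument for \<open>L = Q P\<close>, now with
      \<open>N \<inter> P\<close> trivial.\<close>
    have "N \<inter> normer Q \<subseteq> Q"
    proof
      fix x assume x: "x \<in> N \<inter> normer Q"
      then have "x \<in> Q <#> P" using L(2) QPL by blast
      then obtain u y where uy: "u \<in> Q" "y \<in> P" "x = u \<otimes> y" unfolding set_mult_def by blast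
      have cl: "u \<in> carrier G" "y \<in> carrier G" using subgroup.mem_carrier[OF subQ uy(1)] subgroup.mem_carrier[OF subP uy(2)] .
      have uN: "u \<in> N" using uy(1) QN by blast
      have "inv u \<otimes> x \<in> N" using subgroup.m_closed[OF N_subgroup subgroup.m_inv_closed[OF N_subgroup uN]] x by blast
      then have "y \<in> N" using uy(3) cl by simp
      then have "y = \<one>" using uy(2) NP by blast
      then show "x \<in> Q" using uy cl by simp
    qed
    then have "N = Q"
      using minimal_normal_eq_sylow[OF N p(1) q qp Q(1) k PM QL Lnorm] by blast
    then show False using ne by blast
  qed
  then show ?thesis using that q(1) j by blast
qed

end

context sigma_epi
begin

lemma maxin_image:
  assumes M: "G.maxin A B" and ker: "kernel G H h \<subseteq> A"
  shows "H.maxin (h ` A) (h ` B)"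
proof -
  note m = G.maxinD[OF M]
  have pA: "pre (h ` A) = A" "pre (h ` B) = B"
    using pre_image[OF m(1) ker] pre_image[OF m(2)] ker m(3) by auto
  have "h ` A \<noteq> h ` B" using pA m(3) by (metis psubset_eq)
  then have "h ` A \<subset> h ` B" using m(3) by blast
  moreover have "K = h ` A \<or> K = h ` B" if K: "subgroup K H" "h ` A \<subseteq> K" "K \<subseteq> h ` B" for K
  proof -
    have "pre K = A \<or> pre K = B"
      using m(4)[OF pre_subgroup[OF K(1)]] pre_mono[OF K(2)] pre_mono[OF K(3)] pA by simp
    moreover have "h ` pre K = K" using image_pre subgroup.subset[OF K(1)] by blast
    ultimately show ?thesis by auto
  qed
  ultimately show ?thesis using m(1,2) subgroup_img_is_subgroup by (simp add: H.maxin_def)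
qed

lemma sylow_image:
  assumes p: "prime p" and B: "subgroup B G" and P: "G.sylow_sub p P B"
  shows "H.sylow_sub p (h ` P) (h ` B)"
proof -
  have subP: "subgroup P G" using P by (rule G.sylow_subD)
  have PB: "P \<subseteq> B" using P by (rule G.sylow_subD)
  obtain k where k: "card P = p ^ k" using G.sylow_subD(3)[OF P] by blast
  have "card (h ` P) dvd p ^ k" using card_image_mult[OF subP] k by (metis dvd_triv_left)
  then obtain j where "card (h ` P) = p ^ j" using p by (meson divides_primepow_nat)
  moreover have "\<not> p dvd card (h ` B) div card (h ` P)"
    using index_image_dvd[OF subP B PB] G.sylow_card(2)[OF B P] dvd_trans by blast
  ultimately show ?thesis using subgroup_img_is_subgroup[OF subP] PB by (auto simp: H.sylow_sub_def)
qed

lemma sn3_image: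
  assumes sn3: "\<And>M1 M2 M3. G.maxin M1 (carrier G) \<Longrightarrow> G.maxin M2 M1 \<Longrightarrow> G.maxin M3 M2 \<Longrightarrow> G.sn M3"
    and M: "H.maxin M1 (carrier H)" "H.maxin M2 M1" "H.maxin M3 M2"
  shows "H.sn M3"
proof -
  have "G.sn (pre M3)"
    using sn3 maxin_pre[OF M(1)] maxin_pre[OF M(2)] maxin_pre[OF M(3)] unfolding pre_carrier by blast
  moreover have "h ` pre M3 = M3" using image_pre subgroup.subset[OF H.maxinD(1)[OF M(3)]] by blast
  ultimately show ?thesis using sn_image by metis
qed

text \<open>An element of \<^term>\<open>P\<close> whose image does not centralize \<^term>\<open>N\<close> lies in no maximal subgroup of \<^term>\<open>P\<close>.\<close>
lemma sylow_abelian: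
  assumes fm: "faithful_maximal H \<sigma> (h ` M) N \<pi> p" and M: "subgroup M G" and P: "G.sylow_sub p P M"
    and sn: "\<And>A. G.maxin A P \<Longrightarrow> G.sn A"
  shows "\<forall>x\<in>P. \<forall>y\<in>P. x \<otimes> y = y \<otimes> x"
proof -
  interpret fm: faithful_maximal H \<sigma> "h ` M" N \<pi> p by fact
  have subP: "subgroup P G" using P by (rule G.sylow_subD)
  obtain k where k: "card P = p ^ k" using G.sylow_subD(3)[OF P] by blast
  obtain y n where yn: "y \<in> P" "n \<in> N" "h y \<otimes>\<^bsub>H\<^esub> n \<noteq> n \<otimes>\<^bsub>H\<^esub> h y"
    using fm.sylow_not_centralizing[OF sylow_image[OF fm.p(1) M P]] by blast
  have yG: "y \<in> carrier G" using subgroup.mem_carrier[OF subP yn(1)] .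
  have gP: "generate G {y} \<subseteq> P" using G.generate_subgroup_incl[of "{y}" P] yn(1) subP by auto
  have subg: "subgroup (generate G {y}) G" using G.generate_is_subgroup yG by auto
  have "generate G {y} = P"
  proof (rule ccontr)
    assume "generate G {y} \<noteq> P"
    then obtain A where A: "G.maxin A P" "generate G {y} \<subseteq> A" using G.maxin_exists[OF subg subP] gP by blast
    have subA: "subgroup A G" using G.maxinD(1)[OF A(1)] .
    have "card (h ` A) dvd p ^ k"
      using card_image_mult[OF subA] k G.subgroup_card_dvd[OF subA subP] G.maxinD(3)[OF A(1)]
      by (metis dvd_trans dvd_triv_left psubset_imp_subset)
    then obtain j where j: "card (h ` A) = p ^ j" using fm.p(1) by (meson divides_primepow_nat)
    have "h y \<in> h ` A" using A(2) generate.incl[of y "{y}" G] by blast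
    then have "h y \<otimes>\<^bsub>H\<^esub> n = n \<otimes>\<^bsub>H\<^esub> h y"
      using H.sn_p_subgroup_centralizes[OF sn_image[OF sn[OF A(1)]] j fm.N_normal fm.\<pi> fm.p(1,2) _ yn(2)] by blast
    then show False using yn(3) by blast
  qed
  then show ?thesis using G.generate_singleton_abelian[OF yG] by blast
qed

end

context finite_group
begin

lemma minimal_normal_exists:
  assumes "carrier G \<noteq> {\<one>}"
  obtains N where "minimal_normal N"
proof -
  define S where "S = {N. N \<lhd> G \<and> N \<noteq> {\<one>}}"
  have "finite S"
    by (rule finite_subset[of _ "Pow (carrier G)"])
      (use finite_carrier subgroup.subset[OF normal_imp_subgroup] in \<open>auto simp: S_def\<close>)
  moreover have "carrier G \<in> S" using assms normal_self by (simp add: S_def)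
  ultimately obtain N where "N \<in> S" "\<forall>K\<in>S. K \<subseteq> N \<longrightarrow> K = N" using finite_has_minimal[of S] by blast
  then have "minimal_normal N" by (auto simp: minimal_normal_def S_def)
  then show ?thesis by (rule that)
qed

lemma solvable_subgroup_subset:
  assumes "subgroup B G" "solvable (G\<lparr>carrier := B\<rparr>)" "subgroup A G" "A \<subseteq> B"
  shows "solvable (G\<lparr>carrier := A\<rparr>)"
  using finite_group.solvable_subgroup'[OF finite_group_subgroup[OF assms(1)], of A] assms
    subgroup_restrict_iff[OF assms(1)] by simp

end

context sigma_epi
begin

lemma solvable_image:
  assumes A: "subgroup A G" and "solvable (G\<lparr>carrier := A\<rparr>)"
  shows "solvable (H\<lparr>carrier := h ` A\<rparr>)"
proof -
  have "h \<in> hom (G\<lparr>carrier := A\<rparr>) (H\<lparr>carrier := h ` A\<rparr>)"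
    using subgroup.mem_carrier[OF A] by (auto simp: hom_def)
  then have "group_hom (G\<lparr>carrier := A\<rparr>) (H\<lparr>carrier := h ` A\<rparr>) h"
    using G.subgroup_imp_group[OF A] H.subgroup_imp_group[OF subgroup_img_is_subgroup[OF A]]
    by (simp add: group_hom_def group_hom_axioms_def)
  then show ?thesis by (rule group_hom.surj_hom_imp_solvable) (use assms in simp_all)
qed

end

section \<open>Solvability from \<sigma>-subnormality along chains\<close>

context sigma_group
begin

text \<open>A prime \<open>p\<close> outside the class of \<open>N\<close> exists, since otherwise
  \<open>M\<close> would reach \<open>G\<close> in one step of primary index. The last conclusion
  serves to compare two classes in \<open>solvable_of_sn_maximals\<close>.\<close>

lemma faithful_maximal_quotient:
  assumes chains: sn_chains3 and M: "maxin M (carrier G)" and ns: "\<not> sn M"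
  obtains K N \<pi> p where "K \<lhd> G" "K \<subseteq> M" "faithful_maximal (G Mod K) \<sigma> ((\<lambda>x. K #> x) ` M) N \<pi> p"
    "pi_number \<pi> (card (carrier G) div card M)"
proof -
  note m = maxinD[OF M]
  define K where "K = core G M"
  have K: "K \<lhd> G" "K \<subseteq> M" "\<And>L. L \<lhd> G \<Longrightarrow> L \<subseteq> M \<Longrightarrow> L \<subseteq> K"
    using core_greatest[OF m(1)] by (simp_all add: K_def)
  have subK: "subgroup K G" using K(1) by (rule normal_imp_subgroup)
  define h where "h = (\<lambda>x. K #> x)"
  interpret q: sigma_epi G "G Mod K" h \<sigma> unfolding h_def by (rule sigma_epi_quotient[OF K(1)])
  have ker: "kernel G (G Mod K) h = K" unfolding h_def by (rule finite_group_quotient(4)[OF K(1)])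
  have pM: "q.pre (h ` M) = M" using q.pre_image[OF m(1)] K(2) ker by simp
  have hK: "h ` K = {K}"
    using coset_join2[OF subgroup.mem_carrier[OF subK] subK] subgroup.one_closed[OF subK] by (auto simp: h_def)
  have hM: "q.H.maxin (h ` M) (carrier (G Mod K))" using q.maxin_image[OF M] ker K(2) q.surj by simp
  have core: "L = {\<one>\<^bsub>G Mod K\<^esub>}" if L: "L \<lhd> G Mod K" "L \<subseteq> h ` M" for L
  proof -
    have subL: "subgroup L (G Mod K)" using L(1) by (rule normal_imp_subgroup)
    have "q.pre L \<subseteq> K" using K(3)[OF q.normal_pre[OF L(1)]] q.pre_mono[OF L(2)] pM by simp
    then have "h ` q.pre L \<subseteq> {K}" using hK by blast
    then have "L \<subseteq> {\<one>\<^bsub>G Mod K\<^esub>}" using q.image_pre[OF subgroup.subset[OF subL]] by simp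
    then show ?thesis using subgroup.one_closed[OF subL] by blast
  qed
  have "carrier (G Mod K) \<noteq> {\<one>\<^bsub>G Mod K\<^esub>}"
    using q.H.maxinD(3)[OF hM] subgroup.one_closed[OF q.H.maxinD(1)[OF hM]] by auto
  then obtain N where N: "q.H.minimal_normal N" by (rule q.H.minimal_normal_exists)
  obtain \<pi> where \<pi>: "\<pi> \<in> \<sigma>" "pi_number \<pi> (card N)"
    using q.H.minimal_normal_not_nonprimary[OF N q.sn_chains3_image[OF chains]] by (auto simp: q.H.nonprimary_def)
  have cardG: "card (carrier (G Mod K)) * card K = card (carrier G)"
    using q.card_image_mult[OF subgroup_self] ker q.surj subgroup.subset[OF subK] by (simp add: Int_absorb1)
  have cardM: "card (h ` M) * card K = card M"
    using q.card_image_mult[OF m(1)] ker K(2) by (simp add: Int_absorb1)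
  have "\<not> pi_number \<pi> (card (carrier (G Mod K)))"
  proof
    assume pi: "pi_number \<pi> (card (carrier (G Mod K)))"
    have "card (carrier G) div card K = card (carrier (G Mod K))"
      using cardG subgroup_card_pos[OF subK] by (metis div_mult_self_is_m)
    then have "pi_number \<pi> (card (carrier G) div card K)" using pi by simp
    moreover have "normalizes (carrier G) K" using normal_mem(1)[OF K(1)] by blast
    moreover have "M \<subseteq> carrier G" using m(3) by blast
    ultimately have "sigma_step M (carrier G)"
      unfolding sigma_step_def using m(1,2) subK K(2) \<pi>(1) by blast
    then show False using ns by blast
  qed
  then obtain p where p: "prime p" "p dvd card (carrier (G Mod K))" "p \<notin> \<pi>" by (auto simp: pi_number_def)
  have fm: "faithful_maximal (G Mod K) \<sigma> (h ` M) N \<pi> p"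
    by (intro faithful_maximal.intro faithful_maximal_axioms.intro q.H.sigma_group_axioms)
      (use hM core N \<pi> p in auto)
  have "card (carrier G) div card M = card (carrier (G Mod K)) div card (h ` M)"
    unfolding cardG[symmetric] cardM[symmetric] using subgroup_card_pos[OF subK] by simp
  then have "pi_number \<pi> (card (carrier G) div card M)"
    using faithful_maximal.index_dvd[OF fm] \<pi>(2) pi_number_dvd by simp
  then show ?thesis using that K(1,2) fm unfolding h_def by blast
qed

text \<open>The two alternatives in \<open>H\<close> correspond to the values 2 and 3 of the
  invariant. Once \<open>M\<close> is solvable and \<open>N\<close> has prime power order, the
  quotient by \<open>K\<close> is solvable as the product of \<open>N\<close> and the image of
  \<open>M\<close>, and \<open>K\<close> is solvable as a subgroup of \<open>M\<close>.\<close>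

lemma solvable_of_not_sn_maximal:
  assumes M: "maxin M (carrier G)" and ns: "\<not> sn M"
    and H: "(\<forall>M1 M2. maxin M1 (carrier G) \<longrightarrow> maxin M2 M1 \<longrightarrow> sn M2) \<or>
      (\<forall>M1 M2 M3. maxin M1 (carrier G) \<longrightarrow> maxin M2 M1 \<longrightarrow> maxin M3 M2 \<longrightarrow> sn M3)"
  shows "solvable G"
proof -
  have chains: sn_chains3 using H unfolding sn_chains3_def by blast
  note m = maxinD[OF M]
  obtain K N \<pi> p where K: "K \<lhd> G" "K \<subseteq> M" and fm: "faithful_maximal (G Mod K) \<sigma> ((\<lambda>x. K #> x) ` M) N \<pi> p"
    by (rule faithful_maximal_quotient[OF chains M ns])
  define h where "h = (\<lambda>x. K #> x)"
  interpret q: sigma_epi G "G Mod K" h \<sigma> unfolding h_def by (rule sigma_epi_quotient[OF K(1)])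
  interpret fm: faithful_maximal "G Mod K" \<sigma> "h ` M" N \<pi> p unfolding h_def by (rule fm)
  obtain P where P: "sylow_sub p P M" using sylow_exists[OF fm.p(1) m(1)] by blast
  have subP: "subgroup P G" using P by (rule sylow_subD)
  have PM: "P \<subseteq> M" using P by (rule sylow_subD)
  obtain k where k: "card P = p ^ k" using sylow_subD(3)[OF P] by blast
  have hP: "q.H.sylow_sub p (h ` P) (h ` M)" by (rule q.sylow_image[OF fm.p(1) m(1) P])
  have no: "\<not> sn A" if "P \<subseteq> A" "A \<subseteq> M" for A
    using fm.no_sn_between[OF hP q.sn_image image_mono[OF that(1)] image_mono[OF that(2)]] by blast
  have "solvable (G\<lparr>carrier := M\<rparr>) \<and> (\<exists>r j. prime r \<and> card N = r ^ j)"
  proof (cases "P = M")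
    case True
    have "card (h ` M) dvd p ^ k" using q.card_image_mult[OF m(1)] k True by (metis dvd_triv_left)
    then obtain j where j: "card (h ` M) = p ^ j" using fm.p(1) by (meson divides_primepow_nat)
    obtain r i where "prime r" "card N = r ^ i" by (rule fm.minimal_normal_prime_power_of_p_group[OF j])
    then show ?thesis using prime_power_subgroup_solvable[OF fm.p(1) m(1)] k True by blast
  next
    case False
    then obtain K2 where K2: "maxin K2 M" "P \<subseteq> K2" using maxin_exists[OF subP m(1)] PM by blast
    have K2M: "K2 \<subseteq> M" using maxinD(3)[OF K2(1)] by blast
    then have "\<not> sn K2" by (rule no[OF K2(2)])
    \<comment> \<open>\<open>K2\<close> is a second term that is not \<sigma>-subnormal, so only the
      second alternative of \<open>H\<close> can hold.\<close>
    then have sn3: "sn M3" if "maxin M1 (carrier G)" "maxin M2 M1" "maxin M3 M2" for M1 M2 M3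
      using H M K2(1) that by blast
    have "K2 = P"
    proof (rule ccontr)
      assume "K2 \<noteq> P"
      then obtain K3 where K3: "maxin K3 K2" "P \<subseteq> K3" using maxin_exists[OF subP maxinD(1)[OF K2(1)]] K2(2) by blast
      have "K3 \<subseteq> M" using maxinD(3)[OF K3(1)] K2M by blast
      then show False using no[OF K3(2)] sn3[OF M K2(1) K3(1)] by blast
    qed
    then have PM': "maxin P M" using K2(1) by simp
    have abel: "\<forall>x\<in>P. \<forall>y\<in>P. x \<otimes> y = y \<otimes> x"
      by (rule q.sylow_abelian[OF fm.faithful_maximal_axioms m(1) P]) (rule sn3[OF M PM'])
    interpret M: finite_group "G\<lparr>carrier := M\<rparr>" using m(1) by (rule finite_group_subgroup)
    have "M.maxin P (carrier (G\<lparr>carrier := M\<rparr>))" using maxin_restrict_iff[OF m(1)] PM' by simp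
    then have "solvable (G\<lparr>carrier := M\<rparr>)"
      using M.solvable_of_abelian_prime_power_maximal[OF fm.p(1) _ k] abel by simp
    moreover obtain r j where "prime r" "card N = r ^ j"
      by (rule fm.minimal_normal_prime_power[OF hP q.sn3_image[OF sn3]])
    ultimately show ?thesis by blast
  qed
  then obtain r j where solM: "solvable (G\<lparr>carrier := M\<rparr>)" and r: "prime r" "card N = r ^ j" by blast
  have "solvable (G Mod K)"
    using q.H.solvable_supplement[OF fm.N_normal _ fm.M_subgroup q.solvable_image[OF m(1) solM] fm.supplement]
      q.H.prime_power_subgroup_solvable[OF r(1) fm.N_subgroup r(2)] by blast
  moreover have "solvable (G\<lparr>carrier := K\<rparr>)"
    using solvable_subgroup_subset[OF m(1) solM normal_imp_subgroup[OF K(1)] K(2)] .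
  ultimately show ?thesis using solvable_extension[OF K(1)] by blast
qed

text \<open>No subgroup lies strictly between \<open>M\<close> and \<open>G\<close>, so the first
  step of the chain that leaves \<open>M\<close> already reaches \<open>G\<close>.\<close>

lemma sn_maximal_cases:
  assumes M: "maxin M (carrier G)" and sn: "sn M"
  obtains "M \<lhd> G" | C \<tau> where "C \<lhd> G" "C \<subseteq> M" "\<tau> \<in> \<sigma>" "pi_number \<tau> (card (carrier G) div card C)"
proof -
  note m = maxinD[OF M]
  have "y = M \<or> sigma_step M (carrier G)" if "sn_in M y" for y
    using that
  proof (induction rule: rtranclp_induct)
    case (step y z)
    show ?case
    proof (cases "y = M")
      case True
      then have "sigma_step M z" "subgroup z G" "M \<subseteq> z" using step(2) by (auto simp: sigma_step_def)
      then show ?thesis using m(4)[of z] subgroup.subset[of z G] by auto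
    next
      case False
      then show ?thesis using step.IH by blast
    qed
  qed simp
  from this[OF sn] have "sigma_step M (carrier G)" using m(3) by blast
  then show ?thesis
  proof (cases rule: sigma_stepE)
    case 1
    then show ?thesis using that(1) normal_invI[OF m(1)] by blast
  next
    case p: (2 C \<tau>)
    then show ?thesis using that(2) normal_invI[OF p(1)] by blast
  qed
qed

text \<open>Inside \<open>M\<close> the subgroup \<open>L\<close> plays the part of the maximal
  subgroup that is not \<sigma>-subnormal. All its maximal subgroups are third terms, hence
  \<sigma>-subnormal; so \<open>L\<close> is an abelian \<open>p\<close>-group and \<open>M\<close>
  is solvable. The single step from \<open>M\<close> to \<open>G\<close> then decides how to climb
  to \<open>G\<close>.\<close>

lemma solvable_of_sn_maximals:
  assumes sn1: "\<And>M1. maxin M1 (carrier G) \<Longrightarrow> sn M1"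
    and sn3: "\<And>M1 M2 M3. maxin M1 (carrier G) \<Longrightarrow> maxin M2 M1 \<Longrightarrow> maxin M3 M2 \<Longrightarrow> sn M3"
    and M: "maxin M (carrier G)" and L: "maxin L M" and ns: "\<not> sn L"
  shows "solvable G"
proof -
  note m = maxinD[OF M] and l = maxinD[OF L]
  interpret M: sigma_group "G\<lparr>carrier := M\<rparr>" \<sigma> using m(1) by (rule sigma_group_subgroup)
  have Msn: "M.sn A" if "sn A" "A \<subseteq> M" for A
    using sn_restrict[OF m(1) that(2)] sn_subgroup[OF that(1) m(1) that(2)] by simp
  have Mmax: "M.maxin A B \<longleftrightarrow> maxin A B \<and> B \<subseteq> M" for A B by (rule maxin_restrict_iff[OF m(1)])
  have sn2: "sn M2" "M2 \<subseteq> M" if "maxin M1 M" "maxin M2 M1" for M1 M2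
    using sn3[OF M that] maxinD(3)[OF that(1)] maxinD(3)[OF that(2)] by auto
  have "M.sn_chains3" unfolding M.sn_chains3_def Mmax using Msn sn2 by auto
  moreover have LM: "M.maxin L (carrier (G\<lparr>carrier := M\<rparr>))" using L Mmax by simp
  moreover have "\<not> M.sn L"
  proof
    assume "M.sn L"
    then have "sn_in L M" using sn_restrict[OF m(1)] l(3) by simp
    then have "sn L" using sn1[OF M] by (rule rtranclp_trans)
    then show False using ns by blast
  qed
  ultimately obtain K N \<pi> p where K: "K \<lhd> G\<lparr>carrier := M\<rparr>" "K \<subseteq> L"
    and fm: "faithful_maximal (G\<lparr>carrier := M\<rparr> Mod K) \<sigma> ((\<lambda>x. K #>\<^bsub>G\<lparr>carrier := M\<rparr>\<^esub> x) ` L) N \<pi> p"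
    and ind: "pi_number \<pi> (card (carrier (G\<lparr>carrier := M\<rparr>)) div card L)"
    by (rule M.faithful_maximal_quotient)
  define h where "h = (\<lambda>x. K #>\<^bsub>G\<lparr>carrier := M\<rparr>\<^esub> x)"
  interpret q: sigma_epi "G\<lparr>carrier := M\<rparr>" "G\<lparr>carrier := M\<rparr> Mod K" h \<sigma>
    unfolding h_def by (rule M.sigma_epi_quotient[OF K(1)])
  interpret fm: faithful_maximal "G\<lparr>carrier := M\<rparr> Mod K" \<sigma> "h ` L" N \<pi> p unfolding h_def by (rule fm)
  have subL: "subgroup L (G\<lparr>carrier := M\<rparr>)" using M.maxinD(1)[OF LM] .
  obtain P where P: "M.sylow_sub p P L" using M.sylow_exists[OF fm.p(1) subL] by blast
  have P': "subgroup P G" "P \<subseteq> L" using M.sylow_subD[OF P] subgroup_restrict_iff[OF m(1)] by auto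
  have hP: "q.H.sylow_sub p (h ` P) (h ` L)" by (rule q.sylow_image[OF fm.p(1) subL P])
  have PL: "P = L"
  proof (rule ccontr)
    assume "P \<noteq> L"
    then obtain K2 where K2: "maxin K2 L" "P \<subseteq> K2" using maxin_exists[OF P'(1) l(1)] P'(2) by blast
    have "K2 \<subseteq> L" using maxinD(3)[OF K2(1)] by blast
    then show False
      using fm.no_sn_between[OF hP q.sn_image[OF Msn[OF sn2[OF L K2(1)]]] image_mono[OF K2(2)] image_mono] by blast
  qed
  obtain k where k: "card L = p ^ k" using M.sylow_subD(3)[OF P] PL by blast
  have abel: "\<forall>x\<in>L. \<forall>y\<in>L. x \<otimes> y = y \<otimes> x"
  proof -
    have "\<forall>x\<in>L. \<forall>y\<in>L. x \<otimes>\<^bsub>G\<lparr>carrier := M\<rparr>\<^esub> y = y \<otimes>\<^bsub>G\<lparr>carrier := M\<rparr>\<^esub> x"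
    proof (rule q.sylow_abelian[OF fm.faithful_maximal_axioms subL])
      show "M.sylow_sub p L L" using P PL by simp
      show "M.sn A" if "M.maxin A L" for A
        using Msn[OF sn2[OF L]] that Mmax by blast
    qed
    then show ?thesis by simp
  qed
  have solM: "solvable (G\<lparr>carrier := M\<rparr>)"
    using M.solvable_of_abelian_prime_power_maximal[OF fm.p(1) LM k] abel by simp
  consider "M \<lhd> G" | C \<tau> where "C \<lhd> G" "C \<subseteq> M" "\<tau> \<in> \<sigma>" "pi_number \<tau> (card (carrier G) div card C)"
    by (rule sn_maximal_cases[OF M sn1[OF M]])
  then show ?thesis
  proof cases
    case 1
    then show ?thesis by (rule solvable_of_normal_maximal[OF M _ solM])
  next
    case (2 C \<tau>)
    note C = 2(1,2) and \<tau> = 2(3,4)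
    have subC: "subgroup C G" using C(1) by (rule normal_imp_subgroup)
    have CL: "subgroup (C <#> L) G"
      by (rule set_mult_subgroup[OF subC l(1)]) (use normal_mem(1)[OF C(1)] subgroup.mem_carrier[OF l(1)] in blast)
    have "L \<subseteq> C <#> L" by (rule subset_set_mult_right[OF subC subgroup.subset[OF l(1)]])
    moreover have "C <#> L \<subseteq> M" using set_mult_subset[OF m(1) C(2)] l(3) by blast
    ultimately consider "C <#> L = M" | "C <#> L = L" using l(4)[OF CL] by blast
    then show ?thesis
    proof cases
      case 1
      \<comment> \<open>\<open>L\<close> covers \<open>M\<close> modulo \<open>C\<close>, so in the
        quotient by \<open>C\<close> its image is an abelian maximal subgroup of prime power
        order.\<close>
      define g where "g = (\<lambda>x. C #> x)"
      interpret g: sigma_epi G "G Mod C" g \<sigma> unfolding g_def by (rule sigma_epi_quotient[OF C(1)])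
      have ker: "kernel G (G Mod C) g = C" unfolding g_def by (rule finite_group_quotient(4)[OF C(1)])
      have "g ` M = g ` L"
      proof
        show "g ` M \<subseteq> g ` L"
        proof
          fix y assume "y \<in> g ` M"
          then obtain x where x: "x \<in> C <#> L" "y = g x" using 1 by blast
          then obtain c u where cu: "c \<in> C" "u \<in> L" "x = c \<otimes> u" unfolding set_mult_def by blast
          have "x \<in> C #> u" using cu by (auto simp: r_coset_def)
          then have "C #> u = C #> x"
            using repr_independence[OF _ subgroup.mem_carrier[OF l(1) cu(2)] subC] by blast
          then show "y \<in> g ` L" using x(2) cu(2) by (auto simp: g_def)
        qed
      qed (use l(3) in blast)
      then have gL: "g.H.maxin (g ` L) (carrier (G Mod C))"
        using g.maxin_image[OF M] ker C(2) g.surj by simp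
      have "card (g ` L) dvd p ^ k" using g.card_image_mult[OF l(1)] k by (metis dvd_triv_left)
      then obtain j where j: "card (g ` L) = p ^ j" using fm.p(1) by (meson divides_primepow_nat)
      have "\<forall>x\<in>g ` L. \<forall>y\<in>g ` L. x \<otimes>\<^bsub>G Mod C\<^esub> y = y \<otimes>\<^bsub>G Mod C\<^esub> x"
      proof (intro ballI)
        fix x y assume "x \<in> g ` L" "y \<in> g ` L"
        then obtain u v where uv: "u \<in> L" "v \<in> L" "x = g u" "y = g v" by blast
        have "g (u \<otimes> v) = g (v \<otimes> u)" using abel uv(1,2) by simp
        then show "x \<otimes>\<^bsub>G Mod C\<^esub> y = y \<otimes>\<^bsub>G Mod C\<^esub> x"
          using g.hom_mult[OF subgroup.mem_carrier[OF l(1) uv(1)] subgroup.mem_carrier[OF l(1) uv(2)]]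
            g.hom_mult[OF subgroup.mem_carrier[OF l(1) uv(2)] subgroup.mem_carrier[OF l(1) uv(1)]] uv(3,4) by simp
      qed
      then have "solvable (G Mod C)"
        by (rule g.H.solvable_of_abelian_prime_power_maximal[OF fm.p(1) gL j])
      moreover have "solvable (G\<lparr>carrier := C\<rparr>)" by (rule solvable_subgroup_subset[OF m(1) solM subC C(2)])
      ultimately show ?thesis using solvable_extension[OF C(1)] by blast
    next
      case 2
      then have CL: "C \<subseteq> L" using subset_set_mult_left[OF subgroup.subset[OF subC] l(1)] by simp
      \<comment> \<open>The index of \<open>L\<close> in \<open>M\<close> exceeds 1 and is both a
        \<open>\<pi>\<close>- and a \<open>\<tau>\<close>-number, so the classes agree and
        \<open>p\<close> is outside \<open>\<tau>\<close>. The index of \<open>C\<close> in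
        \<open>L\<close>, a power of \<open>p\<close> and a \<open>\<tau>\<close>-number, is then 1,
        so \<open>L = C\<close> would be normal in \<open>G\<close>.\<close>
      obtain a where a: "card L = card C * a" using subgroup_card_dvd[OF subC l(1) CL] by blast
      obtain b where b: "card M = card L * b" using subgroup_card_dvd[OF l(1) m(1)] l(3) by blast
      obtain c where c: "card (carrier G) = card M * c" using subgroup_card_dvd[OF m(1,2)] m(3) by blast
      have "card (carrier G) div card C = a * b * c"
        using a b c subgroup_card_pos[OF subC] by (simp add: mult.assoc)
      then have pab: "pi_number \<tau> a" "pi_number \<tau> b" using \<tau>(2) pi_number_dvd by auto
      have "card M div card L = b" using b subgroup_card_pos[OF l(1)] by simp
      then have pb: "pi_number \<pi> b" using ind by simp
      have "b \<noteq> 1"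
      proof
        assume "b = 1"
        then have "L = M" using b l(3) subgroup_finite[OF m(1)] card_subset_eq[of M L] by auto
        then show False using l(3) by blast
      qed
      then obtain s where "prime s" "s dvd b" using prime_factor_nat by blast
      then have "\<pi> = \<tau>" using pab(2) pb class_unique[OF fm.\<pi>(1) \<tau>(1)] by (auto simp: pi_number_def)
      then have "p \<notin> \<tau>" using fm.p(2) by simp
      then have "coprime (p ^ k) a" using pi_number_coprime_prime_power[OF pab(1) fm.p(1)] by blast
      moreover have "a dvd p ^ k" using a k by (metis dvd_triv_right)
      ultimately have "a = 1" using coprime_common_divisor_nat[of "p ^ k" a a] dvd_refl[of a] by blast
      then have "C = L" using a CL card_subset_eq[OF subgroup_finite[OF l(1)] CL] by simp
      then have "sigma_step L (carrier G)"
        unfolding sigma_step_def using C(1) l(1) subgroup_self subgroup.subset[OF l(1)] normal_mem(1)[OF C(1)] by blast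
      then show ?thesis using ns by blast
    qed
  qed
qed

end

section \<open>Chains and chief factors\<close>

context finite_group
begin

lemma maximal_subgroup_restrict_iff:
  assumes "subgroup B G"
  shows "maximal_subgroup A (G\<lparr>carrier := B\<rparr>) \<longleftrightarrow> maxin A B"
  unfolding maximal_subgroup_def maxin_def subgroup_restrict_iff[OF assms]
  using assms by auto

lemma maximal_chain_iff:
  "maximal_chain G n M \<longleftrightarrow> M 0 = carrier G \<and> (\<forall>i<n. maxin (M (Suc i)) (M i))"
proof -
  have "maximal_chain G n M \<longleftrightarrow> M 0 = carrier G \<and> (\<forall>i<n. maximal_subgroup (M (Suc i)) (G\<lparr>carrier := M i\<rparr>))"
  proof -
    have "(\<forall>i\<in>{1..n}. R i (i - 1)) \<longleftrightarrow> (\<forall>i<n. R (Suc i) i)" for R :: "nat \<Rightarrow> nat \<Rightarrow> bool"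
      using ball_simps(9)[of Suc "{..<n}" "\<lambda>i. R i (i - 1)"] image_Suc_lessThan[of n] by auto
    from this[of "\<lambda>i j. maximal_subgroup (M i) (G\<lparr>carrier := M j\<rparr>)"] show ?thesis
      unfolding maximal_chain_def by simp
  qed
  also have "\<dots> \<longleftrightarrow> M 0 = carrier G \<and> (\<forall>i<n. maxin (M (Suc i)) (M i))"
  proof (intro conj_cong refl)
    assume M0: "M 0 = carrier G"
    show "(\<forall>i<n. maximal_subgroup (M (Suc i)) (G\<lparr>carrier := M i\<rparr>)) \<longleftrightarrow> (\<forall>i<n. maxin (M (Suc i)) (M i))"
    proof (intro iffI allI impI)
      fix i assume chain: "\<forall>i<n. maximal_subgroup (M (Suc i)) (G\<lparr>carrier := M i\<rparr>)" and "i < n"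
      \<comment> \<open>Translating one link requires its upper term to be a subgroup of
        \<open>G\<close>, which the earlier links provide.\<close>
      have "subgroup (M i) G" if "i \<le> n" for i using that
      proof (induction i)
        case 0
        then show ?case using M0 subgroup_self by simp
      next
        case (Suc i)
        then have "subgroup (M i) G" "i < n" by simp_all
        then have "maxin (M (Suc i)) (M i)" using chain maximal_subgroup_restrict_iff[of "M i"] by blast
        then show ?case by (rule maxinD(1))
      qed
      then show "maxin (M (Suc i)) (M i)" using chain \<open>i < n\<close> maximal_subgroup_restrict_iff by simp
    next
      fix i assume "\<forall>i<n. maxin (M (Suc i)) (M i)" "i < n"
      then show "maximal_subgroup (M (Suc i)) (G\<lparr>carrier := M i\<rparr>)"
        using maximal_subgroup_restrict_iff maxinD(2) by blast
    qed
  qed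
  finally show ?thesis .
qed

lemma n_maximal_subgroup_1_iff: "n_maximal_subgroup G 1 H \<longleftrightarrow> maxin H (carrier G)"
proof
  assume "n_maximal_subgroup G 1 H"
  then show "maxin H (carrier G)" by (auto simp: n_maximal_subgroup_def maximal_chain_iff)
next
  assume "maxin H (carrier G)"
  then have "maximal_chain G 1 (\<lambda>i. if i = 0 then carrier G else H)" by (simp add: maximal_chain_iff)
  then show "n_maximal_subgroup G 1 H" unfolding n_maximal_subgroup_def by force
qed

lemma n_maximal_subgroup_Suc_iff:
  "n_maximal_subgroup G (Suc (Suc n)) H \<longleftrightarrow> (\<exists>M. n_maximal_subgroup G (Suc n) M \<and> maxin H M)"
proof
  assume "n_maximal_subgroup G (Suc (Suc n)) H"
  then obtain M where "maximal_chain G (Suc (Suc n)) M" "M (Suc (Suc n)) = H" by (auto simp: n_maximal_subgroup_def)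
  then have "maximal_chain G (Suc n) M" "maxin H (M (Suc n))" by (auto simp: maximal_chain_iff)
  then show "\<exists>M. n_maximal_subgroup G (Suc n) M \<and> maxin H M" by (auto simp: n_maximal_subgroup_def)
next
  assume "\<exists>M. n_maximal_subgroup G (Suc n) M \<and> maxin H M"
  then obtain M where M: "maximal_chain G (Suc n) M" "maxin H (M (Suc n))" by (auto simp: n_maximal_subgroup_def)
  have "maximal_chain G (Suc (Suc n)) (M(Suc (Suc n) := H))"
    using M by (auto simp: maximal_chain_iff less_Suc_eq)
  then show "n_maximal_subgroup G (Suc (Suc n)) H" unfolding n_maximal_subgroup_def by force
qed

lemma order_restrict_quotient:
  assumes B: "subgroup B G" and N: "N \<lhd> G\<lparr>carrier := B\<rparr>"
  shows "order (G\<lparr>carrier := B\<rparr> Mod N) = card B div card N"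
proof -
  interpret B: finite_group "G\<lparr>carrier := B\<rparr>" using B by (rule finite_group_subgroup)
  have sub: "subgroup N (G\<lparr>carrier := B\<rparr>)" using N by (rule normal_imp_subgroup)
  have "card (rcosets\<^bsub>G\<lparr>carrier := B\<rparr>\<^esub> N) * card N = card B" using B.lagrange[OF sub] by (simp add: order_def)
  then show ?thesis using B.subgroup_card_pos[OF sub]
    by (simp add: FactGroup_def order_def) (metis div_mult_self_is_m)
qed

end

section \<open>Translation between \<open>sn\<close> and the given notions\<close>

context sigma_group
begin

lemma sigma_primary_iff: "sigma_primary \<sigma> H \<longleftrightarrow> (\<exists>\<pi>\<in>\<sigma>. pi_number \<pi> (order H))"
  by (simp add: sigma_primary_def pi_group_def pi_number_def)

text \<open>The core is the best witness: every admissible \<open>C\<close> lies in it, so its index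
  divides that of \<open>C\<close>.\<close>

lemma sigma_step_iff:
  assumes A: "subgroup A G" and B: "subgroup B G" and AB: "A \<subseteq> B"
  shows "sigma_step A B \<longleftrightarrow> A \<lhd> G\<lparr>carrier := B\<rparr> \<or>
    sigma_primary \<sigma> (G\<lparr>carrier := B\<rparr> Mod core (G\<lparr>carrier := B\<rparr>) A)"
proof -
  interpret B: finite_group "G\<lparr>carrier := B\<rparr>" using B by (rule finite_group_subgroup)
  define K where "K = core (G\<lparr>carrier := B\<rparr>) A"
  have A': "subgroup A (G\<lparr>carrier := B\<rparr>)" using A AB subgroup_restrict_iff[OF B] by blast
  have K: "K \<lhd> G\<lparr>carrier := B\<rparr>" "K \<subseteq> A" "\<And>N. N \<lhd> G\<lparr>carrier := B\<rparr> \<Longrightarrow> N \<subseteq> A \<Longrightarrow> N \<subseteq> K"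
    using B.core_greatest[OF A'] by (simp_all add: K_def)
  have K': "subgroup K G" "K \<subseteq> B" "normalizes B K" using K(1) normal_restrict_iff[OF B] by auto
  have prim: "sigma_primary \<sigma> (G\<lparr>carrier := B\<rparr> Mod K) \<longleftrightarrow> (\<exists>\<pi>\<in>\<sigma>. pi_number \<pi> (card B div card K))"
    by (simp add: sigma_primary_iff order_restrict_quotient[OF B K(1)])
  have "(\<exists>C \<pi>. subgroup C G \<and> C \<subseteq> A \<and> normalizes B C \<and> \<pi> \<in> \<sigma> \<and> pi_number \<pi> (card B div card C))
    \<longleftrightarrow> (\<exists>\<pi>\<in>\<sigma>. pi_number \<pi> (card B div card K))" (is "?L \<longleftrightarrow> ?R")
  proof
    assume ?L
    then obtain C \<pi> where C: "subgroup C G" "C \<subseteq> A" "normalizes B C"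
      and \<pi>: "\<pi> \<in> \<sigma>" "pi_number \<pi> (card B div card C)" by blast
    have CB: "C \<subseteq> B" using C(2) AB by blast
    have "C \<lhd> G\<lparr>carrier := B\<rparr>" using C CB normal_restrict_iff[OF B] by blast
    then have CK: "C \<subseteq> K" using K(3) C(2) by blast
    have "card B div card K dvd card B div card C"
    proof -
      obtain a where a: "card K = card C * a" using subgroup_card_dvd[OF C(1) K'(1) CK] by blast
      obtain b where b: "card B = card K * b" using subgroup_card_dvd[OF K'(1) B K'(2)] by blast
      have "card B div card C = a * b" using a b subgroup_card_pos[OF C(1)] by (simp add: mult.assoc)
      moreover have "card B div card K = b" using b subgroup_card_pos[OF K'(1)] by simp
      ultimately show ?thesis by simp
    qed
    then show ?R using \<pi> pi_number_dvd by blast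
  next
    assume ?R
    then show ?L using K(2) K' by blast
  qed
  then show ?thesis
    unfolding sigma_step_def prim[unfolded K_def, folded K_def] K_def[symmetric] prim
    using A B AB normal_restrict_iff[OF B, of A] by blast
qed

text \<open>Chains given as functions on indices are iterates of \<open>sigma_step\<close> by
  \<open>relpowp_fun_conv\<close>, after shifting the pairs \<open>i - 1\<close>, \<open>i\<close>
  to \<open>i\<close>, \<open>Suc i\<close>.\<close>

lemma sigma_subnormal_iff: "sigma_subnormal \<sigma> G A \<longleftrightarrow> subgroup A G \<and> sn A"
proof
  assume "sigma_subnormal \<sigma> G A"
  then obtain t :: nat and B :: "nat \<Rightarrow> 'a set" where B: "B 0 = A" "B t = carrier G" "\<forall>i\<le>t. subgroup (B i) G"
    and step: "\<forall>i\<in>{1..t}. B (i - 1) \<subseteq> B i \<and> (B (i - 1) \<lhd> G\<lparr>carrier := B i\<rparr> \<or>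
            sigma_primary \<sigma> (G\<lparr>carrier := B i\<rparr> Mod core (G\<lparr>carrier := B i\<rparr>) (B (i - 1))))"
    unfolding sigma_subnormal_def by blast
  have "sigma_step (B i) (B (Suc i))" if "i < t" for i
  proof -
    have "Suc i \<in> {1..t}" using that by simp
    then have "B i \<subseteq> B (Suc i) \<and> (B i \<lhd> G\<lparr>carrier := B (Suc i)\<rparr> \<or>
            sigma_primary \<sigma> (G\<lparr>carrier := B (Suc i)\<rparr> Mod core (G\<lparr>carrier := B (Suc i)\<rparr>) (B i)))"
      using step by (metis diff_Suc_1)
    then show ?thesis using sigma_step_iff[of "B i" "B (Suc i)"] B(3) that by simp
  qed
  then have "(sigma_step ^^ t) A (carrier G)" using B(1,2) by (auto simp: relpowp_fun_conv)
  then show "subgroup A G \<and> sn A" using relpowp_imp_rtranclp B(1,3) by fastforce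
next
  assume A: "subgroup A G \<and> sn A"
  then obtain t where "(sigma_step ^^ t) A (carrier G)" using rtranclp_imp_relpowp[of sigma_step A "carrier G"] by blast
  then obtain B :: "nat \<Rightarrow> 'a set" where B: "B 0 = A" "B t = carrier G" "\<forall>i<t. sigma_step (B i) (B (Suc i))"
    unfolding relpowp_fun_conv by blast
  have sub: "subgroup (B i) G" if "i \<le> t" for i
    using that B subgroup_self by (cases "i = t") (auto simp: sigma_step_def)
  have "B (i - 1) \<subseteq> B i \<and> (B (i - 1) \<lhd> G\<lparr>carrier := B i\<rparr> \<or>
            sigma_primary \<sigma> (G\<lparr>carrier := B i\<rparr> Mod core (G\<lparr>carrier := B i\<rparr>) (B (i - 1))))"
    if i: "i \<in> {1..t}" for i
  proof -
    obtain j where j: "i = Suc j" "j < t" using i by (cases i) auto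
    have s: "sigma_step (B j) (B (Suc j))" using B(3) j by blast
    then have "B j \<subseteq> B (Suc j)" by (simp add: sigma_step_def)
    then show ?thesis using sigma_step_iff[of "B j" "B (Suc j)"] s sub j by simp
  qed
  then show "sigma_subnormal \<sigma> G A" unfolding sigma_subnormal_def using B(1,2) sub by blast
qed

text \<open>Modulo \<open>K\<close> the image of \<open>H\<close> is a minimal normal subgroup, and
  the chain hypothesis passes to that quotient.\<close>

lemma chief_factor_primary:
  assumes chains: sn_chains3 and HK: "chief_factor G H K"
  shows "sigma_primary \<sigma> (G\<lparr>carrier := H\<rparr> Mod K)"
proof -
  have H: "H \<lhd> G" and K: "K \<lhd> G" and lt: "K \<subset> H" and no: "\<And>N. N \<lhd> G \<Longrightarrow> K \<subset> N \<Longrightarrow> N \<subset> H \<Longrightarrow> False"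
    using HK by (auto simp: chief_factor_def)
  have subH: "subgroup H G" and subK: "subgroup K G" using H K normal_imp_subgroup by auto
  define h where "h = (\<lambda>x. K #> x)"
  interpret q: sigma_epi G "G Mod K" h \<sigma> unfolding h_def by (rule sigma_epi_quotient[OF K])
  have ker: "kernel G (G Mod K) h = K" unfolding h_def by (rule finite_group_quotient(4)[OF K])
  have "H \<inter> K = K" using lt by blast
  then have card: "card (h ` H) * card K = card H" using q.card_image_mult[OF subH] ker by simp
  have "q.H.minimal_normal (h ` H)"
  proof -
    have "h ` H \<noteq> {\<one>\<^bsub>G Mod K\<^esub>}"
    proof
      assume "h ` H = {\<one>\<^bsub>G Mod K\<^esub>}"
      then have "card K = card H" using card by simp
      then show False using lt card_subset_eq[OF subgroup_finite[OF subH], of K] by blast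
    qed
    moreover have "L = {\<one>\<^bsub>G Mod K\<^esub>} \<or> L = h ` H" if L: "L \<lhd> G Mod K" "L \<subseteq> h ` H" for L
    proof -
      have subL: "subgroup L (G Mod K)" using L(1) by (rule normal_imp_subgroup)
      have "K \<subseteq> q.pre L" using q.kernel_subset_pre[OF subL] ker by simp
      moreover have "q.pre L \<subseteq> H" using q.pre_mono[OF L(2)] q.pre_image[OF subH] ker lt by auto
      ultimately have "q.pre L = K \<or> q.pre L = H" using no[OF q.normal_pre[OF L(1)]] by blast
      moreover have "h ` q.pre L = L" using q.image_pre subgroup.subset[OF subL] by blast
      moreover have "h ` K = {K}"
        using coset_join2[OF subgroup.mem_carrier[OF subK] subK] subgroup.one_closed[OF subK] by (auto simp: h_def)
      ultimately show ?thesis by auto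
    qed
    ultimately show ?thesis using q.normal_image[OF H] by (simp add: q.H.minimal_normal_def)
  qed
  then obtain \<pi> where \<pi>: "\<pi> \<in> \<sigma>" "pi_number \<pi> (card (h ` H))"
    using q.H.minimal_normal_not_nonprimary q.sn_chains3_image[OF chains] by (auto simp: q.H.nonprimary_def)
  have KH: "K \<lhd> G\<lparr>carrier := H\<rparr>" using normal_restrict_supergroup[OF subH K] lt by blast
  have "card H div card K = card (h ` H)" using card subgroup_card_pos[OF subK] by (metis div_mult_self_is_m)
  then show ?thesis using \<pi> order_restrict_quotient[OF subH KH] by (auto simp: sigma_primary_iff)
qed

lemma sn_chains3_iff:
  "sn_chains3 \<longleftrightarrow> (\<forall>M. maximal_chain G 3 M \<longrightarrow>
     sigma_subnormal \<sigma> G (M 3) \<or> sigma_subnormal \<sigma> G (M 2) \<or> sigma_subnormal \<sigma> G (M 1))" (is "_ \<longleftrightarrow> ?R")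
proof
  assume chains: sn_chains3
  show ?R
  proof (intro allI impI)
    fix M assume M: "maximal_chain G 3 M"
    have "maxin (M (Suc i)) (M i)" if "i < 3" for i using M that by (simp add: maximal_chain_iff)
    from this[of 0] this[of 1] this[of 2] have "maxin (M 1) (carrier G)" "maxin (M 2) (M 1)" "maxin (M 3) (M 2)"
      using M by (simp_all add: maximal_chain_iff numeral_2_eq_2 numeral_3_eq_3)
    then show "sigma_subnormal \<sigma> G (M 3) \<or> sigma_subnormal \<sigma> G (M 2) \<or> sigma_subnormal \<sigma> G (M 1)"
      using chains sn_imp_subgroup unfolding sn_chains3_def sigma_subnormal_iff by blast
  qed
next
  assume R: ?R
  show sn_chains3
    unfolding sn_chains3_def
  proof (intro allI impI)
    fix M1 M2 M3 assume M: "maxin M1 (carrier G)" "maxin M2 M1" "maxin M3 M2"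
    define M where "M i = (if i = 0 then carrier G else if i = 1 then M1 else if i = 2 then M2 else M3)" for i :: nat
    have "maximal_chain G 3 M"
      using M by (auto simp: maximal_chain_iff M_def numeral_3_eq_3 less_Suc_eq)
    then show "sn M3 \<or> sn M2 \<or> sn M1"
      using R by (auto simp: sigma_subnormal_iff M_def)
  qed
qed

text \<open>If some maximal subgroup is not \<sigma>-subnormal, one lemma serves both values of
  \<open>n\<close>. Otherwise \<open>n = 2\<close> is excluded, as its witness would be a maximal
  subgroup, and for \<open>n = 3\<close> the witness is a second term that is not
  \<sigma>-subnormal.\<close>

lemma solvable_of_m_sigma_eq:
  assumes m: "m_sigma_eq \<sigma> G n" and n: "1 < n" "n \<le> 3"
  shows "solvable G"
proof -
  have n': "n = 2 \<or> n = 3" using n by auto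
  have sn: "sn H" if "n_maximal_subgroup G n H" for H
    using m that by (simp add: m_sigma_eq_def sigma_subnormal_iff)
  have nm1: "n_maximal_subgroup G (Suc 0) H \<longleftrightarrow> maxin H (carrier G)" for H
    using n_maximal_subgroup_1_iff by simp
  have nm2: "n_maximal_subgroup G 2 H \<longleftrightarrow> (\<exists>M. maxin M (carrier G) \<and> maxin H M)" for H
    using n_maximal_subgroup_Suc_iff[of 0 H] nm1 by (simp add: numeral_2_eq_2)
  have nm3: "n_maximal_subgroup G 3 H \<longleftrightarrow> (\<exists>M2 M. maxin M (carrier G) \<and> maxin M2 M \<and> maxin H M2)" for H
    using n_maximal_subgroup_Suc_iff[of 1 H] nm2 by (simp add: numeral_3_eq_3 numeral_2_eq_2) blast
  have sns: "(\<forall>M1 M2. maxin M1 (carrier G) \<longrightarrow> maxin M2 M1 \<longrightarrow> sn M2) \<or>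
      (\<forall>M1 M2 M3. maxin M1 (carrier G) \<longrightarrow> maxin M2 M1 \<longrightarrow> maxin M3 M2 \<longrightarrow> sn M3)"
    using n' sn nm2 nm3 by blast
  obtain H where H: "n_maximal_subgroup G (n - 1) H" "\<not> sigma_subnormal \<sigma> G H"
    using m n by (auto simp: m_sigma_eq_def)
  show ?thesis
  proof (cases "\<forall>M. maxin M (carrier G) \<longrightarrow> sn M")
    case False
    then show ?thesis using solvable_of_not_sn_maximal sns by blast
  next
    case True
    have "n \<noteq> 2"
    proof
      assume "n = 2"
      then have "maxin H (carrier G)" using H(1) nm1 by simp
      then show False using True H(2) sigma_subnormal_iff maxinD(1) by blast
    qed
    then have n3: "n = 3" using n' by blast
    then obtain M where M: "maxin M (carrier G)" "maxin H M" using H(1) nm2 by auto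
    have "\<not> sn H" using H(2) maxinD(1)[OF M(2)] by (simp add: sigma_subnormal_iff)
    moreover have "sn M3" if "maxin M1 (carrier G)" "maxin M2 M1" "maxin M3 M2" for M1 M2 M3
      using sn nm3 n3 that by blast
    ultimately show ?thesis using solvable_of_sn_maximals M True by blast
  qed
qed

end

theorem theorem1p4:
  fixes \<sigma> :: "nat set set" and G :: "('a, 'b) monoid_scheme"
  assumes "partition_on {p::nat. Factorial_Ring.prime p} \<sigma>"
    and "group G" and "finite (carrier G)"
  shows "((\<forall>M. maximal_chain G 3 M \<longrightarrow>
              sigma_subnormal \<sigma> G (M 3) \<or> sigma_subnormal \<sigma> G (M 2) \<or> sigma_subnormal \<sigma> G (M 1))
            \<longrightarrow> sigma_soluble \<sigma> G)
       \<and> (\<forall>n. m_sigma_eq \<sigma> G n \<and> 1 < n \<and> n \<le> 3 \<longrightarrow> solvable G)"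
proof -
  interpret sigma_group G \<sigma>
    using assms by (simp add: sigma_group_def sigma_group_axioms_def finite_group_def finite_group_axioms_def)
  show ?thesis
    using chief_factor_primary sn_chains3_iff solvable_of_m_sigma_eq by (auto simp: sigma_soluble_def)
qed

end
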